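(* Let $m\ge 2$ and let $\Omega\subset\mathbb{R}^m$ be a smoothly bounded domain. Then $\Omega$ is mean convex if and only if the function $x\mapsto -d_{\partial\Omega}(x)$ is subharmonic throughout $\Omega$.
   Context: A domain is a nonempty connected open set. "Smoothly bounded" means bounded with smooth ($C^\infty$) boundary. $d_{\partial\Omega}(x)=\inf_{w\in\partial\Omega}\|x-w\|$ is the Euclidean distance to the boundary. Let $\nu(w)$ be the inward unit normal to $\partial\Omega$ at $w$. The principal curvatures $\kappa_1,\dots,\kappa_{m-1}$ of $\partial\Omega$ at $w$ are the eigenvalues of the second fundamental form $\mathrm{II}(w)(X,Y)=-\langle d\nu(w)(X),Y\rangle$ on $T_w\partial\Omega$ (with the inner product induced from $\mathbb{R}^m$); with this sign convention the unit ball has all principal curvatures equal to $1$. The mean curvature is $H(w)=\frac{\kappa_1+\cdots+\kappa_{m-1}}{m-1}$. The domain $\Omega$ is mean convex if $H(w)\ge0$ for every $w\in\partial\Omega$. *)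

theory Defs
  imports "HOL-Analysis.Analysis"
begin

(* C^k via iterated directional derivatives; on an open set this is the usual notion, since
   C^k regularity of all first-order directional derivatives is C^k regularity of the
   first-order partial derivatives. *)
primrec Ck_on :: "nat \<Rightarrow> ('a::real_normed_vector \<Rightarrow> 'b::real_normed_vector) \<Rightarrow> 'a set \<Rightarrow> bool" where
  "Ck_on 0 f U \<longleftrightarrow> continuous_on U f"
| "Ck_on (Suc k) f U \<longleftrightarrow>
     (\<forall>x\<in>U. f differentiable (at x)) \<and>
     (\<forall>v. Ck_on k (\<lambda>x. frechet_derivative f (at x) v) U)"

definition smooth_on :: "('a::real_normed_vector \<Rightarrow> 'b::real_normed_vector) \<Rightarrow> 'a set \<Rightarrow> bool" where
  "smooth_on f U \<longleftrightarrow> (\<forall>k. Ck_on k f U)"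

(* Smooth boundary by means of local defining functions. On such a U the boundary is
   exactly the regular level set {x \<in> U. \<rho> x = 0}, and \<Omega> lies on one side of it. *)
definition smooth_boundary :: "'a::euclidean_space set \<Rightarrow> bool" where
  "smooth_boundary \<Omega> \<longleftrightarrow>
     (\<forall>w\<in>frontier \<Omega>. \<exists>U (\<rho> :: 'a \<Rightarrow> real).
        open U \<and> w \<in> U \<and> smooth_on \<rho> U \<and>
        (\<forall>x\<in>U. frechet_derivative \<rho> (at x) \<noteq> (\<lambda>v. 0)) \<and>
        \<Omega> \<inter> U = {x \<in> U. \<rho> x < 0})"

definition smoothly_bounded_domain :: "'a::euclidean_space set \<Rightarrow> bool" where
  "smoothly_bounded_domain \<Omega> \<longleftrightarrow>
     \<Omega> \<noteq> {} \<and> connected \<Omega> \<and> open \<Omega> \<and> bounded \<Omega> \<and> smooth_boundary \<Omega>"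

(* Velocities at w of curves in S through w. *)
definition tangent_space :: "'a::real_normed_vector set \<Rightarrow> 'a \<Rightarrow> 'a set" where
  "tangent_space S w =
     {X. \<exists>(\<gamma> :: real \<Rightarrow> 'a) \<epsilon>. 0 < \<epsilon> \<and> \<gamma> 0 = w \<and> (\<forall>t\<in>{-\<epsilon><..<\<epsilon>}. \<gamma> t \<in> S) \<and>
           (\<gamma> has_vector_derivative X) (at 0)}"

definition inward_normal :: "'a::euclidean_space set \<Rightarrow> 'a \<Rightarrow> 'a" where
  "inward_normal \<Omega> w =
     (THE n. norm n = 1 \<and> (\<forall>X\<in>tangent_space (frontier \<Omega>) w. n \<bullet> X = 0) \<and>
             (\<exists>\<epsilon>>0. \<forall>t\<in>{0<..<\<epsilon>}. w + t *\<^sub>R n \<in> \<Omega>))"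

(* The normal field is differentiated along the hypersurface only. The derivative within
   frontier \<Omega> is determined only on tangent vectors, and second_fundamental_form is used
   below only for tangent X and Y. *)
definition second_fundamental_form :: "'a::euclidean_space set \<Rightarrow> 'a \<Rightarrow> 'a \<Rightarrow> 'a \<Rightarrow> real" where
  "second_fundamental_form \<Omega> w X Y =
     - (frechet_derivative (inward_normal \<Omega>) (at w within frontier \<Omega>) X \<bullet> Y)"

definition curvature_eigenspace :: "'a::euclidean_space set \<Rightarrow> 'a \<Rightarrow> real \<Rightarrow> 'a set" where
  "curvature_eigenspace \<Omega> w \<kappa> =
     {X \<in> tangent_space (frontier \<Omega>) w.
        \<forall>Y\<in>tangent_space (frontier \<Omega>) w. second_fundamental_form \<Omega> w X Y = \<kappa> * (X \<bullet> Y)}"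

definition principal_curvatures :: "'a::euclidean_space set \<Rightarrow> 'a \<Rightarrow> real set" where
  "principal_curvatures \<Omega> w = {\<kappa>. \<exists>X\<in>curvature_eigenspace \<Omega> w \<kappa>. X \<noteq> 0}"

(* principal_curvatures is a set, so the sum of the m - 1 principal curvatures weights each
   of them by its multiplicity, the dimension of its eigenspace. *)
definition mean_curvature :: "'a::euclidean_space set \<Rightarrow> 'a \<Rightarrow> real" where
  "mean_curvature \<Omega> w =
     (\<Sum>\<kappa>\<in>principal_curvatures \<Omega> w. real (dim (curvature_eigenspace \<Omega> w \<kappa>)) * \<kappa>)
       / (real DIM('a) - 1)"

definition mean_convex :: "'a::euclidean_space set \<Rightarrow> bool" where
  "mean_convex \<Omega> \<longleftrightarrow> (\<forall>w\<in>frontier \<Omega>. mean_curvature \<Omega> w \<ge> 0)"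

(* Subharmonicity of real-valued functions: upper semicontinuity and the sub-mean value
   inequality on every closed ball in \<Omega>. An upper semicontinuous function is bounded above on
   the ball, so a mean of at least u x > -\<infinity> entails integrability; it is required explicitly
   because a Bochner integral has the value 0 for a non-integrable function. *)
definition subharmonic_on :: "'a::euclidean_space set \<Rightarrow> ('a \<Rightarrow> real) \<Rightarrow> bool" where
  "subharmonic_on \<Omega> u \<longleftrightarrow>
     (\<forall>x\<in>\<Omega>. \<forall>c>u x. \<forall>\<^sub>F y in at x within \<Omega>. u y < c) \<and>
     (\<forall>x r. 0 < r \<longrightarrow> cball x r \<subseteq> \<Omega> \<longrightarrow>
        set_integrable lborel (cball x r) u \<and>
        u x \<le> (LINT y:cball x r|lborel. u y) / measure lborel (cball x r))"

end

theory Submission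
  imports Defs
begin

text \<open>
  Let \<open>u\<close> be minus the distance to the boundary. If the domain is mean convex, let \<open>x\<close> be an interior point and \<open>w\<close> a
  nearest boundary point. The distance near \<open>x\<close> is at most the length of the segment to the boundary in the direction of
  the normal at \<open>w\<close>, so \<open>u\<close> is touched from below at \<open>x\<close> by a function whose Laplacian is the sum of the principal
  curvatures at \<open>w\<close>. Hence the difference quotients for the Laplacian of \<open>u\<close> are asymptotically nonnegative at every
  point; they are also locally bounded below, since \<open>u\<close> is touched from below by \<open>z \<mapsto> - norm (z - w)\<close>. Integrating
  against radial test functions shows that suitable weighted means of \<open>u\<close> over balls increase with the radius, and the
  weights approximate indicator functions of balls.

  If the mean curvature is negative at \<open>w\<close>, then near \<open>w\<close> the distance is bounded below by a function of Lipschitz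
  constant \<open>1\<close> that is nonpositive on the boundary, agrees with the distance on the normal at \<open>w\<close>, and has positive
  Laplacian there; so \<open>u\<close> violates the mean value inequality on small balls centred on that normal.
\<close>

section \<open>Symmetric endomorphisms and second derivatives\<close>

text \<open>The distance has no classical Laplacian where the nearest boundary point is not unique,
  so both implications compare \<open>u\<close> with explicit functions built from the second-order
  contact of the boundary at a single point. Where the distance is smooth, the exact Laplacian of
  \<open>u\<close> at distance \<open>D\<close> along a normal is the sum of
  \<open>k / (1 - D * k)\<close> over the principal curvatures \<open>k\<close>, and each term is at
  least \<open>k\<close>. Measuring along a fixed normal direction loses just this gain, so a
  nonnegative sum of curvatures still suffices. A pointwise statement on difference quotients says
  nothing about integrals by itself: translation invariance moves the second difference from
  \<open>u\<close> to a test function, and the uniform lower bound keeps negative mass from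
  surviving in the limit. In the converse, a function with gradient at most 1 that is nonpositive on
  the boundary lies below the distance, because it grows by at most the length of the segment from a
  nearest boundary point. Slack \<open>\<epsilon>\<close> in every curvature pays for the error
  terms, which are small multiples of the squared tangential distance.\<close>

lemma symmetric_eigenvector:
  fixes H :: "'a::euclidean_space \<Rightarrow> 'a"
  assumes lin: "linear H" and sym: "\<And>x y. H x \<bullet> y = x \<bullet> H y"
    and V: "subspace V" "V \<noteq> {0}"
  obtains b l where "b \<in> V" "norm b = 1" "\<And>y. y \<in> V \<Longrightarrow> H b \<bullet> y = l * (b \<bullet> y)"
proof -
  interpret linear H by (fact lin)
  let ?S = "V \<inter> sphere 0 1"
  obtain v where v: "v \<in> V" "v \<noteq> 0" using V subspace_0 by blast
  have "v /\<^sub>R norm v \<in> ?S" using v V by (simp add: subspace_scale)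
  moreover have "compact ?S"
    using V by (simp add: closed_subspace compact_Int_closed closed_Int_compact)
  moreover have "continuous_on ?S (\<lambda>x. H x \<bullet> x)"
    by (intro continuous_intros linear_continuous_on linear_conv_bounded_linear[THEN iffD1] lin)
  \<comment> \<open>A maximiser of the Rayleigh quotient on the unit sphere of \<open>V\<close>.
    Since \<open>H\<close> may move vectors out of \<open>V\<close>, the eigenvector equation is
    that of the compression of \<open>H\<close> to \<open>V\<close>, tested against vectors of
    \<open>V\<close>.\<close>
  ultimately obtain b where b: "b \<in> ?S" "\<And>y. y \<in> ?S \<Longrightarrow> H y \<bullet> y \<le> H b \<bullet> b"
    using continuous_attains_sup[of ?S "\<lambda>x. H x \<bullet> x"] by blast
  define l where "l = H b \<bullet> b"
  have bV: "b \<in> V" "norm b = 1" using b by auto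
  have max: "H y \<bullet> y \<le> l * (norm y)\<^sup>2" if y: "y \<in> V" for y
  proof (cases "y = 0")
    case False
    have "y /\<^sub>R norm y \<in> ?S" using False y V by (simp add: subspace_scale)
    from b(2)[OF this] have "(H y \<bullet> y) / (norm y)\<^sup>2 \<le> l"
      by (simp add: scale l_def divide_inverse power2_eq_square mult_ac)
    then show ?thesis using False by (simp add: field_simps)
  qed (simp add: zero)
  have orth: "H b \<bullet> y = 0" if y: "y \<in> V" "b \<bullet> y = 0" for y
  proof (rule ccontr)
    assume n: "H b \<bullet> y \<noteq> 0"
    define c where "c = H b \<bullet> y"
    define M where "M = l * (norm y)\<^sup>2 - H y \<bullet> y"
    have M: "M \<ge> 0" using max[OF y(1)] by (simp add: M_def)
    \<comment> \<open>Maximality along \<open>b + t y\<close>: the term linear in \<open>t\<close>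
      is dominated by the quadratic one for every \<open>t\<close>, which forces
      \<open>c = 0\<close>. The choice \<open>t = c / (M + 1)\<close> below exhibits this, the 1
      covering the case \<open>M = 0\<close>.\<close>
    have *: "2 * t * c \<le> t\<^sup>2 * M" for t
    proof -
      have "b + t *\<^sub>R y \<in> V" using bV y V by (simp add: subspace_add subspace_scale)
      note max[OF this]
      moreover have "(norm (b + t *\<^sub>R y))\<^sup>2 = 1 + t\<^sup>2 * (norm y)\<^sup>2"
        using bV y unfolding power2_norm_eq_inner by (simp add: norm_eq_1 inner_simps inner_commute[of y b] power2_eq_square)
      moreover have "H (b + t *\<^sub>R y) \<bullet> (b + t *\<^sub>R y) = l + 2 * t * c + t\<^sup>2 * (H y \<bullet> y)"
        using sym[of y b] by (simp add: add scale inner_simps l_def c_def inner_commute[of y "H b"] power2_eq_square algebra_simps)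
      ultimately show ?thesis by (simp add: M_def algebra_simps)
    qed
    have "2 * (c / (M + 1)) * c \<le> (c / (M + 1))\<^sup>2 * M" by (rule *)
    also have "\<dots> = c\<^sup>2 * (M / (M+1)^2)" by (simp add: power_divide)
    finally have "2 * c\<^sup>2 * (M+1) \<le> c\<^sup>2 * M" using M
      by (simp add: divide_simps power2_eq_square split: if_splits)
    then have "c\<^sup>2 * (M + 2) \<le> 0" by (simp add: algebra_simps)
    moreover have "c\<^sup>2 * (M + 2) > 0" using n M by (simp add: c_def)
    ultimately show False by simp
  qed
  show thesis
  proof
    show "b \<in> V" "norm b = 1" by (fact bV)+
    fix y assume y: "y \<in> V"
    have "y - (b \<bullet> y) *\<^sub>R b \<in> V" using y bV V by (simp add: subspace_diff subspace_scale)
    moreover have "b \<bullet> (y - (b \<bullet> y) *\<^sub>R b) = 0" using bV by (simp add: inner_simps norm_eq_1)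
    ultimately have "H b \<bullet> (y - (b \<bullet> y) *\<^sub>R b) = 0" by (rule orth)
    then show "H b \<bullet> y = l * (b \<bullet> y)" by (simp add: inner_simps l_def)
  qed
qed

text \<open>Induction on the dimension: split off one unit eigenvector \<open>b\<close> and continue
  in its orthogonal complement \<open>W\<close> inside \<open>V\<close>. The induction hypothesis
  tests eigenvectors against \<open>W\<close> only; symmetry of \<open>H\<close> supplies the
  remaining direction \<open>b\<close>.\<close>

lemma symmetric_eigenbasis:
  fixes H :: "'a::euclidean_space \<Rightarrow> 'a"
  assumes lin: "linear H" and sym: "\<And>x y. H x \<bullet> y = x \<bullet> H y" and V: "subspace V"
  shows "\<exists>B l. finite B \<and> B \<subseteq> V \<and> span B = V \<and> pairwise orthogonal B \<and> (\<forall>b\<in>B. norm b = 1) \<and>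
     (\<forall>b\<in>B. \<forall>y\<in>V. H b \<bullet> y = l b * (b \<bullet> y))"
  using V
proof (induction "dim V" arbitrary: V rule: less_induct)
  case less
  show ?case
  proof (cases "V = {0}")
    case True
    then show ?thesis by (intro exI[of _ "{}"]) auto
  next
    case False
    from symmetric_eigenvector[OF lin sym less.prems False]
    obtain b l where b: "b \<in> V" "norm b = 1" "\<And>y. y \<in> V \<Longrightarrow> H b \<bullet> y = l * (b \<bullet> y)" by blast
    define W where "W = {y \<in> V. b \<bullet> y = 0}"
    have W: "subspace W" unfolding W_def
      using less.prems by (auto simp: subspace_def inner_simps)
    have "b \<notin> W" using b by (auto simp: W_def norm_eq_1)
    moreover have "W \<subseteq> V" by (auto simp: W_def)
    ultimately have "W \<subset> V" using b by blast
    then have "dim W < dim V" using W less.prems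
      by (metis span_eq_iff dim_psubset)
    from less.hyps[OF this W] obtain B' l' where B': "finite B'" "B' \<subseteq> W" "span B' = W"
      "pairwise orthogonal B'" "\<forall>b\<in>B'. norm b = 1" "\<forall>b\<in>B'. \<forall>y\<in>W. H b \<bullet> y = l' b * (b \<bullet> y)" by blast
    have bn: "b \<notin> B'" using b B' by (auto simp: W_def norm_eq_1)
    have dec: "\<exists>z. z \<in> W \<and> y = (b \<bullet> y) *\<^sub>R b + z" if "y \<in> V" for y
      using that b less.prems
      by (intro exI[of _ "y - (b \<bullet> y) *\<^sub>R b"]) (auto simp: W_def subspace_diff subspace_scale inner_simps norm_eq_1)
    show ?thesis
    proof (intro exI[of _ "insert b B'"] exI[of _ "l'(b := l)"] conjI)
      show "finite (insert b B')" using B' by simp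
      show sub: "insert b B' \<subseteq> V" using b B' by (auto simp: W_def)
      show "span (insert b B') = V"
      proof
        show "span (insert b B') \<subseteq> V" using sub less.prems by (rule span_minimal)
        show "V \<subseteq> span (insert b B')"
        proof
          fix y assume "y \<in> V"
          from dec[OF this] obtain z where z: "z \<in> W" "y = (b \<bullet> y) *\<^sub>R b + z" by blast
          have "z \<in> span (insert b B')" using z(1) B'(3) span_mono[of B' "insert b B'"] by blast
          then show "y \<in> span (insert b B')"
            by (subst z(2)) (simp add: span_add span_scale span_base)
        qed
      qed
      show "pairwise orthogonal (insert b B')"
        using B' by (auto simp: pairwise_insert W_def orthogonal_def inner_commute)
      show "\<forall>x\<in>insert b B'. norm x = 1" using b B' by auto
      show "\<forall>x\<in>insert b B'. \<forall>y\<in>V. H x \<bullet> y = (l'(b := l)) x * (x \<bullet> y)"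
      proof (intro ballI)
        fix x y assume x: "x \<in> insert b B'" and y: "y \<in> V"
        show "H x \<bullet> y = (l'(b := l)) x * (x \<bullet> y)"
        proof (cases "x = b")
          case False
          with x have xB: "x \<in> B'" by simp
          then have xW: "x \<in> V" "b \<bullet> x = 0" using B' by (auto simp: W_def)
          from dec[OF y] obtain z where z: "z \<in> W" "y = (b \<bullet> y) *\<^sub>R b + z" by blast
          have "H x \<bullet> b = 0" using b(3)[OF xW(1)] xW sym[of x b] by (simp add: inner_commute)
          then have "H x \<bullet> y = H x \<bullet> z" "x \<bullet> y = x \<bullet> z"
            using xW by (subst z(2), simp add: inner_simps inner_commute)+
          then show ?thesis using B' xB z False by simp
        qed (use b y in simp)
      qed
    qed
  qed
qed

text \<open>The mixed second difference is symmetric in \<open>v\<close> and \<open>k\<close>, so this estimate forces the derivative of a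
  gradient field to be symmetric; differentiability of the gradient at one point is enough.\<close>

lemma mixed_difference_estimate:
  fixes f :: "'a::euclidean_space \<Rightarrow> real"
  assumes f: "\<And>x. x \<in> ball w r \<Longrightarrow> (f has_derivative (\<lambda>h. g x \<bullet> h)) (at x)"
    and lin: "linear H" and g: "\<And>z. norm z < r \<Longrightarrow> norm (g (w + z) - g w - H z) \<le> e * norm z"
    and t: "0 < t" "t * (norm v + norm k) < r" and e: "e \<ge> 0"
  shows "\<bar>f (w + t *\<^sub>R v + t *\<^sub>R k) - f (w + t *\<^sub>R v) - f (w + t *\<^sub>R k) + f w - t\<^sup>2 * (H k \<bullet> v)\<bar>
          \<le> 2 * e * t\<^sup>2 * (norm v + norm k)\<^sup>2"
proof -
  interpret linear H by (fact lin)
  define N where "N = norm v + norm k"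
  let ?F = "\<lambda>s. f (w + s *\<^sub>R v + t *\<^sub>R k) - f (w + s *\<^sub>R v)"
  have nr: "norm (s *\<^sub>R v) \<le> t * N" "norm (s *\<^sub>R v + t *\<^sub>R k) \<le> t * N" if "0 \<le> s" "s \<le> t" for s
  proof -
    have "s * norm v \<le> t * norm v" using that by (simp add: mult_right_mono)
    then show "norm (s *\<^sub>R v) \<le> t * N" "norm (s *\<^sub>R v + t *\<^sub>R k) \<le> t * N"
      using that norm_triangle_ineq[of "s *\<^sub>R v" "t *\<^sub>R k"] t
      by (auto simp: N_def algebra_simps intro: order_trans add_increasing2)
  qed
  have tr: "t * N < r" using t by (simp add: N_def)
  have mem: "w + z \<in> ball w r" if "norm z < r" for z using that by (simp add: dist_norm)
  have der: "(?F has_derivative (\<lambda>h. (g (w + s *\<^sub>R v + t *\<^sub>R k) - g (w + s *\<^sub>R v)) \<bullet> (h *\<^sub>R v))) (at s within {0..t})"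
    if "0 \<le> s" "s \<le> t" for s
  proof -
    have "w + s *\<^sub>R v + t *\<^sub>R k \<in> ball w r" "w + s *\<^sub>R v \<in> ball w r"
      using mem[of "s *\<^sub>R v + t *\<^sub>R k"] mem[of "s *\<^sub>R v"] nr[OF that] tr by (simp_all add: add.assoc)
    note D = f[OF this(1)] f[OF this(2)]
    have a: "((\<lambda>s. w + s *\<^sub>R v + t *\<^sub>R k) has_derivative (\<lambda>h. h *\<^sub>R v)) (at s within {0..t})"
      "((\<lambda>s. w + s *\<^sub>R v) has_derivative (\<lambda>h. h *\<^sub>R v)) (at s within {0..t})"
      by (auto intro!: derivative_eq_intros)
    show ?thesis
      using has_derivative_diff[OF has_derivative_compose[OF a(1) D(1)] has_derivative_compose[OF a(2) D(2)]]
      by (simp add: inner_simps right_diff_distrib)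
  qed
  from mvt_simple[OF t(1) der] obtain s where s: "s \<in> {0<..<t}"
    "?F t - ?F 0 = (g (w + s *\<^sub>R v + t *\<^sub>R k) - g (w + s *\<^sub>R v)) \<bullet> ((t - 0) *\<^sub>R v)" by blast
  \<comment> \<open>The mean value theorem along \<open>v\<close> has produced a difference of
    gradients at points \<open>t k\<close> apart. Linearising both at \<open>w\<close>, the common
    term \<open>H (s v)\<close> cancels and \<open>H (t k)\<close> remains.\<close>
  define D where "D = g (w + s *\<^sub>R v + t *\<^sub>R k) - g (w + s *\<^sub>R v) - H (t *\<^sub>R k)"
  have D: "norm D \<le> 2 * e * t * N"
  proof -
    have "norm (g (w + (s *\<^sub>R v + t *\<^sub>R k)) - g w - H (s *\<^sub>R v + t *\<^sub>R k)) \<le> e * (t * N)"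
      using nr(2)[of s] s tr e by (intro order_trans[OF g]) (auto intro: mult_left_mono)
    moreover have "norm (g (w + s *\<^sub>R v) - g w - H (s *\<^sub>R v)) \<le> e * (t * N)"
      using nr(1)[of s] s tr e by (intro order_trans[OF g]) (auto intro: mult_left_mono)
    moreover have "D = (g (w + (s *\<^sub>R v + t *\<^sub>R k)) - g w - H (s *\<^sub>R v + t *\<^sub>R k)) - (g (w + s *\<^sub>R v) - g w - H (s *\<^sub>R v))"
      by (simp add: D_def add add.assoc)
    ultimately have "norm D \<le> e * (t * N) + e * (t * N)"
      by (simp only:) (rule order_trans[OF norm_triangle_ineq4 add_mono])
    then show ?thesis by (simp add: mult_ac)
  qed
  have "f (w + t *\<^sub>R v + t *\<^sub>R k) - f (w + t *\<^sub>R v) - f (w + t *\<^sub>R k) + f w - t\<^sup>2 * (H k \<bullet> v) = ?F t - ?F 0 - t\<^sup>2 * (H k \<bullet> v)"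
    by simp
  also have "\<dots> = t * (D \<bullet> v)"
    unfolding s(2) by (simp add: D_def inner_simps scale power2_eq_square algebra_simps)
  also have "\<bar>\<dots>\<bar> \<le> t * (norm D * norm v)"
    using Cauchy_Schwarz_ineq2[of D v] t by (simp add: abs_mult)
  also have "\<dots> \<le> t * ((2 * e * t * N) * N)"
    using D t e by (intro mult_left_mono mult_mono) (auto simp: N_def)
  also have "\<dots> = 2 * e * t\<^sup>2 * N\<^sup>2" by (simp add: power2_eq_square)
  finally show ?thesis unfolding N_def .
qed

lemma second_derivative_symmetric:
  fixes f :: "'a::euclidean_space \<Rightarrow> real"
  assumes r: "0 < r" and f: "\<And>x. x \<in> ball w r \<Longrightarrow> (f has_derivative (\<lambda>h. g x \<bullet> h)) (at x)"
    and g: "(g has_derivative H) (at w)"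
  shows "H v \<bullet> k = v \<bullet> H k"
proof -
  have lin: "linear H" using g has_derivative_linear by blast
  define N where "N = norm v + norm k"
  have "\<bar>H v \<bullet> k - H k \<bullet> v\<bar> \<le> 4 * e * N\<^sup>2" if e: "e > 0" for e
  proof -
    from g e obtain d where d: "d > 0" "\<And>y. norm (y - w) < d \<Longrightarrow> norm (g y - g w - H (y - w)) \<le> e * norm (y - w)"
      unfolding has_derivative_at_alt by blast
    define s where "s = min d r"
    have s: "s > 0" using d r by (simp add: s_def)
    have gs: "norm (g (w + z) - g w - H z) \<le> e * norm z" if "norm z < s" for z
      using d(2)[of "w+z"] that by (simp add: s_def)
    have fs: "(f has_derivative (\<lambda>h. g x \<bullet> h)) (at x)" if "x \<in> ball w s" for x
      using f that by (simp add: s_def)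
    define t where "t = s / (2 * (N + 1))"
    have N: "N \<ge> 0" by (simp add: N_def)
    have t: "t > 0" using s N by (simp add: t_def)
    have tN: "t * N < s" using s N by (simp add: t_def field_simps add_nonneg_pos)
    note est = mixed_difference_estimate[OF fs lin gs t]
    have 1: "\<bar>f (w + t *\<^sub>R v + t *\<^sub>R k) - f (w + t *\<^sub>R v) - f (w + t *\<^sub>R k) + f w - t\<^sup>2 * (H k \<bullet> v)\<bar> \<le> 2 * e * t\<^sup>2 * N\<^sup>2"
      using est[where v=v and k=k] tN e by (simp add: N_def)
    have 2: "\<bar>f (w + t *\<^sub>R k + t *\<^sub>R v) - f (w + t *\<^sub>R k) - f (w + t *\<^sub>R v) + f w - t\<^sup>2 * (H v \<bullet> k)\<bar> \<le> 2 * e * t\<^sup>2 * N\<^sup>2"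
      using est[where v=k and k=v] tN e by (simp add: N_def add.commute)
    have "w + t *\<^sub>R k + t *\<^sub>R v = w + t *\<^sub>R v + t *\<^sub>R k" by simp
    with 2 have "\<bar>f (w + t *\<^sub>R v + t *\<^sub>R k) - f (w + t *\<^sub>R v) - f (w + t *\<^sub>R k) + f w - t\<^sup>2 * (H v \<bullet> k)\<bar> \<le> 2 * e * t\<^sup>2 * N\<^sup>2"
      by simp
    with 1 have "\<bar>t\<^sup>2 * (H v \<bullet> k) - t\<^sup>2 * (H k \<bullet> v)\<bar> \<le> 4 * e * t\<^sup>2 * N\<^sup>2" by linarith
    also have "\<bar>t\<^sup>2 * (H v \<bullet> k) - t\<^sup>2 * (H k \<bullet> v)\<bar> = t\<^sup>2 * \<bar>H v \<bullet> k - H k \<bullet> v\<bar>"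
      by (simp add: abs_mult flip: right_diff_distrib)
    also have "4 * e * t\<^sup>2 * N\<^sup>2 = t\<^sup>2 * (4 * e * N\<^sup>2)" by simp
    finally show ?thesis using t by simp
  qed
  note * = this
  have "\<bar>H v \<bullet> k - H k \<bullet> v\<bar> \<le> 0"
  proof (rule field_le_epsilon)
    fix e :: real assume e: "e > 0"
    have "\<bar>H v \<bullet> k - H k \<bullet> v\<bar> \<le> 4 * (e / (4 * (N\<^sup>2 + 1))) * N\<^sup>2" using e by (intro *) (simp add: add_nonneg_pos)
    also have "\<dots> = (4 * e * N\<^sup>2) / (4 * (N\<^sup>2 + 1))" by simp
    also have "\<dots> = e * (N\<^sup>2 / (N\<^sup>2 + 1))"
      using mult_divide_mult_cancel_left[of 4 "e * N\<^sup>2" "N\<^sup>2 + 1"] by (simp add: mult.assoc)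
    also have "\<dots> \<le> e * 1" using e by (intro mult_left_mono) (auto simp: divide_le_eq add_nonneg_pos)
    finally show "\<bar>H v \<bullet> k - H k \<bullet> v\<bar> \<le> 0 + e" by simp
  qed
  then show ?thesis by (simp add: inner_commute)
qed

text \<open>After subtraction of the quadratic polynomial the gradient at \<open>w + z\<close> is
  \<open>g (w + z) - g w - H z\<close>, of size \<open>e * norm z\<close>, and the mean value
  inequality on the ball of radius \<open>norm y\<close> applies. Symmetry of \<open>H\<close> makes
  \<open>H z\<close> the gradient of half the quadratic form.\<close>

lemma second_order_taylor:
  fixes f :: "'a::euclidean_space \<Rightarrow> real"
  assumes r: "0 < r" and f: "\<And>x. x \<in> ball w r \<Longrightarrow> (f has_derivative (\<lambda>h. g x \<bullet> h)) (at x)"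
    and g: "(g has_derivative H) (at w)" and e: "e > 0"
  obtains d where "d > 0" "d \<le> r"
    "\<And>y. norm y < d \<Longrightarrow> \<bar>f (w + y) - f w - g w \<bullet> y - H y \<bullet> y / 2\<bar> \<le> e * (norm y)\<^sup>2"
proof -
  have lin: "linear H" and bl: "bounded_linear H" using g has_derivative_linear has_derivative_bounded_linear by blast+
  from g e obtain d where d: "d > 0" "\<And>y. norm (y - w) < d \<Longrightarrow> norm (g y - g w - H (y - w)) \<le> e * norm (y - w)"
    unfolding has_derivative_at_alt by blast
  show thesis
  proof
    show "min d r > 0" "min d r \<le> r" using d r by auto
    fix y :: 'a assume y: "norm y < min d r"
    define F where "F z = f (w + z) - g w \<bullet> z - H z \<bullet> z / 2" for z
    have nz: "norm z \<le> norm y" if "z \<in> cball 0 (norm y)" for z using that by simp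
    have "norm (F y - F 0) \<le> (e * norm y) * norm (y - 0)"
    proof (rule differentiable_bound[where S="cball 0 (norm y)"])
      show "convex (cball (0::'a) (norm y))" by simp
      fix z :: 'a assume z: "z \<in> cball 0 (norm y)"
      have "w + z \<in> ball w r" using nz[OF z] y by (simp add: dist_norm)
      note D = f[OF this]
      have "((\<lambda>z. f (w + z)) has_derivative (\<lambda>h. g (w + z) \<bullet> h)) (at z within cball 0 (norm y))"
        by (rule has_derivative_compose[where f="\<lambda>z. w + z", OF _ D]) (auto intro!: derivative_eq_intros)
      then have "(F has_derivative (\<lambda>h. g (w + z) \<bullet> h - g w \<bullet> h - (H z \<bullet> h + H h \<bullet> z) / 2)) (at z within cball 0 (norm y))"
        unfolding F_def
        by (auto intro!: derivative_eq_intros bounded_linear.has_derivative[OF bl])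
      also have "(\<lambda>h. g (w + z) \<bullet> h - g w \<bullet> h - (H z \<bullet> h + H h \<bullet> z) / 2) = (\<lambda>h. (g (w + z) - g w - H z) \<bullet> h)"
        using second_derivative_symmetric[OF r f g] by (auto simp: fun_eq_iff inner_simps inner_commute)
      finally show "(F has_derivative (\<lambda>h. (g (w + z) - g w - H z) \<bullet> h)) (at z within cball 0 (norm y))" .
      have "norm (g (w + z) - g w - H z) \<le> e * norm z" using d(2)[of "w+z"] nz[OF z] y by simp
      also have "\<dots> \<le> e * norm y" using nz[OF z] e by simp
      finally have "norm (g (w + z) - g w - H z) \<le> e * norm y" .
      then show "onorm (\<lambda>h. (g (w + z) - g w - H z) \<bullet> h) \<le> e * norm y"
        unfolding real_norm_def
        by (intro onorm_le order_trans[OF Cauchy_Schwarz_ineq2[folded real_norm_def]] mult_right_mono) auto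
    qed auto
    then show "\<bar>f (w + y) - f w - g w \<bullet> y - H y \<bullet> y / 2\<bar> \<le> e * (norm y)\<^sup>2"
      using linear_0[OF lin] by (simp add: F_def power2_eq_square mult.assoc)
  qed
qed

section \<open>The second fundamental form in terms of a defining function\<close>

text \<open>Smoothness enters the curvature computation only through a gradient field that is
  differentiable. As \<open>\<rho>\<close> is negative inside, \<open>g\<close> points
  outwards.\<close>

locale boundary_chart =
  fixes \<Omega> U :: "'a::euclidean_space set" and \<rho> :: "'a \<Rightarrow> real" and g :: "'a \<Rightarrow> 'a"
  assumes open_domain: "open \<Omega>" and open_chart: "open U"
    and chart_gradient: "\<And>x. x \<in> U \<Longrightarrow> (\<rho> has_derivative (\<lambda>h. g x \<bullet> h)) (at x)"
    and gradient_differentiable: "\<And>x. x \<in> U \<Longrightarrow> g differentiable (at x)"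
    and gradient_nonzero: "\<And>x. x \<in> U \<Longrightarrow> g x \<noteq> 0"
    and domain_chart: "\<Omega> \<inter> U = {x \<in> U. \<rho> x < 0}"
begin

lemma mem_domain_iff: "x \<in> U \<Longrightarrow> x \<in> \<Omega> \<longleftrightarrow> \<rho> x < 0"
  using domain_chart by blast

lemma directional_derivative:
  assumes "w \<in> U" shows "((\<lambda>t. \<rho> (w + t *\<^sub>R v)) has_real_derivative g w \<bullet> v) (at 0)"
proof -
  have "((\<lambda>t. w + t *\<^sub>R v) has_derivative (\<lambda>t. t *\<^sub>R v)) (at 0)"
    by (auto intro!: derivative_eq_intros)
  moreover have "(\<rho> has_derivative (\<lambda>h. g w \<bullet> h)) (at (w + 0 *\<^sub>R v))"
    using chart_gradient[OF assms] by simp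
  ultimately have "((\<lambda>t. \<rho> (w + t *\<^sub>R v)) has_derivative (\<lambda>t. g w \<bullet> (t *\<^sub>R v))) (at 0)"
    by (rule has_derivative_compose)
  moreover have "(\<lambda>t. g w \<bullet> (t *\<^sub>R v)) = (*) (g w \<bullet> v)" by (auto simp: fun_eq_iff)
  ultimately show ?thesis by (simp add: has_field_derivative_def)
qed

lemma ray_in_chart:
  assumes "w \<in> U" obtains e where "e > 0" "\<And>t. \<bar>t\<bar> < e \<Longrightarrow> w + t *\<^sub>R v \<in> U"
proof -
  obtain d where d: "d > 0" "ball w d \<subseteq> U" using open_chart assms open_contains_ball by blast
  show thesis
  proof
    show "d / (norm v + 1) > 0" using d by (simp add: add_nonneg_pos)
    fix t assume "\<bar>t\<bar> < d / (norm v + 1)"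
    then have "\<bar>t\<bar> * (norm v + 1) < d" by (simp add: pos_less_divide_eq add_nonneg_pos)
    then have "norm (t *\<^sub>R v) < d" by (simp add: algebra_simps)
    then show "w + t *\<^sub>R v \<in> U" using d by (auto simp: dist_norm)
  qed
qed

lemma ray_enters:
  assumes w: "w \<in> U" "\<rho> w = 0" and v: "g w \<bullet> v < 0"
  shows "\<exists>e>0. \<forall>t\<in>{0<..<e}. w + t *\<^sub>R v \<in> \<Omega>"
proof -
  from DERIV_neg_dec_right[OF directional_derivative[OF w(1)] v] w(2)
  obtain d where d: "d > 0" "\<And>h. 0 < h \<Longrightarrow> h < d \<Longrightarrow> \<rho> (w + h *\<^sub>R v) < 0" by auto
  obtain e where e: "e > 0" "\<And>t. \<bar>t\<bar> < e \<Longrightarrow> w + t *\<^sub>R v \<in> U" using ray_in_chart[OF w(1), where v=v] by blast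
  show ?thesis using d e by (intro exI[of _ "min d e"]) (auto simp: mem_domain_iff)
qed

text \<open>Where \<open>\<rho>\<close> is positive, continuity keeps the domain away; where it
  vanishes, the nonzero gradient lets the ray along \<open>- g x\<close> enter the domain at once,
  so \<open>x\<close> is a limit of points of the domain.\<close>

lemma mem_frontier_iff:
  assumes "x \<in> U" shows "x \<in> frontier \<Omega> \<longleftrightarrow> \<rho> x = 0"
proof
  assume x: "x \<in> frontier \<Omega>"
  have "x \<notin> \<Omega>" using x open_domain frontier_disjoint_eq by blast
  then have "\<rho> x \<ge> 0" using assms mem_domain_iff by auto
  moreover have "\<not> \<rho> x > 0"
  proof
    assume p: "\<rho> x > 0"
    have "(\<rho> \<longlongrightarrow> \<rho> x) (at x)"
      using has_derivative_continuous[OF chart_gradient[OF assms]] by (simp add: continuous_within)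
    with p have "\<forall>\<^sub>F y in at x. 0 < \<rho> y" by (simp add: order_tendstoD)
    moreover have "\<forall>\<^sub>F y in at x. y \<in> U"
      using open_chart assms by (metis eventually_at_topological)
    ultimately have "\<forall>\<^sub>F y in at x. y \<notin> \<Omega>"
      by eventually_elim (simp add: mem_domain_iff)
    moreover have "x islimpt \<Omega>"
      using x \<open>x \<notin> \<Omega>\<close> by (simp add: frontier_def closure_def)
    ultimately show False by (simp add: islimpt_iff_eventually)
  qed
  ultimately show "\<rho> x = 0" by simp
next
  assume x: "\<rho> x = 0"
  then have "x \<notin> \<Omega>" using mem_domain_iff assms by simp
  have "g x \<bullet> (- g x) < 0" using gradient_nonzero[OF assms] by simp
  from ray_enters[OF assms x this] obtain e where e: "e > 0" "\<And>t. t\<in>{0<..<e} \<Longrightarrow> x + t *\<^sub>R (- g x) \<in> \<Omega>" by blast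
  have "((\<lambda>t. x + t *\<^sub>R (- g x)) \<longlongrightarrow> x + 0 *\<^sub>R (- g x)) (at_right 0)" by (intro tendsto_intros)
  moreover have "\<forall>\<^sub>F t in at_right 0. x + t *\<^sub>R (- g x) \<in> closure \<Omega>"
    using e closure_subset by (auto simp: eventually_at_right_field intro!: exI[of _ e])
  ultimately have "x + 0 *\<^sub>R (- g x) \<in> closure \<Omega>"
    by (intro Lim_in_closed_set[where F="at_right (0::real)"]) auto
  then show "x \<in> frontier \<Omega>" using \<open>x \<notin> \<Omega>\<close> open_domain by (simp add: frontier_def interior_open)
qed

lemma chart_taylor:
  assumes w: "w \<in> U" "\<rho> w = 0" and H: "(g has_derivative H) (at w)" and e: "e > 0"
  obtains d where "d > 0" "ball w d \<subseteq> U"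
    "\<And>y. norm y < d \<Longrightarrow> \<bar>\<rho> (w + y) - g w \<bullet> y - H y \<bullet> y / 2\<bar> \<le> e * (norm y)\<^sup>2"
proof -
  obtain r where r: "r > 0" "ball w r \<subseteq> U" using open_chart w open_contains_ball by blast
  from second_order_taylor[OF r(1) chart_gradient H e] r(2) obtain d where "d > 0" "d \<le> r"
    "\<And>y. norm y < d \<Longrightarrow> \<bar>\<rho> (w + y) - \<rho> w - g w \<bullet> y - H y \<bullet> y / 2\<bar> \<le> e * (norm y)\<^sup>2" by blast
  then show thesis using w(2) r(2) by (intro that[of d]) auto
qed

lemma hessian_symmetric:
  assumes w: "w \<in> U" and H: "(g has_derivative H) (at w)"
  shows "H x \<bullet> y = x \<bullet> H y"
proof -
  obtain r where r: "r > 0" "ball w r \<subseteq> U" using open_chart w open_contains_ball by blast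
  show ?thesis using second_derivative_symmetric[OF r(1) chart_gradient H] r(2) by blast
qed

text \<open>\<open>\<rho>\<close> vanishes along the curve near parameter 0, so the chain rule at 0
  gives the orthogonality.\<close>

lemma tangent_subset:
  assumes w: "w \<in> U" and X: "X \<in> tangent_space (frontier \<Omega>) w"
  shows "g w \<bullet> X = 0"
proof -
  from X obtain \<gamma> e where c: "0 < e" "\<gamma> 0 = w" "\<forall>t\<in>{-e<..<e}. \<gamma> t \<in> frontier \<Omega>"
    "(\<gamma> has_vector_derivative X) (at 0)" unfolding tangent_space_def by blast
  have "isCont \<gamma> 0" using c(4) by (rule has_vector_derivative_continuous)
  then have "(\<gamma> \<longlongrightarrow> w) (at 0)" by (simp only: continuous_within c(2))
  then have ev_U: "\<forall>\<^sub>F t in at 0. \<gamma> t \<in> U" using open_chart w by (rule topological_tendstoD)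
  have ev_e: "\<forall>\<^sub>F t in at (0::real). t \<in> {-e<..<e}"
    using c(1) by (intro eventually_at_in_open') simp_all
  have ev: "\<forall>\<^sub>F t in at 0. \<rho> (\<gamma> t) = 0"
    using ev_U ev_e
  proof eventually_elim
    case (elim t)
    then show ?case using mem_frontier_iff[OF elim(1)] bspec[OF c(3) elim(2)] by simp
  qed
  have "w \<in> frontier \<Omega>" using c(1) bspec[OF c(3), of 0] by (simp add: c(2))
  then have zero: "\<rho> (\<gamma> 0) = 0" using mem_frontier_iff[OF w] by (simp add: c(2))
  have D: "((\<lambda>t. \<rho> (\<gamma> t)) has_derivative (\<lambda>t. g w \<bullet> (t *\<^sub>R X))) (at 0)"
  proof (rule has_derivative_compose[where f=\<gamma>])
    show "(\<gamma> has_derivative (\<lambda>t. t *\<^sub>R X)) (at 0)" using c(4) by (simp only: has_vector_derivative_def)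
    show "(\<rho> has_derivative (\<lambda>h. g w \<bullet> h)) (at (\<gamma> 0))" unfolding c(2) by (rule chart_gradient[OF w])
  qed
  have "((\<lambda>t. 0) has_derivative (\<lambda>t. g w \<bullet> (t *\<^sub>R X))) (at (0::real))"
    by (rule has_derivative_transform_eventually[OF D ev zero UNIV_I])
  from has_derivative_unique[OF this has_derivative_const]
  have "(\<lambda>t::real. g w \<bullet> (t *\<^sub>R X)) = (\<lambda>t. 0)" .
  from fun_cong[OF this, of 1] show ?thesis by simp
qed

text \<open>The implicit function theorem is not needed: \<open>tangent_space\<close> only asks for a curve that is differentiable at
  \<open>0\<close>, so it may be chosen pointwise by the intermediate value theorem, with an error of at most
  \<open>M t\<^sup>2\<close> in the normal direction.\<close>

lemma tangent_supset:
  assumes w: "w \<in> U" "\<rho> w = 0" and X: "g w \<bullet> X = 0"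
  shows "X \<in> tangent_space (frontier \<Omega>) w"
proof -
  obtain H where H: "(g has_derivative H) (at w)" using gradient_differentiable[OF w(1)] by (auto simp: differentiable_def)
  obtain d where d: "d > 0" "ball w d \<subseteq> U"
    "\<And>y. norm y < d \<Longrightarrow> \<bar>\<rho> (w + y) - g w \<bullet> y - H y \<bullet> y / 2\<bar> \<le> 1 * (norm y)\<^sup>2"
    using chart_taylor[OF w H zero_less_one] by blast
  obtain L where L: "L > 0" "\<And>y. norm (H y) \<le> norm y * L"
    using bounded_linear.pos_bounded[OF has_derivative_bounded_linear[OF H]] by blast
  have est: "\<bar>\<rho> (w + y) - g w \<bullet> y\<bar> \<le> (1 + L) * (norm y)\<^sup>2" if "norm y < d" for y
  proof -
    have "\<bar>H y \<bullet> y\<bar> \<le> norm (H y) * norm y" by (rule Cauchy_Schwarz_ineq2)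
    also have "\<dots> \<le> L * (norm y)\<^sup>2" using mult_right_mono[OF L(2)[of y], of "norm y"] by (simp add: power2_eq_square mult_ac)
    finally have "\<bar>H y \<bullet> y\<bar> \<le> L * (norm y)\<^sup>2" .
    moreover have "L * (norm y)\<^sup>2 \<ge> 0" using L by simp
    moreover have "(1 + L) * (norm y)\<^sup>2 = (norm y)\<^sup>2 + L * (norm y)\<^sup>2" by (simp add: algebra_simps)
    ultimately show ?thesis using d(3)[OF that] by linarith
  qed
  define N where "N = norm X + norm (g w)"
  \<comment> \<open>Chosen so that at \<open>s = M t^2\<close> the linear term
    \<open>s * (norm (g w))^2\<close> exceeds the Taylor error \<open>(1 + L) * N^2 * t^2\<close> by
    \<open>t^2\<close>; this fixes the signs at both ends of the interval.\<close>
  define M where "M = ((1 + L) * N\<^sup>2 + 1) / (norm (g w))\<^sup>2"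
  have gw: "norm (g w) > 0" using gradient_nonzero[OF w(1)] by simp
  have N: "N > 0" using gw by (simp add: N_def add_nonneg_pos)
  have M: "M > 0" using gw L by (simp add: M_def add_nonneg_pos)
  \<comment> \<open>Below \<open>1 / M\<close> the correction satisfies
    \<open>M t^2 \<le> \<bar>t\<bar>\<close>, so the displacement is at most
    \<open>\<bar>t\<bar> * N\<close>; below \<open>d / N\<close> it stays in the range of the Taylor
    bound.\<close>
  define \<tau> where "\<tau> = min (1 / M) (d / N)"
  have \<tau>: "\<tau> > 0" using M N d by (simp add: \<tau>_def)
  have nrm: "norm (t *\<^sub>R X + s *\<^sub>R g w) \<le> \<bar>t\<bar> * N" "norm (t *\<^sub>R X + s *\<^sub>R g w) < d"
    if t: "\<bar>t\<bar> < \<tau>" and s: "\<bar>s\<bar> \<le> M * t\<^sup>2" for t s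
  proof -
    have "\<bar>t\<bar> * M \<le> 1" using t M by (simp add: \<tau>_def field_simps)
    then have "M * t\<^sup>2 \<le> \<bar>t\<bar>" using mult_left_mono[of "\<bar>t\<bar> * M" 1 "\<bar>t\<bar>"] by (simp add: power2_eq_square mult_ac)
    then have "\<bar>s\<bar> * norm (g w) \<le> \<bar>t\<bar> * norm (g w)" using s by (intro mult_right_mono) auto
    then show 1: "norm (t *\<^sub>R X + s *\<^sub>R g w) \<le> \<bar>t\<bar> * N"
      using norm_triangle_ineq[of "t *\<^sub>R X" "s *\<^sub>R g w"] by (simp add: N_def algebra_simps)
    have "\<bar>t\<bar> * N < d" using t N by (simp add: \<tau>_def field_simps)
    with 1 show "norm (t *\<^sub>R X + s *\<^sub>R g w) < d" by simp
  qed
  have "\<exists>s. \<bar>s\<bar> \<le> M * t\<^sup>2 \<and> \<rho> (w + (t *\<^sub>R X + s *\<^sub>R g w)) = 0" if t: "\<bar>t\<bar> < \<tau>" for t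
  proof -
    let ?f = "\<lambda>s. \<rho> (w + (t *\<^sub>R X + s *\<^sub>R g w))"
    have b: "\<bar>?f s - s * (norm (g w))\<^sup>2\<bar> \<le> (1 + L) * N\<^sup>2 * t\<^sup>2" if s: "\<bar>s\<bar> \<le> M * t\<^sup>2" for s
    proof -
      have "g w \<bullet> (t *\<^sub>R X + s *\<^sub>R g w) = s * (norm (g w))\<^sup>2"
        using X by (simp add: inner_simps power2_norm_eq_inner)
      then have "\<bar>?f s - s * (norm (g w))\<^sup>2\<bar> \<le> (1 + L) * (norm (t *\<^sub>R X + s *\<^sub>R g w))\<^sup>2"
        using est[OF nrm(2)[OF t s]] by simp
      also have "\<dots> \<le> (1 + L) * (\<bar>t\<bar> * N)\<^sup>2" using nrm(1)[OF t s] L by (intro mult_left_mono power_mono) auto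
      finally show ?thesis by (simp add: power_mult_distrib mult_ac)
    qed
    have Mt: "M * t\<^sup>2 \<ge> 0" using M by simp
    have "M * t\<^sup>2 * (norm (g w))\<^sup>2 = ((1 + L) * N\<^sup>2 + 1) * t\<^sup>2" using gw by (simp add: M_def)
    then have Mt2: "M * t\<^sup>2 * (norm (g w))\<^sup>2 = (1 + L) * N\<^sup>2 * t\<^sup>2 + t\<^sup>2" by (simp add: algebra_simps)
    have t2: "t\<^sup>2 \<ge> 0" by simp
    have "\<bar>?f (- (M * t\<^sup>2)) - - (M * t\<^sup>2) * (norm (g w))\<^sup>2\<bar> \<le> (1 + L) * N\<^sup>2 * t\<^sup>2"
      by (rule b) (use Mt in simp)
    with Mt2 t2 have "?f (- (M * t\<^sup>2)) \<le> 0" unfolding mult_minus_left by linarith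
    moreover have "\<bar>?f (M * t\<^sup>2) - M * t\<^sup>2 * (norm (g w))\<^sup>2\<bar> \<le> (1 + L) * N\<^sup>2 * t\<^sup>2"
      by (rule b) (use Mt in simp)
    with Mt2 t2 have "0 \<le> ?f (M * t\<^sup>2)" by linarith
    moreover have "continuous_on {- (M * t\<^sup>2)..M * t\<^sup>2} ?f"
    proof (intro continuous_at_imp_continuous_on ballI)
      fix s assume "s \<in> {- (M * t\<^sup>2)..M * t\<^sup>2}"
      then have "w + (t *\<^sub>R X + s *\<^sub>R g w) \<in> U"
        using nrm(2)[OF t, of s] d(2) by (auto simp: dist_norm abs_le_iff subset_iff simp flip: minus_add_distrib)
      note cont = has_derivative_continuous[OF chart_gradient[OF this]]
      show "isCont ?f s"
        by (rule isCont_o2[where g=\<rho> and f="\<lambda>s. w + (t *\<^sub>R X + s *\<^sub>R g w)", OF _ cont]) (intro continuous_intros)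
    qed
    ultimately show ?thesis using IVT'[of ?f "- (M * t\<^sup>2)" 0 "M * t\<^sup>2"] Mt by (auto simp: abs_le_iff)
  qed
  then have "\<exists>s. \<forall>t\<in>{-\<tau><..<\<tau>}. \<bar>s t\<bar> \<le> M * t\<^sup>2 \<and> \<rho> (w + (t *\<^sub>R X + s t *\<^sub>R g w)) = 0"
    by (intro bchoice ballI) (auto simp: abs_less_iff)
  then obtain s where s: "\<And>t. t\<in>{-\<tau><..<\<tau>} \<Longrightarrow> \<bar>s t\<bar> \<le> M * t\<^sup>2"
    "\<And>t. t\<in>{-\<tau><..<\<tau>} \<Longrightarrow> \<rho> (w + (t *\<^sub>R X + s t *\<^sub>R g w)) = 0" by blast
  have s0: "s 0 = 0" using s(1)[of 0] \<tau> by simp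
  \<comment> \<open>The function \<open>s\<close> comes from pointwise choices and may be
    discontinuous elsewhere; the bound by \<open>M t^2\<close> alone gives derivative 0 at
    0.\<close>
  have "(s has_real_derivative 0) (at 0)" unfolding DERIV_def
  proof (rule Lim_null_comparison)
    show "((\<lambda>h. M * \<bar>h\<bar>) \<longlongrightarrow> 0) (at 0)" by (auto intro!: tendsto_eq_intros)
    have "\<forall>\<^sub>F h in at (0::real). h \<in> {-\<tau><..<\<tau>}" using \<tau> by (intro eventually_at_in_open') auto
    moreover have "\<forall>\<^sub>F h in at (0::real). h \<noteq> 0" by (simp add: eventually_at_filter)
    ultimately show "\<forall>\<^sub>F h in at 0. norm ((s (0 + h) - s 0) / h) \<le> M * \<bar>h\<bar>"
    proof eventually_elim
      case (elim h)
      then show ?case using s(1)[of h] s0 by (simp add: divide_le_eq power2_eq_square mult.assoc flip: abs_mult)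
    qed
  qed
  then have "(s has_vector_derivative 0) (at 0)" by (simp add: has_real_derivative_iff_has_vector_derivative)
  then have "((\<lambda>t. w + (t *\<^sub>R X + s t *\<^sub>R g w)) has_vector_derivative X) (at 0)"
    by (auto intro!: derivative_eq_intros simp: has_real_derivative_iff_has_vector_derivative)
  moreover have "w + (t *\<^sub>R X + s t *\<^sub>R g w) \<in> frontier \<Omega>" if "t \<in> {-\<tau><..<\<tau>}" for t
  proof -
    have "norm (t *\<^sub>R X + s t *\<^sub>R g w) < d" using that s(1)[OF that] by (intro nrm(2)) (auto simp: abs_less_iff)
    then have "w + (t *\<^sub>R X + s t *\<^sub>R g w) \<in> U" using d(2) by (auto simp: dist_norm subset_iff simp flip: minus_add_distrib)
    then show ?thesis using mem_frontier_iff s(2)[OF that] by blast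
  qed
  ultimately show ?thesis unfolding tangent_space_def using \<tau> s0
    by (intro CollectI exI[of _ "\<lambda>t. w + (t *\<^sub>R X + s t *\<^sub>R g w)"] exI[of _ \<tau>]) auto
qed

lemma tangent_space_eq:
  assumes "w \<in> U" "\<rho> w = 0" shows "tangent_space (frontier \<Omega>) w = {X. g w \<bullet> X = 0}"
  using tangent_subset[OF assms(1)] tangent_supset[OF assms] by blast

text \<open>A competitor annihilates the kernel of \<open>g w\<close>, hence is a multiple of
  \<open>g w\<close>. Unit length fixes the factor up to sign, and entering the domain fixes the
  sign because \<open>\<rho>\<close> increases along \<open>g w\<close>.\<close>

lemma inward_normal_eq:
  assumes w: "w \<in> U" "\<rho> w = 0"
  shows "inward_normal \<Omega> w = - (g w /\<^sub>R norm (g w))"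
  unfolding inward_normal_def tangent_space_eq[OF w]
proof (rule the_equality)
  let ?n = "- (g w /\<^sub>R norm (g w))"
  have gw: "norm (g w) > 0" using gradient_nonzero[OF w(1)] by simp
  have "g w \<bullet> ?n < 0" using gw by (simp add: inner_simps)
  from ray_enters[OF w this]
  show "norm ?n = 1 \<and> (\<forall>X\<in>{X. g w \<bullet> X = 0}. ?n \<bullet> X = 0) \<and> (\<exists>\<epsilon>>0. \<forall>t\<in>{0<..<\<epsilon>}. w + t *\<^sub>R ?n \<in> \<Omega>)"
    using gw by auto
  fix n assume n: "norm n = 1 \<and> (\<forall>X\<in>{X. g w \<bullet> X = 0}. n \<bullet> X = 0) \<and> (\<exists>\<epsilon>>0. \<forall>t\<in>{0<..<\<epsilon>}. w + t *\<^sub>R n \<in> \<Omega>)"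
  define c where "c = (g w \<bullet> n) / (g w \<bullet> g w)"
  have X: "g w \<bullet> (n - c *\<^sub>R g w) = 0" using gw by (simp add: inner_simps c_def)
  with n have "n \<bullet> (n - c *\<^sub>R g w) = 0" by blast
  with X have "(n - c *\<^sub>R g w) \<bullet> (n - c *\<^sub>R g w) = 0" by (simp add: inner_diff_left)
  then have nc: "n = c *\<^sub>R g w" by simp
  have "\<not> 0 < g w \<bullet> n"
  proof
    assume "0 < g w \<bullet> n"
    from DERIV_pos_inc_right[OF directional_derivative[OF w(1)] this] w(2)
    obtain d where d: "d > 0" "\<And>h. 0 < h \<Longrightarrow> h < d \<Longrightarrow> 0 < \<rho> (w + h *\<^sub>R n)" by auto
    obtain e where e: "e > 0" "\<And>t. \<bar>t\<bar> < e \<Longrightarrow> w + t *\<^sub>R n \<in> U" using ray_in_chart[OF w(1), where v=n] by blast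
    from n obtain e' where e': "e' > 0" "\<forall>t\<in>{0<..<e'}. w + t *\<^sub>R n \<in> \<Omega>" by blast
    define t where "t = min d (min e e') / 2"
    have "0 < t" "t < d" "t < e" "t < e'" using d e e' by (auto simp: t_def)
    then have "0 < \<rho> (w + t *\<^sub>R n)" "w + t *\<^sub>R n \<in> U" "w + t *\<^sub>R n \<in> \<Omega>" using d e e' by auto
    then show False using mem_domain_iff by force
  qed
  then have "c \<le> 0" by (simp add: c_def divide_nonpos_nonneg)
  moreover have "\<bar>c\<bar> * norm (g w) = 1" using n nc by (metis norm_scaleR)
  ultimately have "c = - inverse (norm (g w))" using gw by (simp add: field_simps)
  then show "n = ?n" using nc by simp
qed

text \<open>The field \<open>- g / norm g\<close> extends the normal to the open set
  \<open>U\<close>, with derivative \<open>- H h / norm (g w)\<close> plus a multiple of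
  \<open>g w\<close>, which is invisible to a tangent vector \<open>Y\<close>.\<close>

lemma second_fundamental_form_eq:
  assumes w: "w \<in> U" "\<rho> w = 0" and H: "(g has_derivative H) (at w)"
    and X: "g w \<bullet> X = 0" and Y: "g w \<bullet> Y = 0"
  shows "second_fundamental_form \<Omega> w X Y = (H X \<bullet> Y) / norm (g w)"
proof -
  let ?S = "frontier \<Omega>"
  let ?N = "\<lambda>x. - (g x /\<^sub>R norm (g x))"
  have gw: "g w \<noteq> 0" using gradient_nonzero[OF w(1)] by simp
  obtain k where N: "(?N has_derivative (\<lambda>h. - (H h /\<^sub>R norm (g w)) + k h *\<^sub>R g w)) (at w)"
  proof -
    have "((\<lambda>x. norm (g x)) has_derivative (\<lambda>h. sgn (g w) \<bullet> H h)) (at w)"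
      using has_derivative_compose[OF H has_derivative_norm[OF gw]] by (simp add: inner_commute)
    then have "((\<lambda>x. inverse (norm (g x))) has_derivative (\<lambda>h. - (inverse (norm (g w)) * (sgn (g w) \<bullet> H h) * inverse (norm (g w))))) (at w)"
      using gw by (intro Deriv.has_derivative_inverse) auto
    from has_derivative_minus[OF has_derivative_scaleR[OF this H]]
    have "(?N has_derivative (\<lambda>h. - (H h /\<^sub>R norm (g w)) + (inverse (norm (g w)) * (sgn (g w) \<bullet> H h) * inverse (norm (g w))) *\<^sub>R g w)) (at w)"
      by (simp add: algebra_simps)
    then show thesis by (rule that)
  qed
  have wS: "w \<in> ?S" using w mem_frontier_iff by blast
  have ev: "\<forall>\<^sub>F x in at w within ?S. ?N x = inward_normal \<Omega> x"
  proof -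
    have "\<forall>\<^sub>F x in at w within ?S. x \<in> U"
      using open_chart w(1) by (metis eventually_at_topological)
    then have "\<forall>\<^sub>F x in at w within ?S. x \<in> U \<and> x \<in> ?S"
      by (auto simp: eventually_at_filter elim: eventually_mono)
    then show ?thesis by eventually_elim (use inward_normal_eq mem_frontier_iff in auto)
  qed
  have N': "(inward_normal \<Omega> has_derivative (\<lambda>h. - (H h /\<^sub>R norm (g w)) + k h *\<^sub>R g w)) (at w within ?S)"
    by (rule has_derivative_transform_eventually[OF has_derivative_at_withinI[OF N] ev])
      (use inward_normal_eq[OF w] wS in auto)
  then have "inward_normal \<Omega> differentiable (at w within ?S)" by (auto simp: differentiable_def)
  then have D: "(inward_normal \<Omega> has_derivative frechet_derivative (inward_normal \<Omega>) (at w within ?S)) (at w within ?S)"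
    (is "(_ has_derivative ?D) _") by (simp add: frechet_derivative_works)
  \<comment> \<open>As a linear map on the whole space the derivative within the frontier is not
    unique. A curve in the frontier with velocity \<open>X\<close> pins down its value at
    \<open>X\<close>, by uniqueness of derivatives on an interval.\<close>
  have "X \<in> tangent_space ?S w" using tangent_supset[OF w X] .
  then obtain \<gamma> e where c: "0 < e" "\<gamma> 0 = w" "\<forall>t\<in>{-e<..<e}. \<gamma> t \<in> ?S"
    "(\<gamma> has_vector_derivative X) (at 0)" unfolding tangent_space_def by blast
  let ?I = "{-e<..<e}"
  have c': "(\<gamma> has_derivative (\<lambda>t. t *\<^sub>R X)) (at 0 within ?I)"
    using c(4) by (simp add: has_vector_derivative_def has_derivative_at_withinI)
  have comp: "((\<lambda>t. inward_normal \<Omega> (\<gamma> t)) has_derivative (\<lambda>t. A (t *\<^sub>R X))) (at 0 within ?I)"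
    if "(inward_normal \<Omega> has_derivative A) (at w within ?S)" for A
  proof (rule has_derivative_in_compose[OF c'])
    show "(inward_normal \<Omega> has_derivative A) (at (\<gamma> 0) within \<gamma> ` ?I)"
      unfolding c(2) by (rule has_derivative_subset[OF that]) (use c(3) in auto)
  qed
  have "(\<lambda>t. ?D (t *\<^sub>R X)) = (\<lambda>t. - (H (t *\<^sub>R X) /\<^sub>R norm (g w)) + k (t *\<^sub>R X) *\<^sub>R g w)"
    using comp[OF D] comp[OF N'] c(1)
    by (intro has_derivative_unique[where x="0::real" and f="\<lambda>t. inward_normal \<Omega> (\<gamma> t)"]) (simp_all add: at_within_open[where S="?I" and a=0])
  from fun_cong[OF this, of 1] have "?D X = - (H X /\<^sub>R norm (g w)) + k X *\<^sub>R g w" by simp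
  then show ?thesis using Y unfolding second_fundamental_form_def by (simp add: inner_simps divide_inverse)
qed

end

section \<open>Orthonormal frames, the trace of the second fundamental form, second-order
  contact\<close>

definition normal_frame :: "'a::euclidean_space \<Rightarrow> 'a set \<Rightarrow> bool" where
  "normal_frame n B \<longleftrightarrow> norm n = 1 \<and> finite B \<and> pairwise orthogonal B \<and>
     (\<forall>b\<in>B. norm b = 1 \<and> n \<bullet> b = 0) \<and> span B = {y. n \<bullet> y = 0}"

lemma normal_frame_expand:
  assumes "normal_frame n B"
  shows "(\<Sum>b\<in>B. (y \<bullet> b) *\<^sub>R b) = y - (n \<bullet> y) *\<^sub>R n"
proof -
  note f = assms[unfolded normal_frame_def]
  have "n \<bullet> n = 1" using f by (simp add: norm_eq_1)
  then have "y - (n \<bullet> y) *\<^sub>R n \<in> span B" using f by (simp add: inner_simps)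
  with f have "(\<Sum>b\<in>B. ((y - (n \<bullet> y) *\<^sub>R n) \<bullet> b) *\<^sub>R b) = y - (n \<bullet> y) *\<^sub>R n"
    by (intro orthonormal_basis_expand) auto
  moreover have "(y - (n \<bullet> y) *\<^sub>R n) \<bullet> b = y \<bullet> b" if "b \<in> B" for b
    using f that by (simp add: inner_simps)
  ultimately show ?thesis by simp
qed

lemma normal_frame_norm:
  assumes "normal_frame n B"
  shows "(norm y)\<^sup>2 = (n \<bullet> y)\<^sup>2 + (\<Sum>b\<in>B. (y \<bullet> b)\<^sup>2)"
proof -
  have "y \<bullet> (\<Sum>b\<in>B. (y \<bullet> b) *\<^sub>R b) = y \<bullet> y - (n \<bullet> y)\<^sup>2"
    unfolding normal_frame_expand[OF assms] by (simp add: inner_simps power2_eq_square inner_commute)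
  then show ?thesis unfolding power2_norm_eq_inner by (simp add: inner_sum_right power2_eq_square)
qed

lemma normal_frame_inner_sum:
  assumes "normal_frame n B" "b \<in> B"
  shows "(\<Sum>a\<in>B. c a *\<^sub>R a) \<bullet> b = c b"
proof -
  note f = assms(1)[unfolded normal_frame_def]
  have "(\<Sum>a\<in>B. c a *\<^sub>R a) \<bullet> b = (\<Sum>a\<in>B. c a * (a \<bullet> b))" by (simp add: inner_sum_left)
  also have "\<dots> = (\<Sum>a\<in>B. if a = b then c b else 0)"
    using f assms(2) by (intro sum.cong refl) (auto simp: pairwise_def orthogonal_def norm_eq_1)
  finally have "(\<Sum>a\<in>B. c a *\<^sub>R a) \<bullet> b = (\<Sum>a\<in>B. if a = b then c b else 0)" .
  then show ?thesis using f assms(2) by simp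
qed

text \<open>This turns the sum over distinct eigenvalues weighted by multiplicity into a trace. By
  symmetry an eigenvector for \<open>k\<close> is orthogonal to each \<open>b\<close> with
  \<open>l b \<noteq> k\<close>, so \<open>E k\<close> is spanned by the fibre of \<open>l\<close>
  over \<open>k\<close> and its dimension counts that fibre.\<close>

lemma eigenvalue_sum:
  fixes V :: "'a::euclidean_space set"
  assumes V: "subspace V" and A: "linear A" and sym: "\<And>x y. A x \<bullet> y = x \<bullet> A y"
    and B: "finite B" "B \<subseteq> V" "span B = V" "pairwise orthogonal B" "\<forall>b\<in>B. norm b = 1"
    and l: "\<forall>b\<in>B. \<forall>y\<in>V. A b \<bullet> y = l b * (b \<bullet> y)"
    and E: "\<And>k. E k = {X\<in>V. \<forall>Y\<in>V. A X \<bullet> Y = k * (X \<bullet> Y)}"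
  shows "(\<Sum>k\<in>{k. \<exists>X\<in>E k. X \<noteq> 0}. real (dim (E k)) * k) = sum l B"
proof -
  interpret linear A by (fact A)
  let ?B = "\<lambda>k. {b\<in>B. l b = k}"
  have E_span: "E k = span (?B k)" for k
  proof
    have "subspace (E k)" unfolding E using V by (auto simp: subspace_def inner_simps add scale zero algebra_simps)
    then show "span (?B k) \<subseteq> E k" using B(2) l by (intro span_minimal) (auto simp: E)
    show "E k \<subseteq> span (?B k)"
    proof
      fix X assume X: "X \<in> E k"
      then have XV: "X \<in> V" by (simp add: E)
      have "(X \<bullet> b) *\<^sub>R b \<in> span (?B k)" if b: "b \<in> B" for b
      proof (cases "l b = k")
        case False
        have bV: "b \<in> V" using b B by blast
        have "k * (X \<bullet> b) = A X \<bullet> b" using X bV by (simp add: E)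
        also have "\<dots> = b \<bullet> A X" by (rule inner_commute)
        also have "\<dots> = A b \<bullet> X" by (rule sym[symmetric])
        also have "\<dots> = l b * (b \<bullet> X)" using l b XV by blast
        finally have "X \<bullet> b = 0" using False by (simp add: inner_commute)
        then show ?thesis by (simp add: span_zero)
      qed (use b in \<open>auto intro: span_scale span_base\<close>)
      then have "(\<Sum>b\<in>B. (X \<bullet> b) *\<^sub>R b) \<in> span (?B k)" by (rule span_sum)
      moreover have "(\<Sum>b\<in>B. (X \<bullet> b) *\<^sub>R b) = X"
        using B XV by (intro orthonormal_basis_expand) auto
      ultimately show "X \<in> span (?B k)" by simp
    qed
  qed
  have dim: "dim (E k) = card (?B k)" for k
  proof -
    have "independent (?B k)"
      using B by (intro pairwise_orthogonal_independent pairwise_subset[OF B(4)]) auto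
    then show ?thesis unfolding E_span by (rule dim_span_eq_card_independent)
  qed
  have "{k. \<exists>X\<in>E k. X \<noteq> 0} = l ` B"
  proof (intro set_eqI iffI)
    fix k assume "k \<in> {k. \<exists>X\<in>E k. X \<noteq> 0}"
    then have "span (?B k) \<noteq> {0}" by (auto simp: E_span)
    then have "?B k \<noteq> {}" by (metis span_empty)
    then show "k \<in> l ` B" by blast
  next
    fix k assume "k \<in> l ` B"
    then obtain b where b: "b \<in> ?B k" by blast
    then have "b \<in> E k" "b \<noteq> 0" using B(5) by (auto simp: E_span intro: span_base)
    then show "k \<in> {k. \<exists>X\<in>E k. X \<noteq> 0}" by blast
  qed
  then have "(\<Sum>k\<in>{k. \<exists>X\<in>E k. X \<noteq> 0}. real (dim (E k)) * k) = (\<Sum>k\<in>l ` B. \<Sum>b\<in>?B k. l b)"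
    by (simp add: dim)
  then show ?thesis using sum.image_gen[OF B(1), of l l] by simp
qed

text \<open>For principal directions \<open>B\<close> and principal curvatures \<open>l\<close> this
  is the second fundamental form at the tangential part of \<open>y\<close>. The weights are left
  free because the estimates shift the curvatures by \<open>\<epsilon>\<close>.\<close>

definition frame_quadratic :: "('a::euclidean_space \<Rightarrow> real) \<Rightarrow> 'a set \<Rightarrow> 'a \<Rightarrow> real" where
  "frame_quadratic l B y = (\<Sum>b\<in>B. l b * (y \<bullet> b)\<^sup>2)"

text \<open>To second order at \<open>w\<close>, the boundary is the graph of half the quadratic form over the tangent space and
  the domain lies above it. The two inequalities overlap on the frontier.\<close>

definition osculating :: "'a::euclidean_space set \<Rightarrow> 'a \<Rightarrow> 'a \<Rightarrow> 'a set \<Rightarrow> ('a \<Rightarrow> real) \<Rightarrow> bool" where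
  "osculating \<Omega> w n B l \<longleftrightarrow> (\<forall>\<eta>>0. \<exists>d>0. \<forall>y. norm y < d \<longrightarrow>
     (w + y \<in> closure \<Omega> \<longrightarrow> n \<bullet> y \<ge> frame_quadratic l B y / 2 - \<eta> * (\<bar>n \<bullet> y\<bar> + (norm y)\<^sup>2)) \<and>
     (w + y \<notin> \<Omega> \<longrightarrow> n \<bullet> y \<le> frame_quadratic l B y / 2 + \<eta> * (\<bar>n \<bullet> y\<bar> + (norm y)\<^sup>2)))"

context boundary_chart
begin

text \<open>Dividing the Taylor expansion of \<open>\<rho>\<close> at \<open>w\<close> by
  \<open>G\<close> expresses \<open>\<rho>\<close> through \<open>n \<bullet> y\<close> and the
  Hessian on the tangential part, which is the second fundamental form; the sign of
  \<open>\<rho>\<close> then yields both halves of \<open>osculating\<close>.\<close>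

lemma curvature_frame:
  assumes w: "w \<in> U" "\<rho> w = 0" and dim: "DIM('a) \<ge> 2"
  obtains n B l where "normal_frame n B" "sum l B = (real DIM('a) - 1) * mean_curvature \<Omega> w"
    "osculating \<Omega> w n B l"
proof -
  obtain H where H: "(g has_derivative H) (at w)" using gradient_differentiable[OF w(1)] by (auto simp: differentiable_def)
  note sym = hessian_symmetric[OF w(1) H]
  define G where "G = norm (g w)"
  have G: "G > 0" using gradient_nonzero[OF w(1)] by (simp add: G_def)
  define n where "n = - (g w /\<^sub>R G)"
  have gn: "g w = - (G *\<^sub>R n)" using G by (simp add: n_def)
  have n1: "norm n = 1" using G by (simp add: n_def G_def)
  define V where "V = {X. g w \<bullet> X = 0}"
  have V_n: "V = {X. n \<bullet> X = 0}" using G by (simp add: V_def gn)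
  have V: "subspace V" unfolding V_def by (rule subspace_hyperplane)
  define A where "A X = H X /\<^sub>R G" for X
  interpret H: linear H using H has_derivative_linear by blast
  have A: "linear A" unfolding A_def by (intro linear_compose_scale_right H.linear_axioms)
  have A_sym: "A x \<bullet> y = x \<bullet> A y" for x y using sym by (simp add: A_def)
  obtain B l where B: "finite B" "B \<subseteq> V" "span B = V" "pairwise orthogonal B" "\<forall>b\<in>B. norm b = 1"
    and l: "\<forall>b\<in>B. \<forall>y\<in>V. A b \<bullet> y = l b * (b \<bullet> y)"
    using symmetric_eigenbasis[OF A A_sym V] by blast
  have frame: "normal_frame n B" using n1 B V_n by (auto simp: normal_frame_def)
  have T: "tangent_space (frontier \<Omega>) w = V" using tangent_space_eq[OF w] by (simp add: V_def)
  have "curvature_eigenspace \<Omega> w k = {X\<in>V. \<forall>Y\<in>V. A X \<bullet> Y = k * (X \<bullet> Y)}" for k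
    unfolding curvature_eigenspace_def T
    using second_fundamental_form_eq[OF w H] by (auto simp: V_def A_def G_def divide_inverse mult.commute)
  from eigenvalue_sum[OF V A A_sym B l this]
  have sum: "sum l B = (real DIM('a) - 1) * mean_curvature \<Omega> w"
    using dim by (simp add: mean_curvature_def principal_curvatures_def)
  obtain L where L: "L > 0" "\<And>y. norm (H y) \<le> norm y * L"
    using bounded_linear.pos_bounded[OF has_derivative_bounded_linear[OF H]] by blast
  have "osculating \<Omega> w n B l" unfolding osculating_def
  proof (intro allI impI)
    fix \<eta> :: real assume \<eta>: "\<eta> > 0"
    obtain d where d: "d > 0" "ball w d \<subseteq> U"
      "\<And>y. norm y < d \<Longrightarrow> \<bar>\<rho> (w + y) - g w \<bullet> y - H y \<bullet> y / 2\<bar> \<le> (\<eta> * G) * (norm y)\<^sup>2"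
      using chart_taylor[OF w H, of "\<eta> * G"] \<eta> G by auto
    \<comment> \<open>The second entry makes the Hessian terms that involve the normal at most
      \<open>\<eta> * G * \<bar>n \<bullet> y\<bar>\<close>.\<close>
    define d' where "d' = min d (\<eta> * G / (2 * L))"
    have d': "d' > 0" using d \<eta> G L by (simp add: d'_def)
    have main: "\<bar>\<rho> (w + y) + G * (n \<bullet> y - frame_quadratic l B y / 2)\<bar> \<le> G * (\<eta> * (\<bar>n \<bullet> y\<bar> + (norm y)\<^sup>2))"
      if y: "norm y < d'" for y
    proof -
      define s where "s = n \<bullet> y"
      define p where "p = (\<Sum>b\<in>B. (y \<bullet> b) *\<^sub>R b)"
      have yp: "y = p + s *\<^sub>R n" using normal_frame_expand[OF frame, of y] by (simp add: p_def s_def)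
      have pV: "p \<in> V" unfolding p_def using B V by (intro subspace_sum subspace_scale) auto
      have pb: "p \<bullet> b = y \<bullet> b" if "b \<in> B" for b
        unfolding p_def by (rule normal_frame_inner_sum[OF frame that])
      have "H p \<bullet> p = G * (A p \<bullet> p)" using G by (simp add: A_def)
      also have "A p \<bullet> p = p \<bullet> A p" by (rule A_sym)
      also have "\<dots> = (\<Sum>b\<in>B. (y \<bullet> b) * (b \<bullet> A p))" by (subst p_def) (simp add: inner_sum_left)
      also have "\<dots> = (\<Sum>b\<in>B. (y \<bullet> b) * (l b * (y \<bullet> b)))"
      proof (intro sum.cong refl)
        fix b assume b: "b \<in> B"
        have "b \<bullet> A p = A b \<bullet> p" by (rule A_sym[symmetric])
        also have "\<dots> = l b * (b \<bullet> p)" using l pV b by blast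
        also have "b \<bullet> p = y \<bullet> b" using pb[OF b] by (simp add: inner_commute)
        finally show "(y \<bullet> b) * (b \<bullet> A p) = (y \<bullet> b) * (l b * (y \<bullet> b))" by simp
      qed
      finally have Hp: "H p \<bullet> p = G * frame_quadratic l B y"
        by (simp add: frame_quadratic_def power2_eq_square mult_ac)
      have "H y \<bullet> y = H p \<bullet> y + s * (H n \<bullet> y)" by (subst (1) yp) (simp add: H.add H.scale inner_simps)
      also have "H p \<bullet> y = H p \<bullet> p + s * (H p \<bullet> n)" by (subst yp) (simp add: inner_simps)
      also have "H p \<bullet> n = H n \<bullet> p" using sym[of n p] by (simp add: inner_commute)
      \<comment> \<open>Every Hessian term involving the normal carries a factor \<open>s\<close>;
        hence the summand \<open>\<bar>n \<bullet> y\<bar>\<close> in the error allowed by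
        \<open>osculating\<close>.\<close>
      finally have Hy: "H y \<bullet> y - H p \<bullet> p = s * (H n \<bullet> (p + y))" by (simp add: inner_simps algebra_simps)
      have "norm (p + y) \<le> 2 * norm y"
      proof -
        have "(norm p)\<^sup>2 = (norm y)\<^sup>2 - s\<^sup>2"
          using n1 pV unfolding yp power2_norm_eq_inner
          by (simp add: V_n inner_simps norm_eq_1 inner_commute[of p n] power2_eq_square)
        then have "(norm p)\<^sup>2 \<le> (norm y)\<^sup>2" by simp
        then have "norm p \<le> norm y" by (simp add: abs_le_square_iff)
        then show ?thesis using norm_triangle_ineq[of p y] by simp
      qed
      then have "\<bar>H n \<bullet> (p + y)\<bar> \<le> L * (2 * norm y)"
        using L(2)[of n] L(1) n1 by (intro order_trans[OF Cauchy_Schwarz_ineq2] mult_mono) auto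
      also have "\<dots> \<le> \<eta> * G" using y L by (simp add: d'_def field_simps)
      finally have "\<bar>s\<bar> * \<bar>H n \<bullet> (p + y)\<bar> \<le> \<bar>s\<bar> * (\<eta> * G)" by (intro mult_left_mono) auto
      then have "\<bar>H y \<bullet> y - H p \<bullet> p\<bar> \<le> \<bar>s\<bar> * (\<eta> * G)" unfolding Hy abs_mult .
      then have "\<bar>H y \<bullet> y / 2 - H p \<bullet> p / 2\<bar> \<le> \<bar>s\<bar> * (\<eta> * G)" by linarith
      moreover have "\<bar>\<rho> (w + y) - g w \<bullet> y - H y \<bullet> y / 2\<bar> \<le> (\<eta> * G) * (norm y)\<^sup>2"
        using d(3) y by (simp add: d'_def)
      moreover have "g w \<bullet> y = - (G * s)" by (simp add: gn s_def)
      ultimately have "\<bar>\<rho> (w + y) + G * s - G * frame_quadratic l B y / 2\<bar> \<le> \<bar>s\<bar> * (\<eta> * G) + (\<eta> * G) * (norm y)\<^sup>2"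
        using Hp by linarith
      then show ?thesis by (simp add: s_def algebra_simps)
    qed
    show "\<exists>d>0. \<forall>y. norm y < d \<longrightarrow>
     (w + y \<in> closure \<Omega> \<longrightarrow> n \<bullet> y \<ge> frame_quadratic l B y / 2 - \<eta> * (\<bar>n \<bullet> y\<bar> + (norm y)\<^sup>2)) \<and>
     (w + y \<notin> \<Omega> \<longrightarrow> n \<bullet> y \<le> frame_quadratic l B y / 2 + \<eta> * (\<bar>n \<bullet> y\<bar> + (norm y)\<^sup>2))"
    proof (intro exI[of _ d'] conjI d' allI impI)
      fix y :: 'a assume y: "norm y < d'"
      then have yU: "w + y \<in> U" using d by (auto simp: d'_def dist_norm subset_iff)
      have pos: "G * a \<le> G * b \<Longrightarrow> a \<le> b" for a b using G by simp
      show "n \<bullet> y \<ge> frame_quadratic l B y / 2 - \<eta> * (\<bar>n \<bullet> y\<bar> + (norm y)\<^sup>2)" if "w + y \<in> closure \<Omega>"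
      proof -
        have "\<rho> (w + y) \<le> 0"
          using that mem_domain_iff[OF yU] mem_frontier_iff[OF yU] by (auto simp: closure_Un_frontier)
        then have "G * (frame_quadratic l B y / 2 - n \<bullet> y) \<le> G * (\<eta> * (\<bar>n \<bullet> y\<bar> + (norm y)\<^sup>2))"
          using main[OF y] by (simp add: algebra_simps abs_le_iff)
        from pos[OF this] show ?thesis by simp
      qed
      show "n \<bullet> y \<le> frame_quadratic l B y / 2 + \<eta> * (\<bar>n \<bullet> y\<bar> + (norm y)\<^sup>2)" if "w + y \<notin> \<Omega>"
      proof -
        have "\<rho> (w + y) \<ge> 0" using that mem_domain_iff[OF yU] by auto
        then have "G * (n \<bullet> y - frame_quadratic l B y / 2) \<le> G * (\<eta> * (\<bar>n \<bullet> y\<bar> + (norm y)\<^sup>2))"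
          using main[OF y] by (simp add: algebra_simps abs_le_iff)
        from pos[OF this] show ?thesis by simp
      qed
    qed
  qed
  with frame sum show thesis by (rule that)
qed

end

text \<open>The gradient is assembled from the directional derivatives along \<open>Basis\<close>;
  its differentiability is the second level of the iterated notion of smoothness.\<close>

lemma smooth_boundary_chart:
  fixes \<Omega> :: "'a::euclidean_space set"
  assumes "open \<Omega>" "smooth_boundary \<Omega>" "w \<in> frontier \<Omega>"
  obtains U \<rho> g where "boundary_chart \<Omega> U \<rho> g" "w \<in> U"
proof -
  obtain U and \<rho> :: "'a \<Rightarrow> real" where U: "open U" "w \<in> U" "smooth_on \<rho> U"
    "\<And>x. x\<in>U \<Longrightarrow> frechet_derivative \<rho> (at x) \<noteq> (\<lambda>v. 0)" "\<Omega> \<inter> U = {x \<in> U. \<rho> x < 0}"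
    using assms(2,3) unfolding smooth_boundary_def by meson
  have C2: "Ck_on (Suc (Suc 0)) \<rho> U" using U(3) unfolding smooth_on_def by blast
  define g where "g x = (\<Sum>e\<in>Basis. frechet_derivative \<rho> (at x) e *\<^sub>R e)" for x
  have D: "(\<rho> has_derivative frechet_derivative \<rho> (at x)) (at x)" if "x \<in> U" for x
    using C2 that by (simp flip: frechet_derivative_works)
  have g: "frechet_derivative \<rho> (at x) = (\<lambda>h. g x \<bullet> h)" if "x \<in> U" for x
  proof
    fix h
    interpret linear "frechet_derivative \<rho> (at x)" using D[OF that] by (rule has_derivative_linear)
    have "frechet_derivative \<rho> (at x) h = frechet_derivative \<rho> (at x) (\<Sum>e\<in>Basis. (h \<bullet> e) *\<^sub>R e)"
      by (simp add: euclidean_representation)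
    also have "\<dots> = g x \<bullet> h"
      by (simp add: sum scale g_def inner_sum_left inner_commute[of h] mult.commute)
    finally show "frechet_derivative \<rho> (at x) h = g x \<bullet> h" .
  qed
  have "boundary_chart \<Omega> U \<rho> g"
  proof
    show "open \<Omega>" "open U" "\<Omega> \<inter> U = {x \<in> U. \<rho> x < 0}" by fact+
    fix x assume x: "x \<in> U"
    show "(\<rho> has_derivative (\<lambda>h. g x \<bullet> h)) (at x)" using D[OF x] g[OF x] by simp
    show "g differentiable (at x)" unfolding g_def
      using C2 x by (intro differentiable_sum differentiable_scaleR) auto
    show "g x \<noteq> 0" using U(4)[OF x] g[OF x] by auto
  qed
  then show thesis using U(2) by (rule that)
qed

section \<open>From second differences to the mean value inequality\<close>

lemma integrable_compact_support:
  fixes f :: "'a::euclidean_space \<Rightarrow> real"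
  assumes "continuous_on UNIV f" "\<And>x. x \<notin> cball a r \<Longrightarrow> f x = 0"
  shows "integrable lborel f"
proof -
  have "integrable lborel (\<lambda>x. indicator (cball a r) x *\<^sub>R f x)"
    using assms(1) by (intro borel_integrable_compact) (auto intro: continuous_on_subset)
  also have "(\<lambda>x. indicator (cball a r) x *\<^sub>R f x) = f"
    using assms(2) by (auto simp: indicator_def fun_eq_iff)
  finally show ?thesis .
qed

lemma lborel_integral_translation:
  fixes f :: "'a::euclidean_space \<Rightarrow> real"
  assumes "continuous_on UNIV f"
  shows "(\<integral>x. f (h + x) \<partial>lborel) = (\<integral>x. f x \<partial>lborel)"
proof -
  have "f \<in> borel_measurable borel" using assms by (rule borel_measurable_continuous_onI)
  then have "(\<integral>x. f x \<partial>distr lborel borel ((+) h)) = (\<integral>x. f (h + x) \<partial>lborel)"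
    by (intro integral_distr) auto
  then show ?thesis by (simp add: lborel_distr_plus)
qed

lemma lborel_integral_eq_cbox_integral:
  fixes f :: "'a::euclidean_space \<Rightarrow> real"
  assumes "continuous_on UNIV f" "\<And>x. x \<notin> cbox a b \<Longrightarrow> f x = 0"
  shows "integral (cbox a b) f = (\<integral>x. f x \<partial>lborel)"
proof -
  have "set_integrable lborel (cbox a b) f"
    unfolding set_integrable_def using assms(1) by (intro borel_integrable_compact) (auto intro: continuous_on_subset)
  from set_borel_integral_eq_integral(2)[OF this]
  have "integral (cbox a b) f = (\<integral>x. indicator (cbox a b) x *\<^sub>R f x \<partial>lborel)"
    by (simp add: set_lebesgue_integral_def)
  also have "(\<lambda>x. indicator (cbox a b) x *\<^sub>R f x) = f"
    using assms(2) by (auto simp: indicator_def fun_eq_iff)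
  finally show ?thesis .
qed

section \<open>Second differences and their transposition under the integral\<close>

definition second_difference :: "('a::real_vector \<Rightarrow> real) \<Rightarrow> 'a \<Rightarrow> 'a \<Rightarrow> real" where
  "second_difference u h z = u (z + h) + u (z - h) - 2 * u z"

definition discrete_laplacian :: "('a::euclidean_space \<Rightarrow> real) \<Rightarrow> real \<Rightarrow> 'a \<Rightarrow> real" where
  "discrete_laplacian u r z = (\<Sum>e\<in>Basis. second_difference u (r *\<^sub>R e) z)"

lemma continuous_on_second_difference [continuous_intros]:
  fixes u :: "'a::real_normed_vector \<Rightarrow> real"
  assumes "continuous_on UNIV u" shows "continuous_on UNIV (second_difference u h)"
  unfolding second_difference_def
  by (intro continuous_intros continuous_on_compose2[OF assms]) auto

lemma continuous_on_discrete_laplacian [continuous_intros]: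
  fixes u :: "'a::euclidean_space \<Rightarrow> real"
  assumes "continuous_on UNIV u" shows "continuous_on UNIV (discrete_laplacian u r)"
  unfolding discrete_laplacian_def by (intro continuous_intros assms)

text \<open>Discrete integration by parts: translation invariance moves the shift by
  \<open>h\<close> from \<open>u\<close> to the shift by \<open>- h\<close> of \<open>g\<close>, and
  the second difference contains both shifts. Continuity of \<open>u\<close> is enough.\<close>

lemma second_difference_symmetric:
  fixes u g :: "'a::euclidean_space \<Rightarrow> real"
  assumes u: "continuous_on UNIV u" and g: "continuous_on UNIV g" and supp: "\<And>x. x \<notin> cball a r \<Longrightarrow> g x = 0"
  shows "(\<integral>z. g z * second_difference u h z \<partial>lborel) = (\<integral>z. u z * second_difference g h z \<partial>lborel)"
proof -
  have c: "continuous_on UNIV (\<lambda>x. u (x + k))" "continuous_on UNIV (\<lambda>x. g (x + k))" for k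
    by (intro continuous_on_compose2[OF u] continuous_on_compose2[OF g] continuous_intros; simp)+
  have i1: "integrable lborel (\<lambda>z. g z * u (z + k))" for k
    using supp by (intro integrable_compact_support[where a=a and r=r] continuous_intros g c) auto
  have i2: "integrable lborel (\<lambda>z. u z * g (z + k))" for k
  proof (intro integrable_compact_support[where a=a and r="r + norm k"] continuous_intros u c)
    fix x assume "x \<notin> cball a (r + norm k)"
    moreover have "dist a x \<le> dist a (x + k) + norm k"
      using dist_triangle[of a x "x + k"] by (simp add: dist_norm)
    ultimately show "u x * g (x + k) = 0" using supp[of "x + k"] by simp
  qed
  have t: "(\<integral>z. g z * u (z + k) \<partial>lborel) = (\<integral>z. u z * g (z + - k) \<partial>lborel)" for k
  proof -
    have "continuous_on UNIV (\<lambda>z. u z * g (z + - k))" by (intro continuous_intros u c)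
    from lborel_integral_translation[OF this, of k] show ?thesis by (simp add: add.commute mult.commute)
  qed
  have "(\<integral>z. g z * second_difference u h z \<partial>lborel)
      = (\<integral>z. g z * u (z + h) + g z * u (z + - h) - 2 * (g z * u (z + 0)) \<partial>lborel)"
    by (simp add: second_difference_def algebra_simps)
  also have "\<dots> = (\<integral>z. g z * u (z + h) \<partial>lborel) + (\<integral>z. g z * u (z + - h) \<partial>lborel) - 2 * (\<integral>z. g z * u (z + 0) \<partial>lborel)"
    using i1[of h] i1[of "-h"] i1[of 0] by simp
  also have "\<dots> = (\<integral>z. u z * g (z + - h) \<partial>lborel) + (\<integral>z. u z * g (z + h) \<partial>lborel) - 2 * (\<integral>z. u z * g (z + 0) \<partial>lborel)"
    using t[of h] t[of "-h"] t[of 0] by simp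
  also have "\<dots> = (\<integral>z. u z * g (z + - h) + u z * g (z + h) - 2 * (u z * g (z + 0)) \<partial>lborel)"
    using i2[of h] i2[of "-h"] i2[of 0] by simp
  also have "\<dots> = (\<integral>z. u z * second_difference g h z \<partial>lborel)"
    by (simp add: second_difference_def algebra_simps)
  finally show ?thesis .
qed

lemma discrete_laplacian_symmetric:
  fixes u g :: "'a::euclidean_space \<Rightarrow> real"
  assumes u: "continuous_on UNIV u" and g: "continuous_on UNIV g" and supp: "\<And>x. x \<notin> cball a s \<Longrightarrow> g x = 0"
  shows "(\<integral>z. g z * discrete_laplacian u r z \<partial>lborel) = (\<integral>z. u z * discrete_laplacian g r z \<partial>lborel)"
proof -
  have i1: "integrable lborel (\<lambda>z. g z * second_difference u h z)" for h
    using supp by (intro integrable_compact_support[where a=a and r=s] continuous_intros g u) auto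
  have i2: "integrable lborel (\<lambda>z. u z * second_difference g h z)" for h
  proof (intro integrable_compact_support[where a=a and r="s + norm h"] continuous_intros g u)
    fix x assume "x \<notin> cball a (s + norm h)"
    moreover have "dist a x \<le> dist a (x + h) + norm h" "dist a x \<le> dist a (x - h) + norm h"
      using dist_triangle[of a x "x + h"] dist_triangle[of a x "x - h"] by (simp_all add: dist_norm)
    moreover have "norm h \<ge> 0" by simp
    ultimately have "x + h \<notin> cball a s" "x - h \<notin> cball a s" "x \<notin> cball a s" unfolding mem_cball by linarith+
    then show "u x * second_difference g h x = 0" using supp by (simp add: second_difference_def)
  qed
  show ?thesis
    unfolding discrete_laplacian_def sum_distrib_left
    using i1 i2 second_difference_symmetric[OF u g supp]
    by (simp add: Bochner_Integration.integral_sum)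
qed

section \<open>Calculus of compactly supported radial profiles\<close>

lemma symmetric_difference_mvt:
  fixes f :: "real \<Rightarrow> real"
  assumes f: "\<And>t. (f has_real_derivative f' t) (at t)" "\<And>t. (f' has_real_derivative f'' t) (at t)" and r: "r > 0"
  obtains t where "0 < t" "t \<le> r" "f r + f (- r) - 2 * f 0 = r\<^sup>2 * (f'' t + f'' (- t)) / 2"
proof -
  \<comment> \<open>Derivatives of the even function \<open>f t + f (- t)\<close>. The first one
    vanishes at 0, so the Maclaurin formula leaves only the second-order term.\<close>
  define F where "F = (\<lambda>k::nat. if k = 0 then (\<lambda>t. f t + f (- t)) else if k = 1 then (\<lambda>t. f' t - f' (- t)) else (\<lambda>t. f'' t + f'' (- t)))"
  have m: "((\<lambda>t. f (- t)) has_real_derivative - f' (- t)) (at t)" "((\<lambda>t. f' (- t)) has_real_derivative - f'' (- t)) (at t)" for t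
    using DERIV_chain2[OF f(1) DERIV_minus[OF DERIV_ident], of t UNIV] DERIV_chain2[OF f(2) DERIV_minus[OF DERIV_ident], of t UNIV]
    by simp_all
  have "\<forall>k t. k < 2 \<and> 0 \<le> t \<and> t \<le> r \<longrightarrow> DERIV (F k) t :> F (Suc k) t"
  proof (intro allI impI)
    fix k :: nat and t assume "k < 2 \<and> 0 \<le> t \<and> t \<le> r"
    then consider "k = 0" | "k = 1" by linarith
    then show "DERIV (F k) t :> F (Suc k) t"
    proof cases
      case 1 then show ?thesis using DERIV_add[OF f(1) m(1)] by (simp add: F_def)
    next
      case 2 then show ?thesis using DERIV_diff[OF f(2) m(2)] by (simp add: F_def)
    qed
  qed
  from Maclaurin2[OF r _ this, of "F 0"] obtain t where t: "0 < t" "t \<le> r"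
    "F 0 r = (\<Sum>k<2. F k 0 / fact k * r ^ k) + F 2 t / fact 2 * r ^ 2" by auto
  then have "f r + f (- r) - 2 * f 0 = r\<^sup>2 * (f'' t + f'' (- t)) / 2"
    by (simp add: F_def numeral_2_eq_2 field_simps)
  with t show thesis by (intro that[of t])
qed

text \<open>The kink of \<open>max 0 (1 - t)\<close> at 1 is flattened because
  \<open>F' 0 = 0\<close>. Used for a profile and again for its derivative, this cuts them off at 1
  with the required regularity.\<close>

lemma has_real_derivative_pos_part:
  assumes F: "\<And>x. (F has_real_derivative F' x) (at x)" and 0: "F' 0 = 0"
  shows "((\<lambda>t. F (max 0 (1 - t))) has_real_derivative - F' (max 0 (1 - t))) (at t)"
proof -
  consider "t < 1" | "t > 1" | "t = 1" by linarith
  then show ?thesis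
  proof cases
    case 1
    have "((\<lambda>t. F (1 - t)) has_real_derivative F' (1 - t) * (- 1)) (at t)"
      by (rule DERIV_chain2[OF F]) (auto intro!: derivative_eq_intros)
    then have "((\<lambda>t. F (1 - t)) has_real_derivative - F' (max 0 (1 - t))) (at t)" using 1 by (simp add: max_def)
    moreover have "\<forall>\<^sub>F x in nhds t. F (1 - x) = F (max 0 (1 - x))"
      using eventually_nhds_in_open[of "{..<1}" t] 1 by (auto elim!: eventually_mono simp: max_def)
    ultimately show ?thesis by (simp add: DERIV_cong_ev)
  next
    case 2
    have "((\<lambda>t. F 0) has_real_derivative - F' (max 0 (1 - t))) (at t)" using 2 0 by (simp add: max_def)
    moreover have "\<forall>\<^sub>F x in nhds t. F 0 = F (max 0 (1 - x))"
      using eventually_nhds_in_open[of "{1<..}" t] 2 by (auto elim!: eventually_mono simp: max_def)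
    ultimately show ?thesis by (simp add: DERIV_cong_ev)
  next
    case 3
    \<comment> \<open>At the kink the Caratheodory slope \<open>E\<close> is continuous with value
      0, and it bounds the difference quotients from both sides.\<close>
    from F[of 0] obtain E where E: "\<And>z. F z - F 0 = E z * (z - 0)" "isCont E 0" "E 0 = 0"
      unfolding CARAT_DERIV using 0 by auto
    have "((\<lambda>h. (F (max 0 (1 - (1 + h))) - F (max 0 (1 - 1))) / h) \<longlongrightarrow> 0) (at 0)"
    proof (rule Lim_null_comparison)
      have "isCont (\<lambda>h. \<bar>E (max 0 (- h))\<bar>) 0"
        by (intro isCont_rabs isCont_o2[where g=E and f="\<lambda>h. max 0 (- h)"] continuous_intros) (simp add: E(2))
      then show "((\<lambda>h. \<bar>E (max 0 (- h))\<bar>) \<longlongrightarrow> 0) (at 0)" using E(3) by (simp add: isCont_def)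
      show "\<forall>\<^sub>F h in at 0. norm ((F (max 0 (1 - (1 + h))) - F (max 0 (1 - 1))) / h) \<le> \<bar>E (max 0 (- h))\<bar>"
      proof (rule eventuallyI)
        fix h :: real
        have "\<bar>E (max 0 (- h)) * max 0 (- h)\<bar> \<le> \<bar>E (max 0 (- h))\<bar> * \<bar>h\<bar>"
          unfolding abs_mult by (intro mult_left_mono) auto
        then show "norm ((F (max 0 (1 - (1 + h))) - F (max 0 (1 - 1))) / h) \<le> \<bar>E (max 0 (- h))\<bar>"
          using E(1)[of "max 0 (- h)"] by (cases "h = 0") (simp_all add: pos_divide_le_eq)
      qed
    qed
    then show ?thesis using 3 0 by (simp add: DERIV_def)
  qed
qed

text \<open>With \<open>m\<close> the dimension, \<open>p (norm y ^ 2 / s ^ 2) / s ^ m\<close> is a radial weight of constant mass, and because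
  \<open>Q' = - p\<close> its derivative in \<open>s\<close> is a positive multiple of the Laplacian of
  \<open>Q (norm y ^ 2 / s ^ 2)\<close>. This replaces spherical means and Green's formula.\<close>

locale radial_profile =
  fixes Q p dp :: "real \<Rightarrow> real"
  assumes Q_deriv: "\<And>t. (Q has_real_derivative - p t) (at t)"
    and p_deriv: "\<And>t. (p has_real_derivative dp t) (at t)"
    and dp_continuous: "continuous_on UNIV dp"
    and Q_nonneg: "\<And>t. 0 \<le> Q t" and p_nonneg: "\<And>t. 0 \<le> p t"
    and vanish: "\<And>t. 1 \<le> t \<Longrightarrow> Q t = 0 \<and> p t = 0 \<and> dp t = 0"
begin

definition bump :: "real \<Rightarrow> 'a::euclidean_space \<Rightarrow> real" where
  "bump s y = Q ((norm y)\<^sup>2 / s\<^sup>2)"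

text \<open>By the chain rule with \<open>Q' = - p\<close>, the second derivative of
  \<open>bump s\<close> in a unit direction \<open>e\<close>; summed over \<open>Basis\<close> it is
  the Laplacian.\<close>

definition bump_dd :: "real \<Rightarrow> 'a::euclidean_space \<Rightarrow> 'a \<Rightarrow> real" where
  "bump_dd s e y = - dp ((norm y)\<^sup>2 / s\<^sup>2) * (2 * (y \<bullet> e) / s\<^sup>2)\<^sup>2 - p ((norm y)\<^sup>2 / s\<^sup>2) * (2 / s\<^sup>2)"

lemma Q_continuous: "continuous_on UNIV Q" and p_continuous: "continuous_on UNIV p"
  using Q_deriv p_deriv by (auto intro!: continuous_at_imp_continuous_on DERIV_isCont)

lemma outside: "0 < s \<Longrightarrow> s \<le> norm y \<Longrightarrow> 1 \<le> (norm y)\<^sup>2 / s\<^sup>2"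
  by (simp add: power_mono)

lemma bump_continuous: "continuous_on UNIV (bump s)"
  unfolding bump_def divide_inverse by (intro continuous_on_compose2[OF Q_continuous] continuous_intros) auto

lemma bump_dd_continuous: "continuous_on UNIV (bump_dd s e)"
  unfolding bump_dd_def divide_inverse
  by (intro continuous_intros continuous_on_compose2[OF p_continuous] continuous_on_compose2[OF dp_continuous]) auto

lemma bump_zero: "0 < s \<Longrightarrow> s \<le> norm y \<Longrightarrow> bump s y = 0"
  using vanish[OF outside[of s y]] by (simp add: bump_def)

lemma bump_dd_zero: "0 < s \<Longrightarrow> s \<le> norm y \<Longrightarrow> bump_dd s e y = 0"
  using vanish[OF outside[of s y]] by (simp add: bump_dd_def)

text \<open>The exact mean value form serves twice: boundedness of \<open>bump_dd\<close> dominates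
  the difference quotients uniformly in \<open>r\<close>, and its continuity gives their
  limit.\<close>

lemma bump_second_difference:
  assumes e: "e \<in> Basis" and r: "r > 0"
  obtains t where "0 < t" "t \<le> r"
    "second_difference (bump s) (r *\<^sub>R e) y = r\<^sup>2 * (bump_dd s e (y + t *\<^sub>R e) + bump_dd s e (y + (- t) *\<^sub>R e)) / 2"
proof -
  have ee: "e \<bullet> e = 1" using e by simp
  have nrm: "(norm (y + t *\<^sub>R e))\<^sup>2 = (norm y)\<^sup>2 + 2 * t * (y \<bullet> e) + t\<^sup>2" for t
    unfolding power2_norm_eq_inner using ee by (simp add: inner_simps inner_commute[of e y] power2_eq_square distrib_left)
  have in_e: "(y + t *\<^sub>R e) \<bullet> e = y \<bullet> e + t" for t using ee by (simp add: inner_simps)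
  define a where "a t = (norm (y + t *\<^sub>R e))\<^sup>2 / s\<^sup>2" for t
  define a' where "a' t = 2 * ((y + t *\<^sub>R e) \<bullet> e) / s\<^sup>2" for t
  have a: "(a has_real_derivative a' t) (at t)" for t
    unfolding a_def a'_def nrm in_e divide_inverse
    by (auto intro!: derivative_eq_intros simp: algebra_simps)
  have a': "(a' has_real_derivative 2 / s\<^sup>2) (at t)" for t
    unfolding a'_def in_e divide_inverse by (auto intro!: derivative_eq_intros)
  have 1: "((\<lambda>t. bump s (y + t *\<^sub>R e)) has_real_derivative - p (a t) * a' t) (at t)" for t
    unfolding bump_def a_def[symmetric] by (rule DERIV_chain2[OF Q_deriv a])
  have 2: "((\<lambda>t. - p (a t) * a' t) has_real_derivative bump_dd s e (y + t *\<^sub>R e)) (at t)" for t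
    unfolding bump_dd_def a_def[symmetric] a'_def[symmetric]
    by (rule DERIV_cong[OF DERIV_mult[OF DERIV_minus[OF DERIV_chain2[OF p_deriv a]] a']]) (simp add: power2_eq_square)
  from symmetric_difference_mvt[OF 1 2 r] obtain t where "0 < t" "t \<le> r"
    "bump s (y + r *\<^sub>R e) + bump s (y + (- r) *\<^sub>R e) - 2 * bump s (y + 0 *\<^sub>R e)
      = r\<^sup>2 * (bump_dd s e (y + t *\<^sub>R e) + bump_dd s e (y + (- t) *\<^sub>R e)) / 2" by blast
  then show thesis by (intro that[of t]) (simp_all add: second_difference_def)
qed

lemma bump_dd_bounded:
  assumes "0 < s" obtains M where "M \<ge> 0" "\<And>y::'a::euclidean_space. \<bar>bump_dd s e y\<bar> \<le> M"
proof -
  have "compact (bump_dd s e ` cball 0 s)"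
    by (intro compact_continuous_image continuous_on_subset[OF bump_dd_continuous]) auto
  then obtain M where M: "\<And>y::'a. y \<in> cball 0 s \<Longrightarrow> \<bar>bump_dd s e y\<bar> \<le> M"
    using compact_imp_bounded[of "bump_dd s e ` cball 0 s"] unfolding bounded_iff by fastforce
  show thesis
  proof (rule that[of "max M 0"])
    fix y :: 'a show "\<bar>bump_dd s e y\<bar> \<le> max M 0"
      using M[of y] bump_dd_zero[OF assms, of y e] by (cases "norm y \<le> s") auto
  qed simp
qed

lemma bump_laplacian_tendsto:
  "((\<lambda>r. discrete_laplacian (bump s) r y / r\<^sup>2) \<longlongrightarrow> (\<Sum>e\<in>Basis. bump_dd s e y)) (at_right 0)"
  unfolding discrete_laplacian_def sum_divide_distrib
proof (intro tendsto_sum)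
  fix e :: 'a assume e: "e \<in> Basis"
  have "isCont (\<lambda>t. bump_dd s e (y + t *\<^sub>R e)) 0"
  proof (rule isCont_o2[where g="bump_dd s e" and f="\<lambda>t. y + t *\<^sub>R e"])
    show "isCont (\<lambda>t. y + t *\<^sub>R e) 0" by (intro continuous_intros)
    show "isCont (bump_dd s e) (y + 0 *\<^sub>R e)"
      using bump_dd_continuous[of s e] by (simp only: continuous_on_eq_continuous_at[OF open_UNIV]) blast
  qed
  then have lim: "((\<lambda>t. bump_dd s e (y + t *\<^sub>R e)) \<longlongrightarrow> bump_dd s e y) (at 0)" by (simp add: isCont_def)
  show "((\<lambda>r. second_difference (bump s) (r *\<^sub>R e) y / r\<^sup>2) \<longlongrightarrow> bump_dd s e y) (at_right 0)"
  proof (rule tendstoI)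
    fix \<eta> :: real assume "\<eta> > 0"
    from tendstoD[OF lim this] obtain d where d: "d > 0"
      "\<And>t. t \<noteq> 0 \<Longrightarrow> \<bar>t\<bar> < d \<Longrightarrow> \<bar>bump_dd s e (y + t *\<^sub>R e) - bump_dd s e y\<bar> < \<eta>"
      by (auto simp: eventually_at dist_real_def)
    show "\<forall>\<^sub>F r in at_right 0. dist (second_difference (bump s) (r *\<^sub>R e) y / r\<^sup>2) (bump_dd s e y) < \<eta>"
      unfolding eventually_at_right_field
    proof (intro exI[of _ d] conjI d(1) allI impI)
      fix r assume r: "0 < r" "r < d"
      from bump_second_difference[OF e r(1), of s y] obtain t where t: "0 < t" "t \<le> r"
        "second_difference (bump s) (r *\<^sub>R e) y = r\<^sup>2 * (bump_dd s e (y + t *\<^sub>R e) + bump_dd s e (y + (- t) *\<^sub>R e)) / 2" .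
      have *: "second_difference (bump s) (r *\<^sub>R e) y / r\<^sup>2 = (bump_dd s e (y + t *\<^sub>R e) + bump_dd s e (y + (- t) *\<^sub>R e)) / 2"
        unfolding t(3) using r by simp
      have "\<bar>bump_dd s e (y + t *\<^sub>R e) - bump_dd s e y\<bar> < \<eta>" "\<bar>bump_dd s e (y + (- t) *\<^sub>R e) - bump_dd s e y\<bar> < \<eta>"
        using d(2)[of t] d(2)[of "- t"] t r by auto
      moreover have "\<bar>(a + b) / 2 - c\<bar> < \<eta>" if "\<bar>a - c\<bar> < \<eta>" "\<bar>b - c\<bar> < \<eta>" for a b c :: real
        using that by (simp add: abs_less_iff field_simps)
      ultimately show "dist (second_difference (bump s) (r *\<^sub>R e) y / r\<^sup>2) (bump_dd s e y) < \<eta>"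
        unfolding dist_real_def * by blast
    qed
  qed
qed

end

text \<open>A substitute for a nonnegative Laplacian that makes sense without differentiability. In
  the second clause \<open>\<delta>\<close> may depend on \<open>z\<close>; the uniform first clause
  supplies the domination for limits under the integral. Points outside \<open>S\<close> may enter
  the differences, since \<open>r\<close> is unrestricted in the first clause.\<close>

definition discretely_subharmonic_on :: "'a::euclidean_space set \<Rightarrow> ('a \<Rightarrow> real) \<Rightarrow> bool" where
  "discretely_subharmonic_on S u \<longleftrightarrow>
     (\<exists>C. \<forall>z\<in>S. \<forall>r>0. - C * r\<^sup>2 \<le> discrete_laplacian u r z) \<and>
     (\<forall>z\<in>S. \<forall>\<eta>>0. \<exists>\<delta>>0. \<forall>r. 0 < r \<and> r < \<delta> \<longrightarrow> - \<eta> * r\<^sup>2 \<le> discrete_laplacian u r z)"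

lemma discretely_subharmonic_on_subset:
  "discretely_subharmonic_on S u \<Longrightarrow> T \<subseteq> S \<Longrightarrow> discretely_subharmonic_on T u"
  unfolding discretely_subharmonic_on_def by (meson subsetD)

lemma discretely_subharmonic_on_const: "discretely_subharmonic_on S (\<lambda>z. c)"
proof -
  have "discrete_laplacian (\<lambda>z::'a. c) r z = 0" for r z
    by (simp add: discrete_laplacian_def second_difference_def)
  then show ?thesis unfolding discretely_subharmonic_on_def
    by (auto intro!: exI[of _ 0] exI[of _ 1])
qed

lemma discretely_subharmonic_on_diff_const:
  "discretely_subharmonic_on S u \<Longrightarrow> discretely_subharmonic_on S (\<lambda>z. u z - c)"
  unfolding discretely_subharmonic_on_def discrete_laplacian_def second_difference_def
  by (simp add: algebra_simps)

text \<open>The difference quotients of \<open>u\<close> are bounded below, but not above, uniformly in \<open>r\<close>; dominated convergence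
  is therefore applied to their negative parts.\<close>

lemma (in radial_profile) bump_laplacian_integral_nonneg:
  fixes u :: "'a::euclidean_space \<Rightarrow> real"
  assumes u: "continuous_on UNIV u" and s: "0 < s" and sub: "discretely_subharmonic_on (ball x0 s) u"
  shows "0 \<le> (\<integral>z. u z * (\<Sum>e\<in>Basis. bump_dd s e (z - x0)) \<partial>lborel)"
proof -
  define G where "G z = bump s (z - x0)" for z
  have G_cont: "continuous_on UNIV G" unfolding G_def
    by (intro continuous_on_compose2[OF bump_continuous] continuous_intros) auto
  have G_zero: "G z = 0" if "z \<notin> ball x0 s" for z
    using that bump_zero[OF s, of "z - x0"] by (simp add: G_def dist_norm norm_minus_commute)
  have G_zero': "G z = 0" if "z \<notin> cball x0 s" for z using that by (intro G_zero) auto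
  have G_nonneg: "0 \<le> G z" for z using Q_nonneg by (simp add: G_def bump_def)
  have DG: "discrete_laplacian G r z = discrete_laplacian (bump s) r (z - x0)" for r z
    by (simp add: discrete_laplacian_def second_difference_def G_def algebra_simps)
  have "\<exists>M. 0 \<le> M \<and> (\<forall>y::'a. \<bar>bump_dd s e y\<bar> \<le> M)" for e
    by (rule bump_dd_bounded[OF s, of e]) blast
  then obtain M where M: "\<And>e. 0 \<le> M e" "\<And>e y::'a. \<bar>bump_dd s e y\<bar> \<le> M e"
    by metis
  define N where "N = (\<Sum>e\<in>(Basis::'a set). M e)"
  have N0: "N \<ge> 0" unfolding N_def using M by (intro sum_nonneg)
  have DG_bound: "\<bar>discrete_laplacian G r z / r\<^sup>2\<bar> \<le> N" if "r > 0" for r z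
  proof -
    have "\<bar>second_difference (bump s) (r *\<^sub>R e) y / r\<^sup>2\<bar> \<le> M e" if e: "e \<in> Basis" for e y :: 'a
    proof -
      from bump_second_difference[OF e \<open>r > 0\<close>, of s y] obtain t where t: "0 < t" "t \<le> r"
        "second_difference (bump s) (r *\<^sub>R e) y = r\<^sup>2 * (bump_dd s e (y + t *\<^sub>R e) + bump_dd s e (y + (- t) *\<^sub>R e)) / 2" .
      have *: "second_difference (bump s) (r *\<^sub>R e) y / r\<^sup>2 = (bump_dd s e (y + t *\<^sub>R e) + bump_dd s e (y + (- t) *\<^sub>R e)) / 2"
        unfolding t(3) using \<open>r > 0\<close> by simp
      have "\<bar>(a + b) / 2\<bar> \<le> m" if "\<bar>a\<bar> \<le> m" "\<bar>b\<bar> \<le> m" for a b m :: real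
        using that by (simp add: abs_le_iff field_simps)
      then show ?thesis unfolding * using M(2) by blast
    qed
    then show ?thesis unfolding DG unfolding discrete_laplacian_def sum_divide_distrib N_def
      by (intro order_trans[OF sum_abs] sum_mono)
  qed
  have DG_zero: "discrete_laplacian G r z = 0" if "z \<notin> cball x0 (s + 1)" "0 < r" "r \<le> 1" for r z
  proof -
    have "second_difference G (r *\<^sub>R e) z = 0" if e: "e \<in> Basis" for e
    proof -
      have "dist x0 z \<le> dist x0 (z + r *\<^sub>R e) + r" "dist x0 z \<le> dist x0 (z - r *\<^sub>R e) + r"
        using dist_triangle[of x0 z "z + r *\<^sub>R e"] dist_triangle[of x0 z "z - r *\<^sub>R e"] e \<open>0 < r\<close> by (simp_all add: dist_norm)
      then have "z + r *\<^sub>R e \<notin> cball x0 s" "z - r *\<^sub>R e \<notin> cball x0 s" "z \<notin> cball x0 s"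
        using \<open>z \<notin> cball x0 (s + 1)\<close> \<open>r \<le> 1\<close> unfolding mem_cball by linarith+
      then show ?thesis using G_zero' by (simp add: second_difference_def)
    qed
    then show ?thesis by (simp add: discrete_laplacian_def)
  qed
  from sub obtain C0 where C0: "\<And>z r. z \<in> ball x0 s \<Longrightarrow> 0 < r \<Longrightarrow> - C0 * r\<^sup>2 \<le> discrete_laplacian u r z"
    unfolding discretely_subharmonic_on_def by blast
  define C where "C = \<bar>C0\<bar>"
  have C: "- C \<le> discrete_laplacian u r z / r\<^sup>2" if "z \<in> ball x0 s" "0 < r" for z r
  proof -
    have "- C0 \<le> discrete_laplacian u r z / r\<^sup>2" using C0[OF that] that(2) by (simp add: pos_le_divide_eq)
    then show ?thesis by (simp add: C_def)
  qed
  define r where "r k = 1 / real (Suc k)" for k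
  have r: "0 < r k" "r k \<le> 1" for k by (auto simp: r_def)
  have r_lim: "filterlim r (at_right 0) sequentially"
    unfolding filterlim_at using r LIMSEQ_inverse_real_of_nat
    by (auto simp: r_def[abs_def] divide_inverse)
  let ?A = "\<lambda>k. \<integral>z. u z * (discrete_laplacian G (r k) z / (r k)\<^sup>2) \<partial>lborel"
  have lim_A: "?A \<longlonglongrightarrow> (\<integral>z. u z * (\<Sum>e\<in>Basis. bump_dd s e (z - x0)) \<partial>lborel)"
  proof (rule integral_dominated_convergence[where w="\<lambda>z. indicator (cball x0 (s + 1)) z *\<^sub>R (\<bar>u z\<bar> * N)"])
    have "continuous_on UNIV (\<lambda>z. u z * (\<Sum>e\<in>Basis. bump_dd s e (z - x0)))"
      by (intro continuous_intros u continuous_on_compose2[OF bump_dd_continuous]) auto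
    then show "(\<lambda>z. u z * (\<Sum>e\<in>Basis. bump_dd s e (z - x0))) \<in> borel_measurable lborel"
      by (simp add: borel_measurable_continuous_onI)
    have "continuous_on UNIV (\<lambda>z. u z * (discrete_laplacian G (r k) z / (r k)\<^sup>2))" for k
      using r(1)[of k] by (intro continuous_intros u G_cont) auto
    then show "(\<lambda>z. u z * (discrete_laplacian G (r k) z / (r k)\<^sup>2)) \<in> borel_measurable lborel" for k
      by (simp add: borel_measurable_continuous_onI)
    show "integrable lborel (\<lambda>z. indicator (cball x0 (s + 1)) z *\<^sub>R (\<bar>u z\<bar> * N))"
      by (intro borel_integrable_compact continuous_intros continuous_on_subset[OF u]) auto
    show "AE z in lborel. (\<lambda>k. u z * (discrete_laplacian G (r k) z / (r k)\<^sup>2))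
        \<longlonglongrightarrow> u z * (\<Sum>e\<in>Basis. bump_dd s e (z - x0))"
      unfolding DG
      by (intro AE_I2 tendsto_mult_left filterlim_compose[OF bump_laplacian_tendsto r_lim])
    show "AE z in lborel. norm (u z * (discrete_laplacian G (r k) z / (r k)\<^sup>2))
        \<le> indicator (cball x0 (s + 1)) z *\<^sub>R (\<bar>u z\<bar> * N)" for k
    proof (rule AE_I2)
      fix z show "norm (u z * (discrete_laplacian G (r k) z / (r k)\<^sup>2))
        \<le> indicator (cball x0 (s + 1)) z *\<^sub>R (\<bar>u z\<bar> * N)"
        using DG_zero[OF _ r, of z k] mult_left_mono[OF DG_bound[OF r(1), of k z] abs_ge_zero[of "u z"]]
        by (cases "z \<in> cball x0 (s + 1)") (simp_all add: abs_mult)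
    qed
  qed
  \<comment> \<open>Weighted negative parts of the quotients of \<open>u\<close>: dominated by
    \<open>G z * C\<close> through the first clause of the hypothesis, and tending to 0 pointwise
    through the second.\<close>
  let ?B = "\<lambda>k z. G z * min 0 (discrete_laplacian u (r k) z / (r k)\<^sup>2)"
  have B_cont: "continuous_on UNIV (?B k)" for k
    using r(1)[of k] by (intro continuous_intros u G_cont) auto
  have lim_B: "(\<lambda>k. \<integral>z. ?B k z \<partial>lborel) \<longlonglongrightarrow> (\<integral>z. 0 \<partial>(lborel :: 'a measure))"
  proof (rule integral_dominated_convergence[where w="\<lambda>z. G z * C"])
    show "?B k \<in> borel_measurable lborel" for k
      using B_cont by (simp add: borel_measurable_continuous_onI)
    show "integrable lborel (\<lambda>z. G z * C)"
      using G_zero' by (intro integrable_compact_support[where a=x0 and r=s] continuous_intros G_cont) auto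
    show "AE z in lborel. norm (?B k z) \<le> G z * C" for k
    proof (rule AE_I2)
      fix z
      show "norm (?B k z) \<le> G z * C"
      proof (cases "z \<in> ball x0 s")
        case True
        have "\<bar>min 0 (discrete_laplacian u (r k) z / (r k)\<^sup>2)\<bar> \<le> C"
          using C[OF True r(1), of k] by (simp add: C_def min_def)
        from mult_left_mono[OF this G_nonneg[of z]] show ?thesis
          by (simp only: real_norm_def abs_mult abs_of_nonneg[OF G_nonneg])
      qed (simp add: G_zero)
    qed
    show "AE z in lborel. (\<lambda>k. ?B k z) \<longlonglongrightarrow> 0"
    proof (rule AE_I2)
      fix z
      show "(\<lambda>k. ?B k z) \<longlonglongrightarrow> 0"
      proof (cases "z \<in> ball x0 s")
        case True
        have "(\<lambda>k. min 0 (discrete_laplacian u (r k) z / (r k)\<^sup>2)) \<longlonglongrightarrow> 0"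
        proof (rule tendstoI)
          fix \<eta> :: real assume \<eta>: "\<eta> > 0"
          then obtain \<delta> where \<delta>: "\<delta> > 0" "\<And>t. 0 < t \<Longrightarrow> t < \<delta> \<Longrightarrow> - (\<eta> / 2) * t\<^sup>2 \<le> discrete_laplacian u t z"
            using sub True unfolding discretely_subharmonic_on_def by (meson half_gt_zero)
          have "\<forall>\<^sub>F k in sequentially. r k < \<delta>"
            using r_lim \<delta>(1) by (auto simp: filterlim_at dest: order_tendstoD(2))
          then show "\<forall>\<^sub>F k in sequentially. dist (min 0 (discrete_laplacian u (r k) z / (r k)\<^sup>2)) 0 < \<eta>"
          proof eventually_elim
            case (elim k)
            have "- (\<eta> / 2) \<le> discrete_laplacian u (r k) z / (r k)\<^sup>2"
              using \<delta>(2)[OF r(1) elim] r(1)[of k] by (simp add: pos_le_divide_eq)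
            then show ?case using \<eta> by (simp add: min_def)
          qed
        qed
        then show ?thesis by (rule tendsto_mult_right_zero)
      qed (simp add: G_zero)
    qed
  qed simp
  \<comment> \<open>Dropping the positive part of the quotient only decreases the integral, as
    \<open>G\<close> is nonnegative; transposing the discrete Laplacian then gives
    \<open>?A\<close>. In the limit this reads 0 on the left and the claimed integral on the
    right.\<close>
  have le: "(\<integral>z. ?B k z \<partial>lborel) \<le> ?A k" for k
  proof -
    have "(\<integral>z. ?B k z \<partial>lborel) \<le> (\<integral>z. G z * (discrete_laplacian u (r k) z / (r k)\<^sup>2) \<partial>lborel)"
    proof (rule integral_mono)
      show "integrable lborel (?B k)"
        using G_zero' B_cont by (intro integrable_compact_support[where a=x0 and r=s]) auto
      show "integrable lborel (\<lambda>z. G z * (discrete_laplacian u (r k) z / (r k)\<^sup>2))"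
        using G_zero' r(1)[of k] by (intro integrable_compact_support[where a=x0 and r=s] continuous_intros G_cont u) auto
      show "?B k z \<le> G z * (discrete_laplacian u (r k) z / (r k)\<^sup>2)" for z
        using G_nonneg[of z] by (intro mult_left_mono) auto
    qed
    also have "\<dots> = (\<integral>z. G z * discrete_laplacian u (r k) z \<partial>lborel) / (r k)\<^sup>2" by simp
    also have "\<dots> = (\<integral>z. u z * discrete_laplacian G (r k) z \<partial>lborel) / (r k)\<^sup>2"
      using discrete_laplacian_symmetric[OF u G_cont G_zero'] by simp
    also have "\<dots> = ?A k" by simp
    finally show ?thesis .
  qed
  show ?thesis
    using LIMSEQ_le[OF lim_B lim_A] le by simp
qed


section \<open>Monotonicity of radially weighted means\<close>

context radial_profile
begin

definition kernel :: "real \<Rightarrow> 'a::euclidean_space \<Rightarrow> real" where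
  "kernel s y = p ((norm y)\<^sup>2 / s\<^sup>2) * inverse s ^ DIM('a)"

lemma kernel_continuous: "continuous_on UNIV (kernel s)"
  unfolding kernel_def divide_inverse
  by (intro continuous_intros continuous_on_compose2[OF p_continuous]) auto

lemma kernel_nonneg: "0 < s \<Longrightarrow> 0 \<le> kernel s y"
  using p_nonneg by (simp add: kernel_def)

lemma kernel_zero: "0 < s \<Longrightarrow> s \<le> norm y \<Longrightarrow> kernel s y = 0"
  using vanish[OF outside[of s y]] by (simp add: kernel_def)

text \<open>The two terms of the product rule match those of the Laplacian of the bump: scaling the
  argument gives the \<open>dp\<close> term, and the normalising power gives the \<open>p\<close>
  term with the dimension as factor.\<close>

lemma kernel_deriv:
  fixes y :: "'a::euclidean_space"
  assumes s: "0 < s"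
  shows "((\<lambda>s. kernel s y) has_real_derivative s * inverse s ^ DIM('a) / 2 * (\<Sum>e\<in>Basis. bump_dd s e y)) (at s)"
proof -
  define N where "N = (norm y)\<^sup>2"
  obtain k where k: "DIM('a) = Suc k" using DIM_positive[where 'a='a] by (metis Suc_pred)
  have "(\<Sum>e\<in>Basis. (2 * (y \<bullet> e) / s\<^sup>2)\<^sup>2) = (\<Sum>e\<in>Basis. (y \<bullet> e)\<^sup>2 * (4 / (s\<^sup>2)\<^sup>2))"
    by (intro sum.cong refl) (simp add: power_divide power_mult_distrib)
  also have "\<dots> = (\<Sum>e\<in>Basis. (y \<bullet> e)\<^sup>2) * (4 / (s\<^sup>2)\<^sup>2)" by (rule sum_distrib_right[symmetric])
  also have "(\<Sum>e\<in>Basis. (y \<bullet> e)\<^sup>2) = N"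
    unfolding N_def power2_norm_eq_inner by (simp only: power2_eq_square euclidean_inner[of y y])
  finally have S0: "(\<Sum>e\<in>Basis. (2 * (y \<bullet> e) / s\<^sup>2)\<^sup>2) = N * (4 / (s\<^sup>2)\<^sup>2)" .
  have S: "(\<Sum>e\<in>Basis. bump_dd s e y) = - dp (N / s\<^sup>2) * (N * (4 / (s\<^sup>2)\<^sup>2)) - real (Suc k) * (p (N / s\<^sup>2) * (2 / s\<^sup>2))"
    unfolding bump_dd_def N_def[symmetric] sum_subtractf sum_distrib_left[symmetric] S0 by (simp add: k)
  have a: "((\<lambda>s. N / s\<^sup>2) has_real_derivative - 2 * N / s ^ 3) (at s)"
    using s by (auto intro!: derivative_eq_intros simp: field_simps power2_eq_square power3_eq_cube)
  have b: "((\<lambda>s. inverse s ^ Suc k) has_real_derivative - (real (Suc k) * inverse s ^ Suc k * inverse s)) (at s)"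
    using s by (intro DERIV_cong[OF DERIV_power_Suc[OF DERIV_inverse]]) auto
  have "((\<lambda>s. p (N / s\<^sup>2) * inverse s ^ Suc k) has_real_derivative
      dp (N / s\<^sup>2) * (- 2 * N / s ^ 3) * inverse s ^ Suc k + - (real (Suc k) * inverse s ^ Suc k * inverse s) * p (N / s\<^sup>2)) (at s)"
    by (rule DERIV_mult[OF DERIV_chain2[OF p_deriv a] b])
  also have "dp (N / s\<^sup>2) * (- 2 * N / s ^ 3) * inverse s ^ Suc k + - (real (Suc k) * inverse s ^ Suc k * inverse s) * p (N / s\<^sup>2)
      = s * inverse s ^ Suc k / 2 * (\<Sum>e\<in>Basis. bump_dd s e y)"
  proof -
    define I where "I = inverse s ^ Suc k"
    show ?thesis unfolding S I_def[symmetric] using s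
      by (simp add: field_simps power2_eq_square power3_eq_cube)
  qed
  finally show ?thesis unfolding kernel_def N_def k .
qed

lemma kernel_mean_mono:
  fixes u :: "'a::euclidean_space \<Rightarrow> real"
  assumes u: "continuous_on UNIV u" and sub: "discretely_subharmonic_on (ball x0 R) u"
    and s: "0 < s" "s \<le> R"
  shows "(\<integral>z. u z * kernel s (z - x0) \<partial>lborel) \<le> (\<integral>z. u z * kernel R (z - x0) \<partial>lborel)"
proof -
  \<comment> \<open>One box containing the largest ball, so that the region of integration does not
    vary with \<open>t\<close> when differentiating under the integral.\<close>
  obtain c :: 'a where c: "cball x0 R \<subseteq> cbox (- c) c"
    using bounded_subset_cbox_symmetric[OF bounded_cball] by blast
  have box: "norm (z - x0) > R" if "z \<notin> cbox (- c) c" for z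
  proof -
    have "z \<notin> cball x0 R" using that c by blast
    then show ?thesis by (simp add: dist_norm norm_minus_commute)
  qed
  have cont_k: "continuous_on UNIV (\<lambda>z. u z * kernel t (z - x0))" for t
    by (intro continuous_intros u continuous_on_compose2[OF kernel_continuous]) auto
  have cont_d: "continuous_on UNIV (\<lambda>z. u z * (\<Sum>e\<in>Basis. bump_dd t e (z - x0)))" for t
    by (intro continuous_intros u continuous_on_compose2[OF bump_dd_continuous]) auto
  define D where "D t z = u z * (t * inverse t ^ DIM('a) / 2 * (\<Sum>e\<in>Basis. bump_dd t e (z - x0)))" for t z
  define F where "F t = integral (cbox (- c) c) (\<lambda>z. u z * kernel t (z - x0))" for t
  have F_eq: "F t = (\<integral>z. u z * kernel t (z - x0) \<partial>lborel)" if "0 < t" "t \<le> R" for t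
    unfolding F_def
  proof (rule lborel_integral_eq_cbox_integral[OF cont_k])
    fix z assume "z \<notin> cbox (- c) c"
    then have "t \<le> norm (z - x0)" using box[of z] that(2) by simp
    then show "u z * kernel t (z - x0) = 0" using kernel_zero[OF that(1), of "z - x0"] by simp
  qed
  have der: "(F has_real_derivative integral (cbox (- c) c) (D t)) (at t)" if t: "0 < t" for t
  proof -
    have "(F has_field_derivative integral (cbox (- c) c) (D t)) (at t within {0<..})"
      unfolding F_def
    proof (rule leibniz_rule_field_derivative)
      show "t \<in> {0<..}" using t by simp
      show "convex {(0::real)<..}" by (rule convex_real_interval)
      show "((\<lambda>t. u z * kernel t (z - x0)) has_field_derivative D x z) (at x within {0<..})" if "x \<in> {0<..}" for x z
        unfolding D_def by (rule has_field_derivative_at_within[OF DERIV_cmult[OF kernel_deriv]]) (use that in simp)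
      show "(\<lambda>z. u z * kernel x (z - x0)) integrable_on cbox (- c) c" for x
        by (rule integrable_continuous[OF continuous_on_subset[OF cont_k subset_UNIV]])
      show "continuous_on ({0<..} \<times> cbox (- c) c) (\<lambda>(x, z). D x z)"
      proof -
        have c: "continuous_on ({0<..} \<times> cbox (- c) c) (\<lambda>x. f ((norm (snd x - x0))\<^sup>2 / (fst x)\<^sup>2))"
          if "continuous_on UNIV f" for f :: "real \<Rightarrow> real"
          by (rule continuous_on_compose2[OF that]) (auto intro!: continuous_intros)
        have cu: "continuous_on ({0<..} \<times> cbox (- c) c) (\<lambda>x. u (snd x))"
          by (rule continuous_on_compose2[OF u]) (auto intro!: continuous_intros)
        show ?thesis
          unfolding D_def bump_dd_def case_prod_unfold
          by (intro continuous_on_mult cu continuous_on_sum continuous_on_diff c[OF p_continuous]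
              c[OF dp_continuous] continuous_on_minus continuous_on_divide continuous_on_power continuous_on_inverse
              continuous_on_inner continuous_on_fst continuous_on_snd continuous_on_id continuous_on_const ballI)
            auto
      qed
    qed
    then show ?thesis using at_within_open[of t "{0<..}"] t by simp
  qed
  have nonneg: "0 \<le> integral (cbox (- c) c) (D t)" if t: "0 < t" "t \<le> R" for t
  proof -
    have "integral (cbox (- c) c) (D t) = (\<integral>z. D t z \<partial>lborel)"
    proof (rule lborel_integral_eq_cbox_integral)
      show "continuous_on UNIV (D t)" unfolding D_def
        by (intro continuous_intros u continuous_on_compose2[OF bump_dd_continuous]) auto
      show "D t z = 0" if "z \<notin> cbox (- c) c" for z
        using box[OF that] bump_dd_zero[OF t(1), of "z - x0"] t(2) by (simp add: D_def)
    qed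
    also have "\<dots> = t * inverse t ^ DIM('a) / 2 * (\<integral>z. u z * (\<Sum>e\<in>Basis. bump_dd t e (z - x0)) \<partial>lborel)"
      unfolding D_def integral_mult_right_zero[symmetric] by (simp only: mult.left_commute)
    also have "0 \<le> \<dots>"
      using t bump_laplacian_integral_nonneg[OF u t(1) discretely_subharmonic_on_subset[OF sub subset_ball[OF t(2)]]]
      by (intro mult_nonneg_nonneg) auto
    finally show ?thesis .
  qed
  have "F s \<le> F R"
  proof (rule DERIV_nonneg_imp_nondecreasing[OF s(2)])
    fix t assume t: "s \<le> t" "t \<le> R"
    then have "0 < t" using s(1) by simp
    from der[OF this] nonneg[OF this t(2)] show "\<exists>y. DERIV F t :> y \<and> 0 \<le> y" by blast
  qed
  then show ?thesis using F_eq s by simp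
qed

text \<open>\<open>u - u x0\<close> vanishes at \<open>x0\<close>, so its weighted integrals over
  small balls are at least \<open>- \<epsilon>\<close> times the constant mass; monotonicity carries
  this bound up to radius \<open>R\<close>.\<close>

lemma kernel_sub_mean:
  fixes u :: "'a::euclidean_space \<Rightarrow> real"
  assumes u: "continuous_on UNIV u" and sub: "discretely_subharmonic_on (ball x0 R) u" and R: "0 < R"
  shows "0 \<le> (\<integral>z. (u z - u x0) * kernel R (z - x0) \<partial>lborel)"
proof -
  define v where "v z = u z - u x0" for z
  have v: "continuous_on UNIV v" unfolding v_def by (intro continuous_intros u)
  have v_sub: "discretely_subharmonic_on (ball x0 R) v"
    unfolding v_def by (rule discretely_subharmonic_on_diff_const[OF sub])
  define I where "I s = (\<integral>z. kernel s (z - x0) \<partial>(lborel :: 'a measure))" for s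
  (* a constant and its negative both satisfy the hypothesis, so the total mass does not depend on s *)
  have I: "I s = I R" if "0 < s" "s \<le> R" for s
    using kernel_mean_mono[OF _ discretely_subharmonic_on_const that, of 1 x0]
      kernel_mean_mono[OF _ discretely_subharmonic_on_const that, of "-1" x0]
    by (simp add: I_def)
  have cont_k: "continuous_on UNIV (\<lambda>z. kernel s (z - x0))" for s
    by (intro continuous_on_compose2[OF kernel_continuous] continuous_intros) auto
  have kz: "kernel s (z - x0) = 0" if "0 < s" "z \<notin> cball x0 s" for s and z :: 'a
    using that kernel_zero[OF that(1), of "z - x0"] by (simp add: dist_norm norm_minus_commute)
  have I0: "0 \<le> I R" unfolding I_def using kernel_nonneg[OF R] by (intro integral_nonneg_AE) auto
  have "- (\<epsilon> * I R) \<le> (\<integral>z. v z * kernel R (z - x0) \<partial>lborel)" if \<epsilon>: "\<epsilon> > 0" for \<epsilon>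
  proof -
    have "isCont v x0" using v by (simp add: continuous_on_eq_continuous_at)
    then obtain d where d: "d > 0" "\<And>z. dist z x0 < d \<Longrightarrow> dist (v z) (v x0) < \<epsilon>"
      using \<epsilon> unfolding continuous_at_eps_delta by (metis (no_types))
    define s where "s = min (d / 2) R"
    have s: "0 < s" "s \<le> R" "s < d" using d R by (auto simp: s_def)
    have "- (\<epsilon> * I R) = (\<integral>z. - \<epsilon> * kernel s (z - x0) \<partial>lborel)"
      using I[OF s(1,2)] by (simp add: I_def)
    also have "\<dots> \<le> (\<integral>z. v z * kernel s (z - x0) \<partial>lborel)"
    proof (rule integral_mono)
      show "integrable lborel (\<lambda>z. - \<epsilon> * kernel s (z - x0))" "integrable lborel (\<lambda>z. v z * kernel s (z - x0))"
        using kz[OF s(1)] by (intro integrable_compact_support[where a=x0 and r=s] continuous_intros cont_k v; simp)+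
      show "- \<epsilon> * kernel s (z - x0) \<le> v z * kernel s (z - x0)" for z
      proof (cases "z \<in> cball x0 s")
        case True
        then have "\<bar>v z\<bar> < \<epsilon>" using d(2)[of z] s by (simp add: v_def dist_real_def dist_commute)
        then show ?thesis using kernel_nonneg[OF s(1)] by (intro mult_right_mono) auto
      qed (simp add: kz[OF s(1)])
    qed
    also have "\<dots> \<le> (\<integral>z. v z * kernel R (z - x0) \<partial>lborel)"
      by (rule kernel_mean_mono[OF v v_sub s(1,2)])
    finally show ?thesis .
  qed
  note * = this
  have "0 \<le> (\<integral>z. v z * kernel R (z - x0) \<partial>lborel)"
  proof (rule field_le_epsilon)
    fix e :: real assume e: "e > 0"
    have "e / (I R + 1) * I R \<le> e" using e I0 by (simp add: pos_divide_le_eq mult_left_mono)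
    then show "0 \<le> (\<integral>z. v z * kernel R (z - x0) \<partial>lborel) + e"
      using *[of "e / (I R + 1)"] e I0 by simp
  qed
  then show ?thesis by (simp add: v_def)
qed

end

text \<open>As \<open>\<theta>\<close> tends to \<open>0\<close>, these weights increase to the indicator function of the open unit ball.\<close>

lemma radial_profile_arctan:
  assumes \<theta>: "\<theta> > 0"
  defines "V \<equiv> \<lambda>t::real. max 0 (1 - t)"
  shows "radial_profile (\<lambda>t. V t - \<theta> * arctan (V t / \<theta>)) (\<lambda>t. (V t)\<^sup>2 / (\<theta>\<^sup>2 + (V t)\<^sup>2))
    (\<lambda>t. - (2 * V t * \<theta>\<^sup>2 / (\<theta>\<^sup>2 + (V t)\<^sup>2)\<^sup>2))"
proof
  have pos: "\<theta>\<^sup>2 + x\<^sup>2 > 0" for x :: real using \<theta> by (simp add: add_pos_nonneg)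
  \<comment> \<open>The weight \<open>x^2 / (\<theta>^2 + x^2)\<close> has an elementary
    antiderivative, and it vanishes at 0 together with its derivative, as the truncation at 1
    requires.\<close>
  have "((\<lambda>x. x - \<theta> * arctan (x / \<theta>)) has_real_derivative x\<^sup>2 / (\<theta>\<^sup>2 + x\<^sup>2)) (at x)" for x
  proof -
    have "((\<lambda>x. x - \<theta> * arctan (x / \<theta>)) has_real_derivative 1 - \<theta> * (inverse (1 + (x / \<theta>)\<^sup>2) * (1 / \<theta>))) (at x)"
      using \<theta> by (auto intro!: derivative_eq_intros)
    also have "1 - \<theta> * (inverse (1 + (x / \<theta>)\<^sup>2) * (1 / \<theta>)) = x\<^sup>2 / (\<theta>\<^sup>2 + x\<^sup>2)"
    proof -
      have "1 + (x / \<theta>)\<^sup>2 = (\<theta>\<^sup>2 + x\<^sup>2) / \<theta>\<^sup>2" using \<theta> by (simp add: power_divide field_simps)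
      then have "\<theta> * (inverse (1 + (x / \<theta>)\<^sup>2) * (1 / \<theta>)) = \<theta>\<^sup>2 / (\<theta>\<^sup>2 + x\<^sup>2)" using \<theta> by simp
      moreover have "1 - a / c = (c - a) / c" if "c > 0" for a c :: real using that by (simp add: diff_divide_distrib)
      from this[OF pos[of x], of "\<theta>\<^sup>2"] have "1 - \<theta>\<^sup>2 / (\<theta>\<^sup>2 + x\<^sup>2) = x\<^sup>2 / (\<theta>\<^sup>2 + x\<^sup>2)" by simp
      ultimately show ?thesis by simp
    qed
    finally show ?thesis .
  qed
  from has_real_derivative_pos_part[OF this]
  show "((\<lambda>t. V t - \<theta> * arctan (V t / \<theta>)) has_real_derivative - ((V t)\<^sup>2 / (\<theta>\<^sup>2 + (V t)\<^sup>2))) (at t)" for t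
    unfolding V_def by simp
  have "((\<lambda>x. x\<^sup>2 / (\<theta>\<^sup>2 + x\<^sup>2)) has_real_derivative 2 * x * \<theta>\<^sup>2 / (\<theta>\<^sup>2 + x\<^sup>2)\<^sup>2) (at x)" for x
    using pos[of x] by (auto intro!: derivative_eq_intros simp: power2_eq_square algebra_simps)
  from has_real_derivative_pos_part[OF this]
  show "((\<lambda>t. (V t)\<^sup>2 / (\<theta>\<^sup>2 + (V t)\<^sup>2)) has_real_derivative - (2 * V t * \<theta>\<^sup>2 / (\<theta>\<^sup>2 + (V t)\<^sup>2)\<^sup>2)) (at t)" for t
    unfolding V_def by simp
  show "continuous_on UNIV (\<lambda>t. - (2 * V t * \<theta>\<^sup>2 / (\<theta>\<^sup>2 + (V t)\<^sup>2)\<^sup>2))"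
    unfolding V_def using pos by (intro continuous_intros ballI) (metis less_irrefl power_not_zero)
  show "0 \<le> V t - \<theta> * arctan (V t / \<theta>)" for t
    using arctan_le_self[of "V t / \<theta>"] \<theta> by (simp add: V_def field_simps)
  show "0 \<le> (V t)\<^sup>2 / (\<theta>\<^sup>2 + (V t)\<^sup>2)" for t by simp
  show "V t - \<theta> * arctan (V t / \<theta>) = 0 \<and> (V t)\<^sup>2 / (\<theta>\<^sup>2 + (V t)\<^sup>2) = 0 \<and> - (2 * V t * \<theta>\<^sup>2 / (\<theta>\<^sup>2 + (V t)\<^sup>2)\<^sup>2) = 0"
    if "1 \<le> t" for t using that by (simp add: V_def)
qed

section \<open>From radial weights to means over balls\<close>

lemma sphere_null_lborel: "sphere c r \<in> null_sets (lborel :: 'a::euclidean_space measure)"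
  using negligible_sphere[of c r] by (auto simp: null_sets_completion_iff negligible_iff_null_sets)

text \<open>The weighted inequality holds for the arctangent profiles with
  \<open>\<theta> = 1 / Suc k\<close>; after removal of the positive factor
  \<open>inverse R ^ DIM('a)\<close> it passes to the limit by dominated convergence.\<close>

lemma sub_mean_value:
  fixes u :: "'a::euclidean_space \<Rightarrow> real"
  assumes u: "continuous_on UNIV u" and sub: "discretely_subharmonic_on (ball x0 R) u" and R: "0 < R"
  shows "u x0 \<le> (LINT y:cball x0 R|lborel. u y) / measure lborel (cball x0 R)"
proof -
  define V where "V z = max 0 (1 - (norm (z - x0))\<^sup>2 / R\<^sup>2)" for z
  define P where "P k z = (V z)\<^sup>2 / ((1 / real (Suc k))\<^sup>2 + (V z)\<^sup>2)" for k z
  have V_cont: "continuous_on UNIV V" unfolding V_def using R by (intro continuous_intros) auto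
  have V_pos: "V z > 0 \<longleftrightarrow> z \<in> ball x0 R" for z
    using R power_mono_iff[of "norm (z - x0)" R 2]
    by (auto simp: V_def dist_norm norm_minus_commute less_max_iff_disj pos_divide_less_eq power_strict_mono
        intro: power_less_imp_less_base[of _ 2])
  have V_zero: "V z = 0" if "z \<notin> ball x0 R" for z
  proof -
    have "0 \<le> V z" by (simp add: V_def)
    then show ?thesis using V_pos[of z] that by linarith
  qed
  have den: "(1 / real (Suc k))\<^sup>2 + (V z)\<^sup>2 > 0" for k z by (intro add_pos_nonneg) auto
  have P_bound: "\<bar>P k z\<bar> \<le> indicator (cball x0 R) z" for k z
    using V_zero[of z] den[of k z] by (cases "z \<in> ball x0 R") (auto simp: P_def divide_le_eq indicator_def)
  have P_nonneg: "0 \<le> (\<integral>z. (u z - u x0) * P k z \<partial>lborel)" for k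
  proof -
    let ?p = "\<lambda>t. (max 0 (1 - t))\<^sup>2 / ((1 / real (Suc k))\<^sup>2 + (max 0 (1 - t))\<^sup>2)"
    interpret prof: radial_profile "\<lambda>t. max 0 (1 - t) - 1 / real (Suc k) * arctan (max 0 (1 - t) / (1 / real (Suc k)))" ?p
      "\<lambda>t. - (2 * max 0 (1 - t) * (1 / real (Suc k))\<^sup>2 / ((1 / real (Suc k))\<^sup>2 + (max 0 (1 - t))\<^sup>2)\<^sup>2)"
      by (rule radial_profile_arctan) simp
    have "prof.kernel R (z - x0) = P k z * inverse R ^ DIM('a)" for z
      unfolding prof.kernel_def P_def V_def by simp
    then have "0 \<le> (\<integral>z. (u z - u x0) * P k z * inverse R ^ DIM('a) \<partial>lborel)"
      using prof.kernel_sub_mean[OF u sub R] by (simp add: mult.assoc)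
    moreover have "\<not> inverse R ^ DIM('a) \<le> 0" using R by (simp add: not_le)
    ultimately show ?thesis by (simp only: integral_mult_left_zero zero_le_mult_iff) blast
  qed
  have "(\<lambda>k. \<integral>z. (u z - u x0) * P k z \<partial>lborel) \<longlonglongrightarrow> (\<integral>z. (u z - u x0) * indicator (ball x0 R) z \<partial>lborel)"
  proof (rule integral_dominated_convergence[where w="\<lambda>z. indicator (cball x0 R) z *\<^sub>R \<bar>u z - u x0\<bar>"])
    have um: "u \<in> borel_measurable borel" by (rule borel_measurable_continuous_onI[OF u])
    show "(\<lambda>z. (u z - u x0) * indicator (ball x0 R) z) \<in> borel_measurable lborel"
      unfolding measurable_lborel1 using um by (intro borel_measurable_times borel_measurable_diff borel_measurable_indicator) auto
    have "V \<in> borel_measurable borel" by (rule borel_measurable_continuous_onI[OF V_cont])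
    then show "(\<lambda>z. (u z - u x0) * P k z) \<in> borel_measurable lborel" for k
      unfolding P_def using um by simp
    show "integrable lborel (\<lambda>z. indicator (cball x0 R) z *\<^sub>R \<bar>u z - u x0\<bar>)"
      by (intro borel_integrable_compact continuous_intros continuous_on_subset[OF u]) auto
    show "AE z in lborel. norm ((u z - u x0) * P k z) \<le> indicator (cball x0 R) z *\<^sub>R \<bar>u z - u x0\<bar>" for k
    proof (rule AE_I2)
      fix z show "norm ((u z - u x0) * P k z) \<le> indicator (cball x0 R) z *\<^sub>R \<bar>u z - u x0\<bar>"
        using mult_left_mono[OF P_bound[of k z], of "\<bar>u z - u x0\<bar>"] by (simp add: abs_mult mult.commute)
    qed
    show "AE z in lborel. (\<lambda>k. (u z - u x0) * P k z) \<longlonglongrightarrow> (u z - u x0) * indicator (ball x0 R) z"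
    proof (intro AE_I2 tendsto_mult_left)
      fix z
      show "(\<lambda>k. P k z) \<longlonglongrightarrow> indicator (ball x0 R) z"
      proof (cases "z \<in> ball x0 R")
        case True
        then have V: "V z \<noteq> 0" using V_pos[of z] by simp
        have "(\<lambda>k. 1 / real (Suc k)) \<longlonglongrightarrow> 0" using LIMSEQ_inverse_real_of_nat by (simp add: divide_inverse)
        then have "(\<lambda>k. P k z) \<longlonglongrightarrow> (V z)\<^sup>2 / (0\<^sup>2 + (V z)\<^sup>2)"
          unfolding P_def using V by (intro tendsto_intros) auto
        then show ?thesis using V True by simp
      qed (simp add: P_def V_zero)
    qed
  qed
  from LIMSEQ_le_const[OF this] P_nonneg
  have "0 \<le> (\<integral>z. (u z - u x0) * indicator (ball x0 R) z \<partial>lborel)" by blast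
  \<comment> \<open>The limit weight is the indicator of the open ball; the bounding sphere is a
    null set.\<close>
  also have "\<dots> = (\<integral>z. indicator (cball x0 R) z *\<^sub>R (u z - u x0) \<partial>lborel)"
  proof (rule integral_cong_AE)
    show "(\<lambda>z. (u z - u x0) * indicator (ball x0 R) z) \<in> borel_measurable lborel"
      "(\<lambda>z. indicator (cball x0 R) z *\<^sub>R (u z - u x0)) \<in> borel_measurable lborel"
      unfolding measurable_lborel1
      by (intro borel_measurable_times borel_measurable_scaleR borel_measurable_diff borel_measurable_indicator
          borel_measurable_continuous_onI[OF u]; simp)+
    show "AE z in lborel. (u z - u x0) * indicator (ball x0 R) z = indicator (cball x0 R) z *\<^sub>R (u z - u x0)"
      using AE_not_in[OF sphere_null_lborel[of x0 R]]
      by eventually_elim (auto simp: indicator_def)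
  qed
  also have "\<dots> = (LINT y:cball x0 R|lborel. u y) - u x0 * measure lborel (cball x0 R)"
  proof -
    have i: "integrable lborel (\<lambda>z. indicator (cball x0 R) z *\<^sub>R u z)"
      "integrable lborel (\<lambda>z. indicator (cball x0 R) z *\<^sub>R u x0)"
      by (intro borel_integrable_compact continuous_intros continuous_on_subset[OF u]; simp)+
    have "(\<integral>z. indicator (cball x0 R) z *\<^sub>R (u z - u x0) \<partial>lborel)
        = (\<integral>z. indicator (cball x0 R) z *\<^sub>R u z - indicator (cball x0 R) z *\<^sub>R u x0 \<partial>lborel)"
      by (simp add: right_diff_distrib)
    also have "\<dots> = (LINT y:cball x0 R|lborel. u y) - (\<integral>z. indicator (cball x0 R) z *\<^sub>R u x0 \<partial>lborel)"
      unfolding set_lebesgue_integral_def by (rule Bochner_Integration.integral_diff[OF i])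
    finally show ?thesis by simp
  qed
  finally show ?thesis using content_cball_pos[OF R, of x0] by (simp add: pos_le_divide_eq)
qed

section \<open>Integrals over balls\<close>

lemma set_integrable_cball:
  fixes f :: "'a::euclidean_space \<Rightarrow> real"
  assumes "continuous_on UNIV f" shows "set_integrable lborel (cball a r) f"
  unfolding set_integrable_def using assms
  by (intro borel_integrable_compact) (auto intro: continuous_on_subset)

lemma cball_integral_sum:
  fixes f :: "'i \<Rightarrow> 'a::euclidean_space \<Rightarrow> real"
  assumes "\<And>i. i \<in> I \<Longrightarrow> continuous_on UNIV (f i)"
  shows "(LINT y:cball a r|lborel. \<Sum>i\<in>I. f i y) = (\<Sum>i\<in>I. LINT y:cball a r|lborel. f i y)"
  using set_integrable_cball[OF assms] unfolding set_lebesgue_integral_def set_integrable_def scaleR_sum_right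
  by (rule Bochner_Integration.integral_sum)

lemma cball_integral_isometry:
  fixes f :: "'a::euclidean_space \<Rightarrow> real"
  assumes T: "distr lborel borel T = lborel" "T \<in> borel_measurable borel" "\<And>y. norm (T y) = norm y"
    and f: "continuous_on UNIV f"
  shows "(LINT y:cball 0 r|lborel. f (T y)) = (LINT y:cball 0 r|lborel. f y)"
proof -
  let ?g = "\<lambda>y. indicator (cball 0 r) y *\<^sub>R f y"
  have g: "?g \<in> borel_measurable borel"
    using borel_measurable_continuous_onI[OF f] by (intro borel_measurable_scaleR borel_measurable_indicator) auto
  have "(\<integral>y. ?g y \<partial>distr lborel borel T) = (\<integral>y. ?g (T y) \<partial>lborel)"
    using T(2) g by (intro integral_distr) auto
  moreover have "indicator (cball 0 r) (T y) = (indicator (cball 0 r) y :: real)" for y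
    using T(3) by (simp add: indicator_def)
  ultimately show ?thesis unfolding T(1) by (simp add: set_lebesgue_integral_def)
qed

lemma lborel_distr_sign_change:
  fixes c :: "'a::euclidean_space \<Rightarrow> real"
  assumes c: "\<And>e. e \<in> Basis \<Longrightarrow> \<bar>c e\<bar> = 1"
  shows "distr lborel borel (\<lambda>y. \<Sum>e\<in>Basis. (c e * (y \<bullet> e)) *\<^sub>R e) = lborel"
proof -
  have "c e \<noteq> 0" if "e \<in> Basis" for e using c[OF that] by auto
  from lborel_affine_euclidean[where t=0 and c=c, OF this] c show ?thesis by (simp add: density_1)
qed

text \<open>Swapping coordinates is an involution that maps boxes to boxes with the same product of
  side lengths, and boxes determine Lebesgue measure.\<close>

lemma lborel_distr_transpose:
  fixes a b :: "'a::euclidean_space"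
  assumes ab: "a \<in> Basis" "b \<in> Basis"
  shows "distr lborel borel (\<lambda>y. \<Sum>e\<in>Basis. (y \<bullet> Transposition.transpose a b e) *\<^sub>R e) = lborel" (is "distr _ _ ?T = _")
proof -
  have bij: "bij_betw (Transposition.transpose a b) Basis Basis"
    using ab bij_betw_transpose_iff by metis
  have mem: "Transposition.transpose a b e \<in> Basis" if "e \<in> Basis" for e
    using bij that by (meson bij_betwE)
  have T_inner: "?T y \<bullet> e = y \<bullet> Transposition.transpose a b e" if "e \<in> Basis" for y e
    using that by simp
  have T_meas: "?T \<in> borel_measurable borel"
    by (intro borel_measurable_continuous_onI continuous_intros)
  have "lborel = distr lborel borel ?T"
  proof (rule lborel_eqI)
    fix l u :: 'a assume le: "\<And>e. e \<in> Basis \<Longrightarrow> l \<bullet> e \<le> u \<bullet> e"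
    have "?T -` box l u = box (?T l) (?T u)"
    proof (intro set_eqI iffI)
      fix y assume y: "y \<in> ?T -` box l u"
      show "y \<in> box (?T l) (?T u)" unfolding mem_box
      proof
        fix e :: 'a assume e: "e \<in> Basis"
        from y have "l \<bullet> Transposition.transpose a b e < ?T y \<bullet> Transposition.transpose a b e \<and> ?T y \<bullet> Transposition.transpose a b e < u \<bullet> Transposition.transpose a b e"
          using mem[OF e] unfolding vimage_eq mem_box by blast
        then show "?T l \<bullet> e < y \<bullet> e \<and> y \<bullet> e < ?T u \<bullet> e"
          unfolding T_inner[OF e] T_inner[OF mem[OF e]] by simp
      qed
    next
      fix y assume y: "y \<in> box (?T l) (?T u)"
      show "y \<in> ?T -` box l u" unfolding vimage_eq mem_box
      proof
        fix e :: 'a assume e: "e \<in> Basis"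
        from y have "?T l \<bullet> Transposition.transpose a b e < y \<bullet> Transposition.transpose a b e \<and> y \<bullet> Transposition.transpose a b e < ?T u \<bullet> Transposition.transpose a b e"
          using mem[OF e] unfolding mem_box by blast
        then show "l \<bullet> e < ?T y \<bullet> e \<and> ?T y \<bullet> e < u \<bullet> e"
          unfolding T_inner[OF e] T_inner[OF mem[OF e]] by simp
      qed
    qed
    then have "emeasure (distr lborel borel ?T) (box l u) = emeasure lborel (box (?T l) (?T u))"
      using T_meas by (subst emeasure_distr) auto
    also have "\<dots> = (\<Prod>e\<in>Basis. (?T u - ?T l) \<bullet> e)"
      using le mem T_inner by (intro emeasure_lborel_box) auto
    also have "(\<Prod>e\<in>Basis. (?T u - ?T l) \<bullet> e) = (\<Prod>e\<in>Basis. (u - l) \<bullet> Transposition.transpose a b e)"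
      by (intro prod.cong refl) (simp add: inner_diff_left)
    also have "\<dots> = (\<Prod>e\<in>Basis. (u - l) \<bullet> e)"
      by (rule prod.reindex_bij_betw[OF bij])
    finally show "emeasure (distr lborel borel ?T) (box l u) = (\<Prod>e\<in>Basis. (u - l) \<bullet> e)" .
  qed simp
  then show ?thesis by simp
qed

lemma cball_integral_odd:
  fixes f :: "'a::euclidean_space \<Rightarrow> real"
  assumes f: "continuous_on UNIV f" and odd: "\<And>y. f (- y) = - f y"
  shows "(LINT y:cball 0 r|lborel. f y) = 0"
proof -
  have "(\<lambda>y::'a. \<Sum>e\<in>Basis. (- 1 * (y \<bullet> e)) *\<^sub>R e) = uminus"
    by (auto simp: fun_eq_iff sum_negf euclidean_representation)
  then have "distr lborel borel uminus = (lborel :: 'a measure)"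
    using lborel_distr_sign_change[of "\<lambda>e::'a. - 1"] by simp
  from cball_integral_isometry[OF this _ _ f, of r]
  have "(LINT y:cball 0 r|lborel. - f y) = (LINT y:cball 0 r|lborel. f y)" by (simp add: odd)
  then show ?thesis by (simp add: set_lebesgue_integral_def)
qed

text \<open>The second moment matrix of a centred ball is a multiple of the identity: reflecting one
  coordinate kills the off-diagonal entries, swapping two equates the diagonal ones. The statement
  for arbitrary \<open>v\<close> serves frames that are not aligned with
  \<open>Basis\<close>.\<close>

lemma cball_integral_square:
  fixes r :: real
  obtains c where "0 < r \<Longrightarrow> 0 < c" "\<And>v::'a::euclidean_space. (LINT y:cball 0 r|lborel. (y \<bullet> v)\<^sup>2) = c * (norm v)\<^sup>2"
proof -
  define J where "J a b = (LINT y:cball 0 r|lborel. (y \<bullet> a) * (y \<bullet> b))" for a b :: 'a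
  have cont: "continuous_on UNIV (\<lambda>y::'a. (y \<bullet> a) * (y \<bullet> b))" for a b by (intro continuous_intros)
  have off: "J a b = 0" if ab: "a \<in> Basis" "b \<in> Basis" "a \<noteq> b" for a b
  proof -
    let ?c = "\<lambda>e::'a. if e = a then - 1 else 1 :: real"
    let ?T = "\<lambda>y. \<Sum>e\<in>Basis. (?c e * (y \<bullet> e)) *\<^sub>R e"
    have T: "?T y \<bullet> e = ?c e * (y \<bullet> e)" if "e \<in> Basis" for y e using that by simp
    have n: "norm (?T y) = norm y" for y
      unfolding norm_eq_sqrt_inner euclidean_inner[of "?T y" "?T y"] euclidean_inner[of y y]
      by (intro arg_cong[of _ _ sqrt] sum.cong refl) (simp only: T; simp)
    have "?T \<in> borel_measurable borel" by (intro borel_measurable_continuous_onI continuous_intros)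
    moreover have "distr lborel borel ?T = lborel" by (rule lborel_distr_sign_change) auto
    ultimately have "(LINT y:cball 0 r|lborel. (?T y \<bullet> a) * (?T y \<bullet> b)) = J a b"
      unfolding J_def using n by (intro cball_integral_isometry[OF _ _ _ cont])
    then have "(LINT y:cball 0 r|lborel. - ((y \<bullet> a) * (y \<bullet> b))) = J a b"
      unfolding T[OF ab(1)] T[OF ab(2)] using ab(3) by simp
    then show ?thesis by (simp add: J_def set_lebesgue_integral_def)
  qed
  have diag: "J a a = J b b" if ab: "a \<in> Basis" "b \<in> Basis" for a b
  proof -
    let ?T = "\<lambda>y::'a. \<Sum>e\<in>Basis. (y \<bullet> Transposition.transpose a b e) *\<^sub>R e"
    have T: "?T y \<bullet> e = y \<bullet> Transposition.transpose a b e" if "e \<in> Basis" for y e using that by simp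
    have bij: "bij_betw (Transposition.transpose a b) Basis Basis"
      using ab bij_betw_transpose_iff by metis
    have n: "norm (?T y) = norm y" for y
    proof -
      have "(\<Sum>e\<in>Basis. (?T y \<bullet> e)\<^sup>2) = (\<Sum>e\<in>Basis. (y \<bullet> Transposition.transpose a b e)\<^sup>2)"
        by (intro sum.cong refl) (simp only: T)
      also have "\<dots> = (\<Sum>e\<in>Basis. (y \<bullet> e)\<^sup>2)" by (rule sum.reindex_bij_betw[OF bij])
      finally show ?thesis
        by (simp only: norm_eq_sqrt_inner euclidean_inner[of "?T y" "?T y"] euclidean_inner[of y y] power2_eq_square)
    qed
    have "?T \<in> borel_measurable borel" by (intro borel_measurable_continuous_onI continuous_intros)
    then have "(LINT y:cball 0 r|lborel. (?T y \<bullet> a) * (?T y \<bullet> a)) = J a a"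
      unfolding J_def using n lborel_distr_transpose[OF ab] by (intro cball_integral_isometry[OF _ _ _ cont])
    then show ?thesis unfolding T[OF ab(1)] by (simp add: J_def)
  qed
  obtain e0 :: 'a where e0: "e0 \<in> Basis" using nonempty_Basis by blast
  have sq: "(LINT y:cball 0 r|lborel. (y \<bullet> v)\<^sup>2) = J e0 e0 * (norm v)\<^sup>2" for v :: 'a
  proof -
    have "(y \<bullet> v)\<^sup>2 = (\<Sum>a\<in>Basis. \<Sum>b\<in>Basis. (v \<bullet> a) * (v \<bullet> b) * ((y \<bullet> a) * (y \<bullet> b)))" for y
      unfolding power2_eq_square by (subst (1 2) euclidean_inner) (simp add: sum_product mult_ac)
    then have "(LINT y:cball 0 r|lborel. (y \<bullet> v)\<^sup>2)
        = (LINT y:cball 0 r|lborel. \<Sum>a\<in>Basis. \<Sum>b\<in>Basis. (v \<bullet> a) * (v \<bullet> b) * ((y \<bullet> a) * (y \<bullet> b)))" by simp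
    also have "\<dots> = (\<Sum>a\<in>Basis. \<Sum>b\<in>Basis. (LINT y:cball 0 r|lborel. (v \<bullet> a) * (v \<bullet> b) * ((y \<bullet> a) * (y \<bullet> b))))"
      by (subst cball_integral_sum, (intro continuous_intros)[1], intro sum.cong refl cball_integral_sum continuous_intros)
    also have "\<dots> = (\<Sum>a\<in>Basis. \<Sum>b\<in>Basis. (v \<bullet> a) * (v \<bullet> b) * J a b)"
      by (simp add: J_def mult.assoc)
    also have "\<dots> = (\<Sum>a\<in>Basis. \<Sum>b\<in>Basis. if b = a then (v \<bullet> a) * (v \<bullet> a) * J e0 e0 else 0)"
      using off diag[OF e0] by (intro sum.cong refl) auto
    also have "\<dots> = J e0 e0 * (norm v)\<^sup>2"
      unfolding power2_norm_eq_inner euclidean_inner[of v v] by (simp add: sum_distrib_left mult_ac)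
    finally show ?thesis .
  qed
  have "0 < J e0 e0" if r: "0 < r"
  proof -
    \<comment> \<open>A ball inside \<open>cball 0 r\<close> on which \<open>y \<bullet> e0\<close>
      is at least \<open>r / 4\<close>, which bounds the moment away from 0.\<close>
    let ?B = "cball ((r / 2) *\<^sub>R e0) (r / 4)"
    have "0 < (r / 4)\<^sup>2 * measure lborel ?B" using r content_cball_pos[of "r / 4"] by simp
    also have "\<dots> = (\<integral>y. indicator ?B y *\<^sub>R (r / 4)\<^sup>2 \<partial>lborel)" by simp
    also have "\<dots> \<le> (\<integral>y. indicator (cball 0 r) y *\<^sub>R ((y \<bullet> e0) * (y \<bullet> e0)) \<partial>lborel)"
    proof (rule integral_mono)
      show "integrable lborel (\<lambda>y. indicator ?B y *\<^sub>R (r / 4)\<^sup>2)"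
        "integrable lborel (\<lambda>y. indicator (cball 0 r) y *\<^sub>R ((y \<bullet> e0) * (y \<bullet> e0)))"
        by (intro borel_integrable_compact continuous_intros; simp)+
      fix y :: 'a
      show "indicator ?B y *\<^sub>R (r / 4)\<^sup>2 \<le> indicator (cball 0 r) y *\<^sub>R ((y \<bullet> e0) * (y \<bullet> e0))"
      proof (cases "y \<in> ?B")
        case True
        then have n: "norm (y - (r / 2) *\<^sub>R e0) \<le> r / 4" by (simp add: dist_norm norm_minus_commute)
        have "norm y \<le> norm (y - (r / 2) *\<^sub>R e0) + norm ((r / 2) *\<^sub>R e0)" by (metis diff_add_cancel norm_triangle_ineq)
        then have 1: "y \<in> cball 0 r" using n r e0 by simp
        have "\<bar>(y - (r / 2) *\<^sub>R e0) \<bullet> e0\<bar> \<le> r / 4" using n Basis_le_norm[OF e0, of "y - (r / 2) *\<^sub>R e0"] by simp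
        moreover have "(y - (r / 2) *\<^sub>R e0) \<bullet> e0 = y \<bullet> e0 - r / 2" using e0 by (simp add: inner_diff_left)
        ultimately have "r / 4 \<le> y \<bullet> e0" unfolding abs_le_iff by linarith
        then have "(r / 4) * (r / 4) \<le> (y \<bullet> e0) * (y \<bullet> e0)" using r by (intro mult_mono) auto
        then show ?thesis using True 1 by (simp add: power2_eq_square)
      qed (simp add: indicator_def)
    qed
    finally show ?thesis by (simp add: J_def set_lebesgue_integral_def)
  qed
  then show thesis using sq by (rule that)
qed

lemma cball_integral_translation:
  fixes f :: "'a::euclidean_space \<Rightarrow> real"
  assumes f: "continuous_on UNIV f"
  shows "(LINT y:cball x r|lborel. f y) = (LINT y:cball 0 r|lborel. f (x + y))"
proof -
  let ?g = "\<lambda>y. indicator (cball x r) y *\<^sub>R f y"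
  have g: "?g \<in> borel_measurable borel"
    using borel_measurable_continuous_onI[OF f] by (intro borel_measurable_scaleR borel_measurable_indicator) auto
  have "(\<integral>y. ?g y \<partial>distr lborel borel ((+) x)) = (\<integral>y. ?g (x + y) \<partial>lborel)"
    using g by (intro integral_distr) auto
  moreover have "indicator (cball x r) (x + y) = (indicator (cball 0 r) y :: real)" for y
    by (simp add: indicator_def dist_norm)
  ultimately show ?thesis by (simp add: lborel_distr_plus set_lebesgue_integral_def)
qed

section \<open>The distance to the boundary from above\<close>

text \<open>The segment from \<open>x\<close> to \<open>q\<close> leaves \<open>S\<close> and so
  crosses the frontier no farther away than \<open>q\<close>.\<close>

lemma infdist_frontier_le:
  fixes S :: "'a::euclidean_space set"
  assumes "x \<in> S" "q \<notin> S"
  shows "infdist x (frontier S) \<le> dist x q"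
proof -
  have "closed_segment x q \<inter> frontier S \<noteq> {}"
    using assms by (intro connected_Int_frontier) auto
  then obtain z where z: "z \<in> closed_segment x q" "z \<in> frontier S" by blast
  have "infdist x (frontier S) \<le> dist x z" using z(2) by (rule infdist_le)
  also have "\<dots> \<le> dist x q" using dist_in_closed_segment[OF z(1)] by (simp add: dist_commute)
  finally show ?thesis .
qed

lemma ball_infdist_subset:
  fixes S :: "'a::euclidean_space set"
  assumes "x \<in> S" shows "ball x (infdist x (frontier S)) \<subseteq> S"
proof
  fix y assume "y \<in> ball x (infdist x (frontier S))"
  then show "y \<in> S" using infdist_frontier_le[OF assms, of y] by (cases "y \<in> S") simp_all
qed

lemma osculating_closure:
  assumes "osculating \<Omega> w n B l" "\<eta> > 0"
  obtains d where "d > 0"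
    "\<And>y. norm y < d \<Longrightarrow> w + y \<in> closure \<Omega> \<Longrightarrow> frame_quadratic l B y / 2 - \<eta> * (\<bar>n \<bullet> y\<bar> + (norm y)\<^sup>2) \<le> n \<bullet> y"
  using assms unfolding osculating_def by metis

lemma osculating_outside:
  assumes "osculating \<Omega> w n B l" "\<eta> > 0"
  obtains d where "d > 0"
    "\<And>y. norm y < d \<Longrightarrow> w + y \<notin> \<Omega> \<Longrightarrow> n \<bullet> y \<le> frame_quadratic l B y / 2 + \<eta> * (\<bar>n \<bullet> y\<bar> + (norm y)\<^sup>2)"
  using assms unfolding osculating_def by metis

lemma frame_quadratic_scale: "frame_quadratic l B (t *\<^sub>R y) = t\<^sup>2 * frame_quadratic l B y"
  by (simp add: frame_quadratic_def power_mult_distrib sum_distrib_left mult_ac)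

lemma frame_quadratic_bound:
  assumes "finite B"
  shows "\<bar>frame_quadratic l B y\<bar> \<le> (\<Sum>b\<in>B. \<bar>l b\<bar>) * (\<Sum>b\<in>B. (y \<bullet> b)\<^sup>2)"
proof -
  have "\<bar>frame_quadratic l B y\<bar> \<le> (\<Sum>b\<in>B. \<bar>l b * (y \<bullet> b)\<^sup>2\<bar>)" unfolding frame_quadratic_def by (rule sum_abs)
  also have "\<dots> \<le> (\<Sum>b\<in>B. \<bar>l b\<bar> * (\<Sum>b\<in>B. (y \<bullet> b)\<^sup>2))"
    using assms by (intro sum_mono) (auto simp: abs_mult intro!: mult_left_mono member_le_sum)
  finally show ?thesis by (simp add: sum_distrib_right)
qed

text \<open>A ball inside the domain touching the boundary at \<open>w\<close> is tangent to it
  there. This is first-order information, extracted from \<open>osculating\<close> along a short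
  segment on which the quadratic terms are negligible.\<close>

lemma nearest_point_normal:
  assumes n: "norm n = 1" and osc: "osculating \<Omega> w n B l" and D: "0 < D" "dist x w = D"
    and ball: "ball x D \<subseteq> \<Omega>"
  shows "x = w + D *\<^sub>R n"
proof (rule ccontr)
  assume neq: "x \<noteq> w + D *\<^sub>R n"
  define v where "v = (x - w) /\<^sub>R D"
  have xv: "x = w + D *\<^sub>R v" using D by (simp add: v_def)
  have "norm (x - w) = D" using D(2) by (simp add: dist_norm)
  then have v1: "norm v = 1" using D(1) by (simp add: v_def)
  (* the direction v - n points into the ball around x but out of the domain at w *)
  define c where "c = 1 - n \<bullet> v"
  have "(norm (v - n))\<^sup>2 = 2 * c"
    using n v1 unfolding power2_norm_eq_inner by (simp add: inner_simps norm_eq_1 c_def inner_commute)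
  moreover have "v \<noteq> n" using neq xv by blast
  then have "(norm (v - n))\<^sup>2 > 0" by simp
  ultimately have c: "c > 0" by linarith
  let ?z = "v - n"
  have zv: "?z \<bullet> v = c" "n \<bullet> ?z = - c"
    using n v1 by (simp_all add: inner_simps norm_eq_1 c_def)
  \<comment> \<open>With tolerance 1/2 the error term absorbs only half of the linear decrease
    \<open>t * c\<close> of \<open>n \<bullet> y\<close>.\<close>
  obtain d where d: "d > 0"
    "\<And>y. norm y < d \<Longrightarrow> w + y \<in> closure \<Omega> \<Longrightarrow> frame_quadratic l B y / 2 - 1/2 * (\<bar>n \<bullet> y\<bar> + (norm y)\<^sup>2) \<le> n \<bullet> y"
    by (rule osculating_closure[OF osc half_gt_zero[OF zero_less_one]]) (rule that)
  define q where "q = \<bar>frame_quadratic l B ?z\<bar> + (norm ?z)\<^sup>2 + 1"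
  have q: "q > 0" "(norm ?z)\<^sup>2 < q" by (auto simp: q_def add_nonneg_pos)
  \<comment> \<open>The three bounds keep \<open>t z\<close> in the range of the contact estimate,
    put \<open>w + t z\<close> inside the ball around \<open>x\<close>, and make the quadratic terms
    at most \<open>c * t / 2\<close>, which is the contradiction.\<close>
  define t where "t = min (d / (2 * (norm ?z + 1))) (min (D * c / q) (c / (2 * q)))"
  have t: "t > 0" using d D c q by (simp add: t_def add_nonneg_pos)
  have "t * norm ?z < d"
  proof -
    have "t \<le> d / (2 * (norm ?z + 1))" by (simp add: t_def)
    then have "t * (2 * (norm ?z + 1)) \<le> d" by (simp add: pos_le_divide_eq add_nonneg_pos)
    moreover have "t * (2 * (norm ?z + 1)) = 2 * (t * norm ?z) + 2 * t" by (simp add: distrib_left)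
    moreover have "t * norm ?z \<ge> 0" using t by simp
    ultimately show ?thesis using t by linarith
  qed
  then have nt: "norm (t *\<^sub>R ?z) < d" using t by simp
  have "t \<le> D * c / q" "t \<le> (c / 2) / q" by (simp_all add: t_def)
  then have tq: "t * q \<le> D * c" "t * q \<le> c / 2" using q(1) by (simp_all only: pos_le_divide_eq)
  have "v \<bullet> v = 1" using v1 by (simp add: norm_eq_1)
  then have "(norm (t *\<^sub>R ?z - D *\<^sub>R v))\<^sup>2 = t\<^sup>2 * (norm ?z)\<^sup>2 - 2 * (t * (D * (?z \<bullet> v))) + D\<^sup>2"
    unfolding power2_norm_eq_inner
    by (simp add: inner_diff_left[of "t *\<^sub>R ?z"] inner_diff_right[of _ "t *\<^sub>R ?z"] power2_eq_square inner_commute[of v ?z] right_diff_distrib mult.left_commute del: inner_diff_left inner_diff_right)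
  moreover have "t\<^sup>2 * (norm ?z)\<^sup>2 < t * (t * q)" using t q(2) by (simp add: power2_eq_square mult.assoc)
  moreover have "t * (t * q) \<le> t * (D * c)" using t tq by (intro mult_left_mono) auto
  moreover have "0 < t * (D * c)" using t D c by simp
  ultimately have "(norm (t *\<^sub>R ?z - D *\<^sub>R v))\<^sup>2 < D\<^sup>2" unfolding zv(1) by linarith
  then have "norm (t *\<^sub>R ?z - D *\<^sub>R v) < D" using D by (simp add: power_less_imp_less_base[of _ 2])
  then have "w + t *\<^sub>R ?z \<in> ball x D" by (simp add: xv dist_norm norm_minus_commute)
  then have "w + t *\<^sub>R ?z \<in> closure \<Omega>" using ball closure_subset by blast
  from d(2)[OF nt this]
  have le: "t\<^sup>2 * frame_quadratic l B ?z / 2 - 1/2 * (t * c + t\<^sup>2 * (norm ?z)\<^sup>2) \<le> - (t * c)"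
    using t c zv(2) unfolding frame_quadratic_scale by (simp add: power_mult_distrib abs_mult)
  have half: "m \<le> b - a" if "a / 2 - 1/2 * (m + b) \<le> - m" for a b m :: real using that by (simp add: field_simps)
  from half[OF le] have "t * c \<le> t * (t * ((norm ?z)\<^sup>2 - frame_quadratic l B ?z))"
    by (simp add: power2_eq_square right_diff_distrib)
  then have "c \<le> t * ((norm ?z)\<^sup>2 - frame_quadratic l B ?z)" using t by simp
  also have "\<dots> \<le> t * q" using t by (intro mult_left_mono) (auto simp: q_def)
  also have "\<dots> \<le> c / 2" by (rule tq)
  finally show False using c by simp
qed

text \<open>Moving from \<open>w + D n + y\<close> in the direction of the normal \<open>n\<close> at \<open>w\<close> (not to the nearest boundary point) one
  leaves the domain after at most the stated length. This bound is quadratic in the tangential part of \<open>y\<close>, with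
  trace close to \<open>sum l B\<close>, even where the distance function is not differentiable.\<close>

lemma vertical_distance_bound:
  assumes frame: "normal_frame n B" and osc: "osculating \<Omega> w n B l" and w: "w \<notin> \<Omega>"
    and D: "0 < D" "ball (w + D *\<^sub>R n) D \<subseteq> \<Omega>" and \<epsilon>: "0 < \<epsilon>"
  obtains d where "0 < d" "\<And>y. norm y < d \<Longrightarrow>
     infdist (w + D *\<^sub>R n + y) (frontier \<Omega>) \<le> D + n \<bullet> y - frame_quadratic (\<lambda>b. l b - \<epsilon>) B y / 2"
proof -
  have fB: "finite B" and n1: "norm n = 1" "n \<bullet> n = 1" and nB: "\<And>b. b \<in> B \<Longrightarrow> n \<bullet> b = 0"
    using frame by (auto simp: normal_frame_def norm_eq_1)
  define K where "K = (\<Sum>b\<in>B. \<bar>l b - \<epsilon>\<bar>)"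
  have K: "K \<ge> 0" by (simp add: K_def sum_nonneg)
  define S where "S = K + 1 + K\<^sup>2"
  \<comment> \<open>\<open>S\<close> is such that \<open>\<bar>h\<bar> + h^2 + p \<le> S * p\<close>
    below, so the contact error at \<open>z\<close> is at most
    \<open>\<epsilon> * p / 4\<close>.\<close>
  define \<eta> where "\<eta> = \<epsilon> / (4 * S)"
  have den: "S > 0" using K by (simp add: S_def add_pos_nonneg add_nonneg_pos)
  have \<eta>: "\<eta> > 0" "\<eta> * S = \<epsilon> / 4" using \<epsilon> den by (simp_all add: \<eta>_def)
  obtain d0 where d0: "d0 > 0"
    "\<And>y. norm y < d0 \<Longrightarrow> w + y \<in> closure \<Omega> \<Longrightarrow> frame_quadratic l B y / 2 - \<eta> * (\<bar>n \<bullet> y\<bar> + (norm y)\<^sup>2) \<le> n \<bullet> y"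
    by (rule osculating_closure[OF osc \<eta>(1)]) (rule that)
  define d where "d = min (min 1 D) (min (d0 / (1 + K)) (D / (1 + K)))"
  show thesis
  proof (rule that)
    show "0 < d" using d0 D K by (simp add: d_def)
    fix y :: 'a assume y: "norm y < d"
    define s where "s = n \<bullet> y"
    define P where "P = (\<Sum>b\<in>B. (y \<bullet> b) *\<^sub>R b)"
    define p where "p = (\<Sum>b\<in>B. (y \<bullet> b)\<^sup>2)"
    define h where "h = frame_quadratic (\<lambda>b. l b - \<epsilon>) B y / 2"
    have yP: "y = P + s *\<^sub>R n" using normal_frame_expand[OF frame, of y] by (simp add: P_def s_def)
    have p0: "p \<ge> 0" by (simp add: p_def sum_nonneg)
    have py: "(norm y)\<^sup>2 = s\<^sup>2 + p" unfolding s_def p_def by (rule normal_frame_norm[OF frame])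
    have "p \<le> (norm y)\<^sup>2" using py by simp
    have y1: "norm y < 1" "norm y < D" "norm y * (1 + K) < d0" "norm y * (1 + K) < D"
      using y K by (simp_all add: d_def pos_less_divide_eq)
    have "(norm y)\<^sup>2 \<le> norm y" using y1(1) by (simp add: power2_eq_square mult_left_le)
    then have p_le: "p \<le> norm y" "p \<le> 1" using \<open>p \<le> (norm y)\<^sup>2\<close> y1(1) by linarith+
    have "\<bar>frame_quadratic (\<lambda>b. l b - \<epsilon>) B y\<bar> \<le> K * p"
      unfolding K_def p_def by (rule frame_quadratic_bound[OF fB])
    then have h: "\<bar>h\<bar> \<le> K * p" using K p0 mult_nonneg_nonneg[OF K p0] by (simp add: h_def)
    also have "\<dots> \<le> K * norm y" using p_le K by (intro mult_left_mono) auto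
    finally have hy: "\<bar>h\<bar> \<le> K * norm y" .
    \<comment> \<open>The point over the tangential part of \<open>y\<close> on the graph with all
      curvatures lowered by \<open>\<epsilon>\<close>. It lies in direction \<open>- n\<close> from
      the shifted point and, as shown next, outside the domain.\<close>
    define z where "z = P + h *\<^sub>R n"
    have zb: "z \<bullet> b = y \<bullet> b" if "b \<in> B" for b
      using nB[OF that] by (simp add: z_def yP inner_add_left)
    have zn: "n \<bullet> z = h"
    proof -
      have "n \<bullet> P = 0" unfolding P_def using nB by (simp add: inner_sum_right)
      then show ?thesis using n1 by (simp add: z_def inner_add_right)
    qed
    have zz: "(norm z)\<^sup>2 = h\<^sup>2 + p"
      using normal_frame_norm[OF frame, of z] zn zb by (simp add: p_def)
    have "w + z \<notin> \<Omega>"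
    proof
      assume "w + z \<in> \<Omega>"
      have "(norm z)\<^sup>2 \<le> (norm y * (1 + K))\<^sup>2"
      proof -
        have "h\<^sup>2 \<le> (K * norm y)\<^sup>2" using power_mono[OF hy abs_ge_zero, of 2] by simp
        then have "(norm z)\<^sup>2 \<le> (norm y)\<^sup>2 * (K\<^sup>2 + 1)"
          using zz \<open>p \<le> (norm y)\<^sup>2\<close> by (simp add: power_mult_distrib algebra_simps)
        also have "\<dots> \<le> (norm y)\<^sup>2 * (1 + K)\<^sup>2" using K by (intro mult_left_mono) (auto simp: power2_sum)
        finally show ?thesis by (simp add: power_mult_distrib)
      qed
      then have "norm z \<le> norm y * (1 + K)" by (rule power2_le_imp_le) (use K in simp)
      then have "norm z < d0" using y1 by simp
      moreover have "w + z \<in> closure \<Omega>" using \<open>w + z \<in> \<Omega>\<close> closure_subset by blast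
      ultimately have "frame_quadratic l B z / 2 - \<eta> * (\<bar>h\<bar> + (h\<^sup>2 + p)) \<le> h"
        using d0(2)[of z] zn zz by simp
      moreover have "frame_quadratic l B z = 2 * h + \<epsilon> * p"
      proof -
        have "frame_quadratic (\<lambda>b. l b - \<epsilon>) B y = frame_quadratic l B y - \<epsilon> * p"
          by (simp add: frame_quadratic_def p_def left_diff_distrib sum_subtractf sum_distrib_left)
        moreover have "frame_quadratic l B z = frame_quadratic l B y"
          unfolding frame_quadratic_def using zb by simp
        ultimately show ?thesis by (simp add: h_def field_simps)
      qed
      \<comment> \<open>Lowering the curvatures puts \<open>z\<close> below the true quadratic graph
        by \<open>\<epsilon> * p / 2\<close>, more than the admissible error unless
        \<open>p = 0\<close>; in that case \<open>z = 0\<close> and \<open>w\<close> itself is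
        outside.\<close>
      ultimately have "\<epsilon> * p / 2 \<le> \<eta> * (\<bar>h\<bar> + (h\<^sup>2 + p))" by (simp add: add_divide_distrib)
      moreover have "\<bar>h\<bar> + (h\<^sup>2 + p) \<le> S * p"
      proof -
        have "h\<^sup>2 \<le> (K * p)\<^sup>2" using power_mono[OF h abs_ge_zero, of 2] by simp
        also have "\<dots> \<le> K\<^sup>2 * p" using p_le p0
          by (simp add: power_mult_distrib power2_eq_square[of p] mult_left_mono mult_left_le)
        finally show ?thesis using h by (simp add: S_def algebra_simps)
      qed
      then have "\<eta> * (\<bar>h\<bar> + (h\<^sup>2 + p)) \<le> \<epsilon> / 4 * p"
        using mult_left_mono[of _ "S * p" \<eta>] \<eta> by (metis less_imp_le mult.assoc)
      ultimately have "\<epsilon> * p / 2 \<le> \<epsilon> / 4 * p" by linarith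
      then have "\<epsilon> * p \<le> 0" by simp
      then have "p = 0" using \<epsilon> p0 by (simp add: mult_le_0_iff)
      then have "z = 0" using h zz by simp
      then show False using \<open>w + z \<in> \<Omega>\<close> w by simp
    qed
    moreover have "w + D *\<^sub>R n + y \<in> \<Omega>" using D(2) y1(2) by (auto simp: subset_iff dist_norm)
    ultimately have "infdist (w + D *\<^sub>R n + y) (frontier \<Omega>) \<le> dist (w + D *\<^sub>R n + y) (w + z)"
      by (intro infdist_frontier_le)
    also have "\<dots> = norm ((D + s - h) *\<^sub>R n)" by (simp add: dist_norm yP z_def algebra_simps)
    also have "\<dots> = D + s - h"
    proof -
      have "\<bar>s\<bar> \<le> norm y" unfolding s_def using Cauchy_Schwarz_ineq2[of n y] n1 by simp
      then have "0 \<le> D + s - h" using hy y1(4) by (simp add: algebra_simps)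
      then show ?thesis using n1 by simp
    qed
    finally show "infdist (w + D *\<^sub>R n + y) (frontier \<Omega>) \<le> D + n \<bullet> y - frame_quadratic (\<lambda>b. l b - \<epsilon>) B y / 2"
      by (simp add: s_def h_def)
  qed
qed

section \<open>Lower bounds for second differences of minus the distance\<close>

lemma sum_Basis_inner_square: "(\<Sum>e\<in>Basis. (e \<bullet> b)\<^sup>2) = (norm b)\<^sup>2"
  unfolding power2_norm_eq_inner euclidean_inner[of b b] by (simp add: power2_eq_square inner_commute)

text \<open>The upper bound for the distance is an equality at the centre. Adding it at opposite
  points cancels the linear part, and the quadratic part sums to the trace \<open>sum l B\<close> up
  to \<open>\<epsilon> * card B\<close>, which is at most \<open>\<eta>\<close>.\<close>

lemma discrete_laplacian_infdist_asymptotic: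
  assumes frame: "normal_frame n B" and osc: "osculating \<Omega> w n B l" and w: "w \<notin> \<Omega>"
    and D: "0 < D" "ball (w + D *\<^sub>R n) D \<subseteq> \<Omega>" "infdist (w + D *\<^sub>R n) (frontier \<Omega>) = D"
    and l: "0 \<le> sum l B" and \<eta>: "0 < \<eta>"
  shows "\<exists>\<delta>>0. \<forall>r. 0 < r \<and> r < \<delta> \<longrightarrow>
    - \<eta> * r\<^sup>2 \<le> discrete_laplacian (\<lambda>x. - infdist x (frontier \<Omega>)) r (w + D *\<^sub>R n)"
proof -
  define \<epsilon> where "\<epsilon> = \<eta> / (real (card B) + 1)"
  have \<epsilon>: "0 < \<epsilon>" using \<eta> by (simp add: \<epsilon>_def add_nonneg_pos)
  have \<epsilon>2: "\<epsilon> * real (card B) \<le> \<eta>" using \<eta> by (simp add: \<epsilon>_def pos_divide_le_eq mult_left_mono add_nonneg_pos)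
  obtain d where d: "0 < d" "\<And>y. norm y < d \<Longrightarrow>
     infdist (w + D *\<^sub>R n + y) (frontier \<Omega>) \<le> D + n \<bullet> y - frame_quadratic (\<lambda>b. l b - \<epsilon>) B y / 2"
    using vertical_distance_bound[OF frame osc w D(1,2) \<epsilon>] by blast
  have nb: "norm b = 1" if "b \<in> B" for b using frame that by (simp add: normal_frame_def)
  show ?thesis
  proof (intro exI[of _ d] conjI d(1) allI impI)
    fix r :: real assume r: "0 < r \<and> r < d"
    let ?q = "frame_quadratic (\<lambda>b. l b - \<epsilon>) B"
    \<comment> \<open>The trace is evaluated in \<open>Basis\<close> instead of \<open>B\<close>:
      each unit vector \<open>b\<close> contributes exactly its weight.\<close>
    have "(\<Sum>e\<in>Basis. ?q e) = (\<Sum>b\<in>B. (l b - \<epsilon>) * (\<Sum>e\<in>Basis. (e \<bullet> b)\<^sup>2))"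
      unfolding frame_quadratic_def sum_distrib_left by (rule sum.swap)
    also have "\<dots> = sum l B - \<epsilon> * real (card B)"
      using nb by (simp add: sum_Basis_inner_square sum_subtractf)
    finally have "- \<eta> \<le> (\<Sum>e\<in>Basis. ?q e)" using l \<epsilon>2 by simp
    then have "r\<^sup>2 * - \<eta> \<le> r\<^sup>2 * (\<Sum>e\<in>Basis. ?q e)" by (intro mult_left_mono) auto
    also have "\<dots> = (\<Sum>e\<in>Basis. ?q (r *\<^sub>R e))" by (simp add: frame_quadratic_scale sum_distrib_left)
    also have "\<dots> \<le> discrete_laplacian (\<lambda>x. - infdist x (frontier \<Omega>)) r (w + D *\<^sub>R n)"
      unfolding discrete_laplacian_def
    proof (rule sum_mono)
      fix e :: 'a assume e: "e \<in> Basis"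
      have "norm (r *\<^sub>R e) < d" "norm (- (r *\<^sub>R e)) < d" using e r by auto
      from d(2)[OF this(1)] d(2)[OF this(2)]
      show "?q (r *\<^sub>R e) \<le> second_difference (\<lambda>x. - infdist x (frontier \<Omega>)) (r *\<^sub>R e) (w + D *\<^sub>R n)"
        using frame_quadratic_scale[of "\<lambda>b. l b - \<epsilon>" B "-1" "r *\<^sub>R e"]
        by (simp add: second_difference_def D(3))
    qed
    finally show "- \<eta> * r\<^sup>2 \<le> discrete_laplacian (\<lambda>x. - infdist x (frontier \<Omega>)) r (w + D *\<^sub>R n)"
      by (simp add: mult.commute)
  qed
qed

text \<open>A nearest point \<open>w\<close> of \<open>z\<close> bounds the distances at
  \<open>z + h\<close> and \<open>z - h\<close>; by the parallelogram law their sum is at most twice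
  the root of \<open>E^2 + (norm h)^2\<close>, hence at most
  \<open>2 * E + (norm h)^2 / E\<close>.\<close>

lemma second_difference_infdist_lower:
  fixes z :: "'a::euclidean_space"
  assumes F: "closed F" "F \<noteq> {}" and D: "0 < D" "D \<le> infdist z F"
  shows "- (norm h)\<^sup>2 / D \<le> second_difference (\<lambda>x. - infdist x F) h z"
proof -
  obtain w where w: "w \<in> F" "infdist z F = dist z w" using infdist_attains_inf[OF F] by blast
  define E where "E = dist z w"
  have E: "D \<le> E" "0 < E" using D w by (auto simp: E_def)
  let ?a = "norm (z - w + h)" and ?b = "norm (z - w - h)"
  have "(?a + ?b)\<^sup>2 \<le> 2 * (?a\<^sup>2 + ?b\<^sup>2)" using sum_squares_bound[of ?a ?b] by (simp add: power2_sum)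
  also have "?a\<^sup>2 + ?b\<^sup>2 = 2 * (E\<^sup>2 + (norm h)\<^sup>2)"
    unfolding E_def dist_norm power2_norm_eq_inner by (simp add: inner_simps inner_commute)
  also have "2 * (2 * (E\<^sup>2 + (norm h)\<^sup>2)) \<le> (2 * E + (norm h)\<^sup>2 / E)\<^sup>2"
    using E by (simp add: power2_sum power_divide field_simps power2_eq_square)
  finally have "?a + ?b \<le> 2 * E + (norm h)\<^sup>2 / E" using E by (intro power2_le_imp_le[of "?a + ?b"]) auto
  also have "(norm h)\<^sup>2 / E \<le> (norm h)\<^sup>2 / D" using E D by (intro divide_left_mono) auto
  finally have "?a + ?b \<le> 2 * E + (norm h)\<^sup>2 / D" by simp
  moreover have "infdist (z + h) F \<le> ?a" "infdist (z - h) F \<le> ?b"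
    using infdist_le[OF w(1), of "z + h"] infdist_le[OF w(1), of "z - h"] by (simp_all add: dist_norm algebra_simps)
  ultimately show ?thesis by (simp add: second_difference_def w(2) E_def)
qed

section \<open>The distance to the boundary from below\<close>

text \<open>Along the normal the exact distance function has tangential Hessian \<open>- B t\<close> with \<open>B' = B ^ 2\<close>; here \<open>B\<close> is
  replaced by a linear function of slope \<open>K\<close> larger than \<open>B ^ 2\<close>, which makes the gradient at most \<open>1\<close>.\<close>

definition comparison :: "'a::euclidean_space \<Rightarrow> 'a set \<Rightarrow> ('a \<Rightarrow> real) \<Rightarrow> real \<Rightarrow> 'a \<Rightarrow> real" where
  "comparison n B m K y = n \<bullet> y - (\<Sum>b\<in>B. (m b + K * (n \<bullet> y)) * (y \<bullet> b)\<^sup>2) / 2"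

lemma comparison_has_derivative:
  "(comparison n B m K has_derivative
     (\<lambda>h. ((1 - K * (\<Sum>b\<in>B. (y \<bullet> b)\<^sup>2) / 2) *\<^sub>R n - (\<Sum>b\<in>B. ((m b + K * (n \<bullet> y)) * (y \<bullet> b)) *\<^sub>R b)) \<bullet> h)) (at y within S)"
proof -
  have sq: "((\<lambda>y. (y \<bullet> b)\<^sup>2) has_derivative (\<lambda>h. 2 * (y \<bullet> b) * (h \<bullet> b))) (at y within S)" for b
    by (auto intro!: derivative_eq_intros simp: power2_eq_square fun_eq_iff)
  have lin: "((\<lambda>y. m b + K * (n \<bullet> y)) has_derivative (\<lambda>h. K * (n \<bullet> h))) (at y within S)" for b
    by (auto intro!: derivative_eq_intros)
  have "(comparison n B m K has_derivative
      (\<lambda>h. n \<bullet> h - (\<Sum>b\<in>B. (m b + K * (n \<bullet> y)) * (2 * (y \<bullet> b) * (h \<bullet> b)) + K * (n \<bullet> h) * (y \<bullet> b)\<^sup>2) / 2)) (at y within S)"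
    unfolding comparison_def[abs_def]
    by (intro has_derivative_diff bounded_linear.has_derivative[OF bounded_linear_divide] has_derivative_sum has_derivative_mult lin sq
        has_derivative_inner_right has_derivative_ident)
  also have "(\<lambda>h. n \<bullet> h - (\<Sum>b\<in>B. (m b + K * (n \<bullet> y)) * (2 * (y \<bullet> b) * (h \<bullet> b)) + K * (n \<bullet> h) * (y \<bullet> b)\<^sup>2) / 2)
    = (\<lambda>h. ((1 - K * (\<Sum>b\<in>B. (y \<bullet> b)\<^sup>2) / 2) *\<^sub>R n - (\<Sum>b\<in>B. ((m b + K * (n \<bullet> y)) * (y \<bullet> b)) *\<^sub>R b)) \<bullet> h)"
  proof
    fix h
    have "(\<Sum>b\<in>B. (m b + K * (n \<bullet> y)) * (2 * (y \<bullet> b) * (h \<bullet> b))) = 2 * (\<Sum>b\<in>B. ((m b + K * (n \<bullet> y)) * (y \<bullet> b)) * (b \<bullet> h))"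
      by (simp add: sum_distrib_left inner_commute mult_ac)
    then show "n \<bullet> h - (\<Sum>b\<in>B. (m b + K * (n \<bullet> y)) * (2 * (y \<bullet> b) * (h \<bullet> b)) + K * (n \<bullet> h) * (y \<bullet> b)\<^sup>2) / 2
      = ((1 - K * (\<Sum>b\<in>B. (y \<bullet> b)\<^sup>2) / 2) *\<^sub>R n - (\<Sum>b\<in>B. ((m b + K * (n \<bullet> y)) * (y \<bullet> b)) *\<^sub>R b)) \<bullet> h"
      by (simp add: sum.distrib inner_diff_left inner_sum_left sum_distrib_left[symmetric] add_divide_distrib algebra_simps)
  qed
  finally show ?thesis .
qed

text \<open>The normal component of the gradient is \<open>1 - K * p / 2\<close>, which lowers the
  squared norm by about \<open>K * p\<close>. The tangential components add at most
  \<open>(A + 1)^2 * p = K * p / 2\<close>; this is the origin of \<open>K\<close>. The radius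
  \<open>1 / K\<close> gives \<open>\<bar>K * s\<bar> \<le> 1\<close> and
  \<open>K * p \<le> 1\<close>.\<close>

lemma comparison_lipschitz:
  assumes frame: "normal_frame n B"
  obtains K \<delta> where "0 < K" "0 < \<delta>" "\<And>x y. norm x < \<delta> \<Longrightarrow> norm y < \<delta> \<Longrightarrow> \<bar>comparison n B m K x - comparison n B m K y\<bar> \<le> norm (x - y)"
proof -
  have fB: "finite B" and n1: "norm n = 1" "n \<bullet> n = 1" and nB: "\<And>b. b \<in> B \<Longrightarrow> n \<bullet> b = 0"
    using frame by (auto simp: normal_frame_def norm_eq_1)
  define A where "A = (\<Sum>b\<in>B. \<bar>m b\<bar>)"
  have A: "0 \<le> A" "\<And>b. b \<in> B \<Longrightarrow> \<bar>m b\<bar> \<le> A"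
    using fB by (auto simp: A_def sum_nonneg intro: member_le_sum)
  define K where "K = 2 * (A + 1)\<^sup>2"
  have "1 \<le> (A + 1)\<^sup>2" using A by (simp add: one_le_power)
  then have K: "2 \<le> K" by (simp add: K_def)
  show thesis
  proof (rule that[of K "1 / K"])
    show "0 < K" "0 < 1 / K" using K by auto
    fix x y :: 'a assume xy: "norm x < 1 / K" "norm y < 1 / K"
    let ?\<psi> = "comparison n B m K"
    let ?G = "\<lambda>y. (1 - K * (\<Sum>b\<in>B. (y \<bullet> b)\<^sup>2) / 2) *\<^sub>R n - (\<Sum>b\<in>B. ((m b + K * (n \<bullet> y)) * (y \<bullet> b)) *\<^sub>R b)"
    have "norm (?\<psi> x - ?\<psi> y) \<le> 1 * norm (x - y)"
    proof (rule differentiable_bound[where S="ball 0 (1 / K)" and f'="\<lambda>y h. ?G y \<bullet> h"])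
      show "convex (ball (0::'a) (1 / K))" by simp
      show "x \<in> ball 0 (1 / K)" "y \<in> ball 0 (1 / K)" using xy by auto
      fix y :: 'a assume y: "y \<in> ball 0 (1 / K)"
      show "(?\<psi> has_derivative (\<lambda>h. ?G y \<bullet> h)) (at y within ball 0 (1 / K))"
        by (rule comparison_has_derivative)
      define p where "p = (\<Sum>b\<in>B. (y \<bullet> b)\<^sup>2)"
      define s where "s = n \<bullet> y"
      have p0: "0 \<le> p" by (simp add: p_def sum_nonneg)
      have ny: "norm y < 1 / K" using y by simp
      have "\<bar>s\<bar> \<le> norm y" unfolding s_def using Cauchy_Schwarz_ineq2[of n y] n1 by simp
      then have "\<bar>s\<bar> * K \<le> 1" using ny K by (simp add: pos_less_divide_eq) (smt (verit) mult_right_mono)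
      then have Ks: "\<bar>K * s\<bar> \<le> 1" using K by (simp add: abs_mult mult.commute)
      have "K * p \<le> 1"
      proof -
        have "p \<le> (norm y)\<^sup>2" using normal_frame_norm[OF frame, of y] by (simp add: p_def)
        also have "\<dots> \<le> (1 / K)\<^sup>2" using ny by (intro power_mono) auto
        finally have "K * p \<le> K * (1 / K)\<^sup>2" using K by (intro mult_left_mono) auto
        also have "\<dots> = 1 / K" using K by (simp add: power2_eq_square)
        also have "\<dots> \<le> 1" using K by simp
        finally show ?thesis .
      qed
      then have "(K * p) * (K * p) \<le> 1 * (K * p)" using K p0 by (intro mult_right_mono) auto
      then have Kp: "(K * p)\<^sup>2 \<le> K * p" by (simp add: power2_eq_square)
      have Gn: "n \<bullet> ?G y = 1 - K * p / 2"
        using n1 nB by (simp add: inner_diff_right inner_sum_right p_def)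
      have Gb: "?G y \<bullet> b = - ((m b + K * s) * (y \<bullet> b))" if b: "b \<in> B" for b
        unfolding inner_diff_left normal_frame_inner_sum[OF frame b] using nB[OF b] by (simp add: s_def)
      have "(norm (?G y))\<^sup>2 = (1 - K * p / 2)\<^sup>2 + (\<Sum>b\<in>B. (?G y \<bullet> b)\<^sup>2)"
        unfolding normal_frame_norm[OF frame, of "?G y"] Gn ..
      also have "(\<Sum>b\<in>B. (?G y \<bullet> b)\<^sup>2) = (\<Sum>b\<in>B. (m b + K * s)\<^sup>2 * (y \<bullet> b)\<^sup>2)"
        by (intro sum.cong refl) (simp only: Gb power2_minus power_mult_distrib)
      finally have "(norm (?G y))\<^sup>2 = (1 - K * p / 2)\<^sup>2 + (\<Sum>b\<in>B. (m b + K * s)\<^sup>2 * (y \<bullet> b)\<^sup>2)" .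
      moreover have "(\<Sum>b\<in>B. (m b + K * s)\<^sup>2 * (y \<bullet> b)\<^sup>2) \<le> (\<Sum>b\<in>B. (A + 1)\<^sup>2 * (y \<bullet> b)\<^sup>2)"
      proof (intro sum_mono mult_right_mono)
        fix b assume "b \<in> B"
        then have "\<bar>m b + K * s\<bar> \<le> \<bar>A + 1\<bar>" using A(2)[of b] A(1) Ks by linarith
        then show "(m b + K * s)\<^sup>2 \<le> (A + 1)\<^sup>2" by (simp only: abs_le_square_iff)
      qed simp
      moreover have "(\<Sum>b\<in>B. (A + 1)\<^sup>2 * (y \<bullet> b)\<^sup>2) = K * p / 2"
        unfolding p_def K_def sum_distrib_left[symmetric] by simp
      moreover have "(1 - K * p / 2)\<^sup>2 = 1 - K * p + (K * p)\<^sup>2 / 4"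
        by (simp add: power2_eq_square field_simps)
      moreover have "0 \<le> K * p" using K p0 by simp
      ultimately have "(norm (?G y))\<^sup>2 \<le> 1\<^sup>2" using Kp by simp
      then have G1: "norm (?G y) \<le> 1" by (rule power2_le_imp_le) simp
      show "onorm (\<lambda>h. ?G y \<bullet> h) \<le> 1"
      proof (rule onorm_le)
        fix h
        have "\<bar>?G y \<bullet> h\<bar> \<le> norm (?G y) * norm h" by (rule Cauchy_Schwarz_ineq2)
        also have "\<dots> \<le> 1 * norm h" using G1 by (intro mult_right_mono) auto
        finally show "norm (?G y \<bullet> h) \<le> 1 * norm h" by simp
      qed
    qed
    then show "\<bar>?\<psi> x - ?\<psi> y\<bar> \<le> norm (x - y)" by simp
  qed
qed

text \<open>On the frontier both halves of \<open>osculating\<close> apply, so \<open>s\<close>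
  equals \<open>q / 2\<close> up to \<open>\<epsilon> * p / 4\<close>. Raising every curvature by
  \<open>\<epsilon>\<close> subtracts \<open>\<epsilon> * p / 2\<close>, which covers this error and
  another \<open>\<epsilon> * p / 4\<close> from the \<open>K\<close> term.\<close>

lemma comparison_frontier:
  assumes frame: "normal_frame n B" and osc: "osculating \<Omega> w n B l" and op: "open \<Omega>"
    and \<epsilon>: "0 < \<epsilon>" and K: "0 < K"
  obtains \<delta> where "0 < \<delta>" "\<And>y. norm y < \<delta> \<Longrightarrow> w + y \<in> frontier \<Omega> \<Longrightarrow> comparison n B (\<lambda>b. l b + \<epsilon>) K y \<le> 0"
proof -
  have fB: "finite B" and n1: "norm n = 1" using frame by (auto simp: normal_frame_def)
  define \<Lambda> where "\<Lambda> = (\<Sum>b\<in>B. \<bar>l b\<bar>)"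
  have \<Lambda>: "0 \<le> \<Lambda>" by (simp add: \<Lambda>_def sum_nonneg)
  \<comment> \<open>The bound 1/4 lets \<open>\<bar>s\<bar>\<close> be absorbed on the left, giving
    \<open>\<bar>s\<bar> \<le> (\<Lambda> + 1) * p\<close>; the other bound then turns the remaining
    error \<open>(2 * \<Lambda> + 3) * p\<close> into \<open>\<epsilon> * p / 4\<close>.\<close>
  define \<eta> where "\<eta> = min (1/4) (\<epsilon> / (4 * (2 * \<Lambda> + 3)))"
  have \<eta>: "0 < \<eta>" using \<epsilon> \<Lambda> by (simp add: \<eta>_def add_nonneg_pos)
  have \<eta>4: "\<eta> \<le> 1/4" unfolding \<eta>_def by (rule min.cobounded1)
  have "\<eta> \<le> \<epsilon> / (4 * (2 * \<Lambda> + 3))" by (simp add: \<eta>_def)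
  then have \<eta>\<epsilon>: "\<eta> * (2 * \<Lambda> + 3) \<le> \<epsilon> / 4" using \<Lambda> by (simp add: pos_le_divide_eq add_nonneg_pos algebra_simps)
  obtain d1 where d1: "d1 > 0"
    "\<And>y. norm y < d1 \<Longrightarrow> w + y \<in> closure \<Omega> \<Longrightarrow> frame_quadratic l B y / 2 - \<eta> * (\<bar>n \<bullet> y\<bar> + (norm y)\<^sup>2) \<le> n \<bullet> y"
    by (rule osculating_closure[OF osc \<eta>]) (rule that)
  obtain d2 where d2: "d2 > 0"
    "\<And>y. norm y < d2 \<Longrightarrow> w + y \<notin> \<Omega> \<Longrightarrow> n \<bullet> y \<le> frame_quadratic l B y / 2 + \<eta> * (\<bar>n \<bullet> y\<bar> + (norm y)\<^sup>2)"
    by (rule osculating_outside[OF osc \<eta>]) (rule that)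
  define \<delta> where "\<delta> = min (min d1 d2) (min 1 (\<epsilon> / (2 * K)))"
  show thesis
  proof (rule that)
    show "0 < \<delta>" using d1 d2 \<epsilon> K by (simp add: \<delta>_def)
    fix y :: 'a assume y: "norm y < \<delta>" and wy: "w + y \<in> frontier \<Omega>"
    define s where "s = n \<bullet> y"
    define p where "p = (\<Sum>b\<in>B. (y \<bullet> b)\<^sup>2)"
    define q where "q = frame_quadratic l B y"
    have p0: "0 \<le> p" by (simp add: p_def sum_nonneg)
    have ns: "(norm y)\<^sup>2 = s\<^sup>2 + p" unfolding s_def p_def by (rule normal_frame_norm[OF frame])
    have sy: "\<bar>s\<bar> \<le> norm y" unfolding s_def using Cauchy_Schwarz_ineq2[of n y] n1 by simp
    have yd: "norm y < d1" "norm y < d2" "norm y < 1" "norm y < \<epsilon> / (2 * K)" using y by (simp_all add: \<delta>_def)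
    have "\<bar>s\<bar> * \<bar>s\<bar> \<le> 1 * \<bar>s\<bar>" using sy yd(3) by (intro mult_right_mono) auto
    then have s2: "s\<^sup>2 \<le> \<bar>s\<bar>" by (simp add: power2_eq_square)
    have "w + y \<in> closure \<Omega>" "w + y \<notin> \<Omega>"
      using wy op by (auto simp: frontier_def interior_open)
    with d1(2)[OF yd(1)] d2(2)[OF yd(2)]
    have "\<bar>s - q / 2\<bar> \<le> \<eta> * (\<bar>s\<bar> + (s\<^sup>2 + p))"
      unfolding s_def[symmetric] q_def[symmetric] ns by (simp add: abs_le_iff)
    also have "\<dots> \<le> \<eta> * (2 * \<bar>s\<bar> + p)" using s2 \<eta> by (intro mult_left_mono) auto
    finally have 1: "\<bar>s - q / 2\<bar> \<le> \<eta> * (2 * \<bar>s\<bar> + p)" .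
    have 2: "\<bar>q\<bar> \<le> \<Lambda> * p" unfolding q_def \<Lambda>_def p_def by (rule frame_quadratic_bound[OF fB])
    have "\<eta> * (2 * \<bar>s\<bar> + p) \<le> 1/4 * (2 * \<bar>s\<bar> + p)" using \<eta>4 p0 by (intro mult_right_mono) auto
    also have "\<dots> = \<bar>s\<bar> / 2 + p / 4" by simp
    finally have "\<bar>s - q / 2\<bar> \<le> \<bar>s\<bar> / 2 + p / 4" using 1 by (rule order_trans[rotated])
    then have "\<bar>s\<bar> \<le> \<Lambda> * p + p" using 2 p0 by linarith
    then have "2 * \<bar>s\<bar> + p \<le> (2 * \<Lambda> + 3) * p" by (simp add: algebra_simps)
    then have "\<eta> * (2 * \<bar>s\<bar> + p) \<le> \<eta> * ((2 * \<Lambda> + 3) * p)" using \<eta> by (intro mult_left_mono) auto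
    also have "\<dots> = (\<eta> * (2 * \<Lambda> + 3)) * p" by simp
    also have "\<dots> \<le> \<epsilon> / 4 * p" by (rule mult_right_mono[OF \<eta>\<epsilon> p0])
    finally have 3: "s - q / 2 \<le> \<epsilon> * p / 4" using 1 by simp
    have "\<bar>s\<bar> \<le> \<epsilon> / (2 * K)" using sy yd(4) by simp
    then have "K * \<bar>s\<bar> \<le> \<epsilon> / 2" using K by (simp add: field_simps)
    moreover have "K * - s \<le> K * \<bar>s\<bar>" using K by (intro mult_left_mono) auto
    ultimately have "- (K * s) \<le> \<epsilon> / 2" by simp
    then have "- (K * s) * p \<le> \<epsilon> / 2 * p" by (rule mult_right_mono[OF _ p0])
    then have 4: "- (K * s * p) \<le> \<epsilon> * p / 2" by simp
    have "comparison n B (\<lambda>b. l b + \<epsilon>) K y = s - (q + \<epsilon> * p + K * s * p) / 2"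
      unfolding comparison_def s_def[symmetric] q_def p_def frame_quadratic_def
      by (simp add: distrib_right sum.distrib sum_distrib_left)
    then show "comparison n B (\<lambda>b. l b + \<epsilon>) K y \<le> 0" using 3 4 by (simp add: add_divide_distrib)
  qed
qed

text \<open>From a nearest point of \<open>F\<close>, where \<open>\<psi>\<close> is nonpositive,
  \<open>\<psi>\<close> can grow by at most the distance travelled. Halving the radius keeps that
  nearest point within reach of both hypotheses.\<close>

lemma comparison_le_infdist:
  assumes w: "w \<in> F" "closed F" and \<psi>: "\<And>y. norm y < \<delta> \<Longrightarrow> w + y \<in> F \<Longrightarrow> \<psi> y \<le> 0"
    and lip: "\<And>x y. norm x < \<delta> \<Longrightarrow> norm y < \<delta> \<Longrightarrow> \<bar>\<psi> x - \<psi> y\<bar> \<le> norm (x - y)"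
    and y: "norm y < \<delta> / 2"
  shows "\<psi> y \<le> infdist (w + (y::'a::euclidean_space)) F"
proof -
  have "F \<noteq> {}" using w by blast
  then obtain v where v: "v \<in> F" "infdist (w + y) F = dist (w + y) v" using infdist_attains_inf[OF w(2)] by blast
  have "dist (w + y) v \<le> norm y" using infdist_le[OF w(1), of "w + y"] v(2) by (simp add: dist_norm)
  then have "norm (y - (v - w)) \<le> norm y" by (simp add: dist_norm algebra_simps)
  then have "norm (v - w) < \<delta>"
    using y norm_triangle_ineq4[of y "y - (v - w)"] by simp
  moreover have "norm y < \<delta>" using y norm_ge_zero[of y] by linarith
  ultimately have "\<psi> y - \<psi> (v - w) \<le> norm (y - (v - w))" "\<psi> (v - w) \<le> 0"
    using lip[of y "v - w"] \<psi>[of "v - w"] v(1) by auto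
  then have "\<psi> y \<le> norm (y - (v - w))" by linarith
  also have "\<dots> = infdist (w + y) F" unfolding v(2) by (simp add: dist_norm algebra_simps)
  finally show ?thesis .
qed

text \<open>Expansion about a point on the normal into a constant, a tangential quadratic form and
  an odd remainder; the remainder integrates to 0 over centred balls.\<close>

lemma comparison_shift:
  assumes "normal_frame n B"
  shows "comparison n B m K (t *\<^sub>R n + y) = t - (\<Sum>b\<in>B. (m b + K * t) / 2 * (y \<bullet> b)\<^sup>2)
     + (n \<bullet> y - K / 2 * ((n \<bullet> y) * (\<Sum>b\<in>B. (y \<bullet> b)\<^sup>2)))"
proof -
  have n: "n \<bullet> n = 1" "\<And>b. b \<in> B \<Longrightarrow> n \<bullet> b = 0" using assms by (auto simp: normal_frame_def norm_eq_1)
  have "(\<Sum>b\<in>B. (m b + K * (n \<bullet> (t *\<^sub>R n + y))) * ((t *\<^sub>R n + y) \<bullet> b)\<^sup>2)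
      = (\<Sum>b\<in>B. (m b + K * t) * (y \<bullet> b)\<^sup>2 + K * (n \<bullet> y) * (y \<bullet> b)\<^sup>2)"
    using n by (intro sum.cong refl) (simp add: inner_add_left inner_add_right algebra_simps)
  also have "\<dots> = (\<Sum>b\<in>B. (m b + K * t) * (y \<bullet> b)\<^sup>2) + K * (n \<bullet> y) * (\<Sum>b\<in>B. (y \<bullet> b)\<^sup>2)"
    by (simp add: sum.distrib sum_distrib_left)
  finally have "comparison n B m K (t *\<^sub>R n + y) =
      t + n \<bullet> y - ((\<Sum>b\<in>B. (m b + K * t) * (y \<bullet> b)\<^sup>2) + K * (n \<bullet> y) * (\<Sum>b\<in>B. (y \<bullet> b)\<^sup>2)) / 2"
    unfolding comparison_def using n(1) by (simp add: inner_add_right)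
  moreover have "(\<Sum>b\<in>B. (m b + K * t) / 2 * (y \<bullet> b)\<^sup>2) = (\<Sum>b\<in>B. (m b + K * t) * (y \<bullet> b)\<^sup>2) / 2"
    unfolding sum_divide_distrib by simp
  ultimately show ?thesis by (simp add: add_divide_distrib)
qed

text \<open>At \<open>x = w + t n\<close> the value of \<open>u\<close> is at least
  \<open>- t\<close>, while on a ball around \<open>x\<close> the comparison function bounds
  \<open>u\<close> above with mean \<open>- t\<close> plus a positive multiple of a perturbed trace.
  Small \<open>\<epsilon>\<close> and \<open>t\<close> keep that trace negative.\<close>

lemma not_subharmonic_of_negative_trace:
  fixes \<Omega> :: "'a::euclidean_space set"
  assumes op: "open \<Omega>" and w: "w \<in> frontier \<Omega>" and frame: "normal_frame n B"
    and osc: "osculating \<Omega> w n B l" and neg: "sum l B < 0"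
  shows "\<not> subharmonic_on \<Omega> (\<lambda>x. - infdist x (frontier \<Omega>))"
proof
  assume sub: "subharmonic_on \<Omega> (\<lambda>x. - infdist x (frontier \<Omega>))"
  let ?F = "frontier \<Omega>"
  let ?u = "\<lambda>x. - infdist x ?F"
  have n1: "norm n = 1" and nb: "\<And>b. b \<in> B \<Longrightarrow> norm b = 1" and nB: "\<And>b. b \<in> B \<Longrightarrow> n \<bullet> b = 0" and fB: "finite B"
    using frame by (auto simp: normal_frame_def)
  define k where "k = real (card B)"
  have k: "0 \<le> k" by (simp add: k_def)
  \<comment> \<open>Raising all curvatures by this \<open>\<epsilon>\<close> uses up at most half of
    the negative trace.\<close>
  define \<epsilon> where "\<epsilon> = - sum l B / (2 * (k + 1))"
  have \<epsilon>: "0 < \<epsilon>" using neg k by (simp add: \<epsilon>_def field_simps add_nonneg_pos)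
  have "\<epsilon> * (2 * (k + 1)) = - sum l B" using k by (simp add: \<epsilon>_def add_nonneg_pos)
  then have \<epsilon>k: "sum l B + \<epsilon> * k < 0" using \<epsilon> mult_nonneg_nonneg[OF less_imp_le[OF \<epsilon>] k] by (simp add: algebra_simps)
  obtain K \<delta>1 where K: "0 < K" "0 < \<delta>1" "\<And>x y. norm x < \<delta>1 \<Longrightarrow> norm y < \<delta>1 \<Longrightarrow>
      \<bar>comparison n B (\<lambda>b. l b + \<epsilon>) K x - comparison n B (\<lambda>b. l b + \<epsilon>) K y\<bar> \<le> norm (x - y)"
    by (rule comparison_lipschitz[OF frame, of "\<lambda>b. l b + \<epsilon>"]) (rule that)
  define \<psi> where "\<psi> = comparison n B (\<lambda>b. l b + \<epsilon>) K"
  obtain \<delta>2 where \<delta>2: "0 < \<delta>2" "\<And>y. norm y < \<delta>2 \<Longrightarrow> w + y \<in> ?F \<Longrightarrow> comparison n B (\<lambda>b. l b + \<epsilon>) K y \<le> 0"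
    by (rule comparison_frontier[OF frame osc op \<epsilon> K(1)]) (rule that)
  define \<delta> where "\<delta> = min \<delta>1 \<delta>2"
  have \<delta>: "0 < \<delta>" using K \<delta>2 by (simp add: \<delta>_def)
  have low: "\<psi> y \<le> infdist (w + y) ?F" if "norm y < \<delta> / 2" for y
    using w that K(3) \<delta>2(2)
    by (intro comparison_le_infdist[where \<delta>=\<delta>]) (auto simp: \<delta>_def \<psi>_def)
  obtain d where d: "d > 0"
    "\<And>y. norm y < d \<Longrightarrow> w + y \<notin> \<Omega> \<Longrightarrow> n \<bullet> y \<le> frame_quadratic l B y / 2 + 1/4 * (\<bar>n \<bullet> y\<bar> + (norm y)\<^sup>2)"
    by (rule osculating_outside[OF osc, of "1/4"]) (simp, rule that)
  \<comment> \<open>The first bound keeps a ball around \<open>w + t n\<close> in the range of the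
    comparison, the next two put the point inside the domain, and the last makes the growth
    \<open>K * t * k\<close> of the trace along the normal at most half of the remaining
    slack.\<close>
  define t where "t = min (min (\<delta> / 4) (d / 2)) (min 1 (- (sum l B + \<epsilon> * k) / (2 * K * (k + 1))))"
  have t: "0 < t" "t < \<delta> / 2" "t < d" "t \<le> 1" "t \<le> - (sum l B + \<epsilon> * k) / (2 * K * (k + 1))"
    using \<delta> d(1) \<epsilon>k K(1) k by (auto simp: t_def divide_neg_pos add_nonneg_pos)
  have trace: "sum l B + \<epsilon> * k + K * t * k < 0"
  proof -
    have "t * (2 * K * (k + 1)) \<le> - (sum l B + \<epsilon> * k)" using t(5) K(1) k by (simp only: pos_le_divide_eq add_nonneg_pos zero_less_one mult_pos_pos zero_less_numeral)
    moreover have "t * (2 * K * (k + 1)) = 2 * (K * t * k) + 2 * (K * t)" by (simp add: algebra_simps)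
    moreover have "0 < K * t" "0 \<le> K * t * k" using K t k by auto
    ultimately show ?thesis by linarith
  qed
  have "w + t *\<^sub>R n \<in> \<Omega>"
  proof (rule ccontr)
    assume "w + t *\<^sub>R n \<notin> \<Omega>"
    moreover have "frame_quadratic l B (t *\<^sub>R n) = 0" using nB by (simp add: frame_quadratic_def)
    moreover have "n \<bullet> (t *\<^sub>R n) = t" using n1 by (simp add: norm_eq_1)
    ultimately have "t \<le> 1/4 * (t + t\<^sup>2)" using d(2)[of "t *\<^sub>R n"] t n1 by simp
    then have "4 * t \<le> t + t\<^sup>2" by (simp add: field_simps)
    moreover have "t\<^sup>2 \<le> t" using t by (simp add: power2_eq_square mult_left_le)
    ultimately show False using t(1) by linarith
  qed
  then obtain r0 where r0: "0 < r0" "cball (w + t *\<^sub>R n) r0 \<subseteq> \<Omega>" using op open_contains_cball by blast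
  define r where "r = min r0 ((\<delta> / 2 - t) / 2)"
  have r: "0 < r" "t + r < \<delta> / 2" using r0 t by (simp_all add: r_def min_def field_simps)
  define x where "x = w + t *\<^sub>R n"
  have "cball x r \<subseteq> \<Omega>" using r0 by (auto simp: x_def r_def)
  then have mean: "?u x \<le> (LINT y:cball x r|lborel. ?u y) / measure lborel (cball x r)"
    using sub r(1) unfolding subharmonic_on_def by blast
  have ux: "?u x \<ge> - t"
    using infdist_le[OF w, of x] n1 t(1) by (simp add: x_def dist_norm)
  define vol where "vol = measure lborel (cball x r)"
  have vol: "vol > 0" "vol = measure lborel (cball (0::'a) r)"
    using content_cball_pos[OF r(1), of x] by (simp_all add: vol_def content_cball less_imp_le[OF r(1)])
  have "- t * vol \<le> ?u x * vol" using ux vol by (intro mult_right_mono) auto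
  also have "\<dots> \<le> (LINT y:cball x r|lborel. ?u y)"
    using mean vol(1) by (simp add: pos_le_divide_eq flip: vol_def)
  also have "\<dots> = (LINT y:cball 0 r|lborel. ?u (x + y))"
    by (intro cball_integral_translation continuous_intros)
  finally have lower: "- t * vol \<le> (LINT y:cball 0 r|lborel. ?u (x + y))" .
  obtain c where c: "0 < c" "\<And>v::'a. (LINT y:cball 0 r|lborel. (y \<bullet> v)\<^sup>2) = c * (norm v)\<^sup>2"
    using cball_integral_square[of r] r(1) by metis
  define f1 where "f1 y = (\<Sum>b\<in>B. (l b + \<epsilon> + K * t) / 2 * (y \<bullet> b)\<^sup>2)" for y
  define f2 where "f2 y = K / 2 * ((n \<bullet> y) * (\<Sum>b\<in>B. (y \<bullet> b)\<^sup>2)) - n \<bullet> y" for y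
  have cont: "continuous_on UNIV f1" "continuous_on UNIV f2"
    unfolding f1_def f2_def by (intro continuous_intros)+
  have "(LINT y:cball 0 r|lborel. ?u (x + y)) \<le> (LINT y:cball 0 r|lborel. (- t + f1 y) + f2 y)"
  proof (rule set_integral_mono)
    show "set_integrable lborel (cball 0 r) (\<lambda>y. ?u (x + y))" "set_integrable lborel (cball 0 r) (\<lambda>y. (- t + f1 y) + f2 y)"
      by (intro set_integrable_cball continuous_intros cont)+
    fix y :: 'a assume "y \<in> cball 0 r"
    then have "norm (t *\<^sub>R n + y) < \<delta> / 2"
      using norm_triangle_ineq[of "t *\<^sub>R n" y] n1 t(1) r(2) by simp
    from low[OF this] show "?u (x + y) \<le> (- t + f1 y) + f2 y"
      unfolding \<psi>_def comparison_shift[OF frame] by (simp add: x_def f1_def f2_def add.assoc)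
  qed
  also have "\<dots> = (LINT y:cball 0 r|lborel. - t + f1 y) + (LINT y:cball 0 r|lborel. f2 y)"
    by (intro set_integral_add set_integrable_cball continuous_intros cont)
  also have "(LINT y:cball 0 r|lborel. f2 y) = 0"
    by (rule cball_integral_odd[OF cont(2)]) (simp add: f2_def)
  also have "(LINT y:cball 0 r|lborel. - t + f1 y) = (LINT y:cball (0::'a) r|lborel. - t) + (LINT y:cball 0 r|lborel. f1 y)"
    by (intro set_integral_add set_integrable_cball continuous_intros cont)
  also have "(LINT y:cball (0::'a) r|lborel. - t) = - t * vol"
    using vol(2) by (simp add: set_lebesgue_integral_def)
  also have "(LINT y:cball 0 r|lborel. f1 y) = (\<Sum>b\<in>B. (l b + \<epsilon> + K * t) / 2 * c)"
  proof -
    have "(LINT y:cball 0 r|lborel. f1 y) = (\<Sum>b\<in>B. LINT y:cball 0 r|lborel. (l b + \<epsilon> + K * t) / 2 * (y \<bullet> b)\<^sup>2)"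
      unfolding f1_def by (intro cball_integral_sum continuous_intros)
    also have "\<dots> = (\<Sum>b\<in>B. (l b + \<epsilon> + K * t) / 2 * (LINT y:cball 0 r|lborel. (y \<bullet> b)\<^sup>2))"
      by (intro sum.cong refl set_integral_mult_right)
    finally show ?thesis using nb by (simp add: c(2))
  qed
  also have "\<dots> = c / 2 * (sum l B + \<epsilon> * k + K * t * k)"
  proof -
    have "(\<Sum>b\<in>B. (l b + \<epsilon> + K * t) / 2 * c) = (\<Sum>b\<in>B. l b + \<epsilon> + K * t) * (c / 2)"
      unfolding sum_distrib_right by (intro sum.cong refl) simp
    also have "(\<Sum>b\<in>B. l b + \<epsilon> + K * t) = sum l B + \<epsilon> * k + K * t * k"
      by (simp add: sum.distrib k_def)
    finally show ?thesis by simp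
  qed
  finally have "- t * vol \<le> - t * vol + c / 2 * (sum l B + \<epsilon> * k + K * t * k)" using lower by simp
  moreover have "c / 2 * (sum l B + \<epsilon> * k + K * t * k) < 0" using c(1) trace by (simp add: mult_pos_neg)
  ultimately show False by simp
qed

section \<open>Assembly of the two implications\<close>

lemma boundary_frame:
  fixes \<Omega> :: "'a::euclidean_space set"
  assumes "DIM('a) \<ge> 2" "smoothly_bounded_domain \<Omega>" "w \<in> frontier \<Omega>"
  obtains n B l where "normal_frame n B" "sum l B = (real DIM('a) - 1) * mean_curvature \<Omega> w"
    "osculating \<Omega> w n B l"
proof -
  have "open \<Omega>" "smooth_boundary \<Omega>" using assms(2) by (auto simp: smoothly_bounded_domain_def)
  from smooth_boundary_chart[OF this assms(3)] obtain U \<rho> g where chart: "boundary_chart \<Omega> U \<rho> g" "w \<in> U" .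
  interpret boundary_chart \<Omega> U \<rho> g by (fact chart(1))
  have "\<rho> w = 0" using mem_frontier_iff[OF chart(2)] assms(3) by simp
  from curvature_frame[OF chart(2) this assms(1)] show thesis using that .
qed

lemma subharmonic_of_mean_convex:
  fixes \<Omega> :: "'a::euclidean_space set"
  assumes dim: "DIM('a) \<ge> 2" and \<Omega>: "smoothly_bounded_domain \<Omega>" and mc: "mean_convex \<Omega>"
  shows "subharmonic_on \<Omega> (\<lambda>x. - infdist x (frontier \<Omega>))"
proof -
  let ?F = "frontier \<Omega>"
  let ?u = "\<lambda>x. - infdist x ?F"
  have op: "open \<Omega>" and ne: "\<Omega> \<noteq> {}" and "bounded \<Omega>" using \<Omega> by (auto simp: smoothly_bounded_domain_def)
  \<comment> \<open>Boundedness makes the frontier nonempty, which excludes the default value 0 of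
    \<open>infdist\<close> for the empty set.\<close>
  then have "\<Omega> \<noteq> UNIV" using not_bounded_UNIV by blast
  then have F: "?F \<noteq> {}" using ne frontier_not_empty by blast
  have disj: "?F \<inter> \<Omega> = {}" using op frontier_disjoint_eq by blast
  have u: "continuous_on UNIV ?u" by (intro continuous_intros)
  have pos: "0 < infdist z ?F" if "z \<in> \<Omega>" for z
    using disj that F by (intro infdist_pos_not_in_closed) auto
  have "discretely_subharmonic_on (ball x r) ?u" if sub: "cball x r \<subseteq> \<Omega>" and r: "0 < r" for x r
    unfolding discretely_subharmonic_on_def
  proof (intro conjI ballI allI impI)
    \<comment> \<open>The minimum \<open>D\<close> of the distance on the compact ball is positive
      and yields one constant for all centres.\<close>
    have "continuous_on (cball x r) (\<lambda>z. infdist z ?F)" by (intro continuous_intros)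
    from continuous_attains_inf[OF compact_cball _ this] r
    obtain z0 where z0: "z0 \<in> cball x r" "\<And>z. z \<in> cball x r \<Longrightarrow> infdist z0 ?F \<le> infdist z ?F" by auto
    define D where "D = infdist z0 ?F"
    have D: "0 < D" using pos sub z0(1) by (auto simp: D_def)
    show "\<exists>C. \<forall>z\<in>ball x r. \<forall>r>0. - C * r\<^sup>2 \<le> discrete_laplacian ?u r z"
    proof (intro exI[of _ "real DIM('a) / D"] ballI allI impI)
      fix z t assume z: "z \<in> ball x r" and t: "0 < (t::real)"
      have "(\<Sum>e\<in>(Basis :: 'a set). - (norm (t *\<^sub>R e))\<^sup>2 / D) \<le> discrete_laplacian ?u t z"
        unfolding discrete_laplacian_def
        using z0(2)[of z] z D F by (intro sum_mono second_difference_infdist_lower) (auto simp: D_def)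
      moreover have "(\<Sum>e\<in>(Basis :: 'a set). - (norm (t *\<^sub>R e))\<^sup>2 / D) = - (real DIM('a) / D) * t\<^sup>2"
        by (simp add: power_mult_distrib)
      ultimately show "- (real DIM('a) / D) * t\<^sup>2 \<le> discrete_laplacian ?u t z" by simp
    qed
  next
    fix z and \<eta> :: real assume z: "z \<in> ball x r" and \<eta>: "0 < \<eta>"
    have z\<Omega>: "z \<in> \<Omega>" using z sub by (auto simp: subset_iff)
    define D where "D = infdist z ?F"
    have D: "0 < D" using pos[OF z\<Omega>] by (simp add: D_def)
    have ball: "ball z D \<subseteq> \<Omega>" unfolding D_def by (rule ball_infdist_subset[OF z\<Omega>])
    obtain w where w: "w \<in> ?F" "infdist z ?F = dist z w" using infdist_attains_inf[OF frontier_closed F] by blast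
    obtain n B l where f: "normal_frame n B" "sum l B = (real DIM('a) - 1) * mean_curvature \<Omega> w" "osculating \<Omega> w n B l"
      by (rule boundary_frame[OF dim \<Omega> w(1)]) (rule that)
    have n1: "norm n = 1" using f(1) by (simp add: normal_frame_def)
    \<comment> \<open>This holds for any choice of nearest point, so the asymptotic bound is
      available also where the distance is not differentiable.\<close>
    have zw: "z = w + D *\<^sub>R n"
      using w(2) by (intro nearest_point_normal[OF n1 f(3) D _ ball]) (simp add: D_def)
    have "0 \<le> mean_curvature \<Omega> w" using mc w(1) by (simp add: mean_convex_def)
    then have "0 \<le> sum l B" unfolding f(2) using dim by (intro mult_nonneg_nonneg) auto
    moreover have "w \<notin> \<Omega>" using w(1) disj by blast
    moreover have "infdist (w + D *\<^sub>R n) ?F = D" by (simp only: zw[symmetric] D_def[symmetric])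
    ultimately show "\<exists>\<delta>>0. \<forall>r. 0 < r \<and> r < \<delta> \<longrightarrow> - \<eta> * r\<^sup>2 \<le> discrete_laplacian ?u r z"
      unfolding zw using ball[unfolded zw] D \<eta> by (intro discrete_laplacian_infdist_asymptotic[OF f(1,3)]) auto
  qed
  then have mean: "?u x \<le> (LINT y:cball x r|lborel. ?u y) / measure lborel (cball x r)"
    if "cball x r \<subseteq> \<Omega>" "0 < r" for x r using sub_mean_value[OF u] that by blast
  show ?thesis unfolding subharmonic_on_def
  proof (intro conjI ballI allI impI)
    fix x c assume "?u x < c"
    moreover have "(?u \<longlongrightarrow> ?u x) (at x within \<Omega>)"
      using u by (metis UNIV_I continuous_on_def subset_UNIV tendsto_within_subset)
    ultimately show "\<forall>\<^sub>F y in at x within \<Omega>. ?u y < c" by (simp only: order_tendstoD(2))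
  next
    fix x r assume "0 < r" "cball x r \<subseteq> \<Omega>"
    then show "?u x \<le> (LINT y:cball x r|lborel. ?u y) / measure lborel (cball x r)" by (intro mean)
    show "set_integrable lborel (cball x r) ?u" by (rule set_integrable_cball[OF u])
  qed
qed

theorem theorem0p5:
  fixes \<Omega> :: "(real ^ 'n) set"
  assumes "CARD('n) \<ge> 2"
    and "smoothly_bounded_domain \<Omega>"
  shows "mean_convex \<Omega> \<longleftrightarrow> subharmonic_on \<Omega> (\<lambda>x. - infdist x (frontier \<Omega>))"
proof
  have dim: "DIM(real ^ 'n) \<ge> 2" using assms(1) by simp
  show "subharmonic_on \<Omega> (\<lambda>x. - infdist x (frontier \<Omega>))" if "mean_convex \<Omega>"
    by (rule subharmonic_of_mean_convex[OF dim assms(2) that])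
  show "mean_convex \<Omega>" if sub: "subharmonic_on \<Omega> (\<lambda>x. - infdist x (frontier \<Omega>))"
    unfolding mean_convex_def
  proof (rule ballI, rule ccontr)
    fix w assume w: "w \<in> frontier \<Omega>" and neg: "\<not> 0 \<le> mean_curvature \<Omega> w"
    obtain n B l where f: "normal_frame n B" "sum l B = (real DIM(real ^ 'n) - 1) * mean_curvature \<Omega> w" "osculating \<Omega> w n B l"
      by (rule boundary_frame[OF dim assms(2) w]) (rule that)
    have "sum l B < 0" unfolding f(2) using dim neg by (intro mult_pos_neg) auto
    moreover have "open \<Omega>" using assms(2) by (simp add: smoothly_bounded_domain_def)
    ultimately show False using not_subharmonic_of_negative_trace[OF _ w f(1,3)] sub by blast
  qed
qed

end
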